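(* Assume there is a decreasing function $\Phi:\mathbb N_0\to[0,\infty)$ and constants $c_1,c_2>0$ independent of $\ell$ with $c_1\|P_\ell x\|_H\le\Phi(\ell)\|x\|_2\le c_2\|P_\ell x\|_H$ for all $x\in\mathbb R^{n_\ell}$ and all $\ell$. Let $\nu>0$ be an even integer and consider the Multigrid Monte Carlo V-cycle ($\gamma_\ell=1$) with $\nu_1=\nu_2=\nu/2$, an exact sampler on level $0$, and the same symmetric invertible splitting matrix $M_\ell=M_\ell^\top$ for pre- and post-smoothing on every level $\ell\ge1$. Assume $0<A_\ell\le M_\ell$ for all $\ell\ge1$ and $$\|M_\ell^{1/2}(A_\ell^{-1}-I_{\ell-1}^\ell A_{\ell-1}^{-1}I_\ell^{\ell-1})M_\ell^{1/2}\|_2\le C_A\qquad\text{for all }\ell\ge1$$ with $C_A>0$ independent of $\ell$. Let $f\in H$, $(f_L)_j=\langle f,\phi_j^L\rangle_H$ for $j=1,\dots,n_L$, and let $(\theta_L^{(m)})_{m\ge0}$ be the chain $\theta_L^{(m+1)}=\mathrm{MGMC}_L(A_L,f_L,\theta_L^{(m)})$, where the initial sample $\theta_L^{(0)}$ satisfies $\|A_L^{1/2}\mathrm{Cov}(\theta_L^{(0)})A_L^{1/2}\|_2<C_0$ and $\|\mathbb E[A_L^{1/2}\theta_L^{(0)}]\|_2<C_0$ for a constant $C_0$ independent of $L$. Let $I(F_L):=\mathbb E[F_L^\top\theta_L]$ with $\theta_L\sim\mathcal N(A_L^{-1}f_L,A_L^{-1})$ and $\tilde I_M(F_L):=\frac1M\sum_{m=1}^MF_L^\top\theta_L^{(m)}$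 for $M\ge1$. Then $$\sqrt{\mathbb E\bigl[|I(F_L)-\tilde I_M(F_L)|^2\bigr]}\le\frac{C}{\sqrt M},$$ where the constant $C>0$ depends on $F_L$ (through $\mathcal F$) but is independent of $M$ and $L$.
   Context: Setting: $H$ is a real separable Hilbert space; $\mathcal A$ is a self-adjoint positive definite (possibly unbounded) operator on $H$ with compact inverse $\mathcal A^{-1}:H\to H$; $V:=D(\mathcal A^{1/2})$ with inner product $a(\zeta,\varphi)=\langle\mathcal A^{1/2}\zeta,\mathcal A^{1/2}\varphi\rangle_H$. $V_0\subset V_1\subset\dots\subset V$ are nested finite-dimensional subspaces, $V_\ell$ of dimension $n_\ell$ with basis $\{\phi_j^\ell\}_{j=1}^{n_\ell}$, and $P_\ell:\mathbb R^{n_\ell}\to V_\ell$, $P_\ell x=\sum_jx^j\phi_j^\ell$. $A_\ell\in\mathbb R^{n_\ell\times n_\ell}$ has entries $(A_\ell)_{jk}=a(\phi_j^\ell,\phi_k^\ell)$; $I_{\ell-1}^\ell\in\mathbb R^{n_\ell\times n_{\ell-1}}$ is the matrix of $P_\ell^{-1}P_{\ell-1}$ and $I_\ell^{\ell-1}=(I_{\ell-1}^\ell)^\top$ (hence $A_{\ell-1}=I_\ell^{\ell-1}A_\ell I_{\ell-1}^\ell$). $\mathcal F(\phi)=\langle\phi,\chi\rangle_H$ for a fixed $\chi\in H$ and $(F_L)_j=\mathcal F(\phi_j^L)$. $A\le B$ means $B-A$ is positive semidefinite. Random smoother: $\mathrm{RandomSmoother}(A,M,f,\theta):=\theta+M^{-1}(f+\xi-A\theta)$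 with a fresh $\xi\sim\mathcal N(0,M+M^\top-A)$, independent of everything else. MGMC update $\mathrm{MGMC}_\ell(A_\ell,f_\ell,\theta_\ell)$ (V-cycle, exact coarse sampler): if $\ell=0$, return a fresh sample from $\mathcal N(A_0^{-1}f_0,A_0^{-1})$. If $\ell\ge1$: (1) starting from $\theta_\ell$ apply $\nu_1$ times $\theta\mapsto\mathrm{RandomSmoother}(A_\ell,M_\ell,f_\ell,\theta)$, giving $\theta_{\ell,\nu_1}$; (2) set $f_{\ell-1}:=I_\ell^{\ell-1}(f_\ell-A_\ell\theta_{\ell,\nu_1})$, $\psi_{\ell-1}:=\mathrm{MGMC}_{\ell-1}(A_{\ell-1},f_{\ell-1},0)$, $\theta_{\ell,\nu_1+1}:=\theta_{\ell,\nu_1}+I_{\ell-1}^\ell\psi_{\ell-1}$; (3) starting from $\theta_{\ell,\nu_1+1}$ apply $\nu_2$ times the same random smoother and return the result. (In step (2), $f_{\ell-1}$ is the coarse right-hand side created by the algorithm.) All random variables drawn are mutually independent and independent of the initial state, which is multivariate normal (possibly degenerate). *)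

theory Defs
  imports "HOL-Probability.Probability" "Jordan_Normal_Form.Gauss_Jordan_Elimination"
begin

no_notation Finite_Cartesian_Product.vec_nth (infixl "$" 90)

section \<open>Vectors and matrices\<close>

definition vec_norm2 :: "real Matrix.vec \<Rightarrow> real" where
  "vec_norm2 v = sqrt (scalar_prod v v)"

text \<open>Spectral norm. The supremum runs over the closed unit ball, so it is also meaningful
  (and 0) for matrices without columns.\<close>

definition mat_norm2 :: "real mat \<Rightarrow> real" where
  "mat_norm2 A = (SUP v \<in> {v \<in> carrier_vec (dim_col A). vec_norm2 v \<le> 1}. vec_norm2 (A *\<^sub>v v))"

definition pos_semidef_mat :: "real mat \<Rightarrow> bool" where
  "pos_semidef_mat A \<longleftrightarrow> square_mat A \<and> A\<^sup>T = A \<and>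
     (\<forall>v \<in> carrier_vec (dim_row A). 0 \<le> scalar_prod v (A *\<^sub>v v))"

definition pos_def_mat :: "real mat \<Rightarrow> bool" where
  "pos_def_mat A \<longleftrightarrow> square_mat A \<and> A\<^sup>T = A \<and>
     (\<forall>v \<in> carrier_vec (dim_row A). v \<noteq> 0\<^sub>v (dim_row A) \<longrightarrow> 0 < scalar_prod v (A *\<^sub>v v))"

definition loewner_le :: "real mat \<Rightarrow> real mat \<Rightarrow> bool" where
  "loewner_le A B \<longleftrightarrow> dim_row A = dim_row B \<and> dim_col A = dim_col B \<and> pos_semidef_mat (B - A)"

text \<open>Only used for invertible matrices, where \<open>mat_inverse\<close> does not return \<open>None\<close>.\<close>

definition mat_inv :: "real mat \<Rightarrow> real mat" where
  "mat_inv A = the (mat_inverse A)"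

text \<open>The positive semidefinite square root of a positive semidefinite matrix; it is unique,
  so the choice operator does not select anything.\<close>

definition mat_sqrt :: "real mat \<Rightarrow> real mat" where
  "mat_sqrt A = (SOME B. pos_semidef_mat B \<and> dim_row B = dim_row A \<and> B * B = A)"

section \<open>Normal random vectors\<close>

text \<open>The Borel sigma-algebra of \<open>\<real>\<^sup>n\<close> on the carrier set of vectors of dimension \<open>n\<close>.\<close>

definition vec_borel :: "nat \<Rightarrow> real Matrix.vec measure" where
  "vec_borel n = vimage_algebra (carrier_vec n) (\<lambda>v. \<lambda>i\<in>{..<n}. v $ i)
     (Pi\<^sub>M {..<n} (\<lambda>_. borel))"

text \<open>\<open>N(\<mu>, \<Sigma>)\<close> is the law of \<open>\<mu> + \<Sigma>\<^sup>1\<^sup>/\<^sup>2 Z\<close>, where \<open>Z\<close> has independent standard normal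
  entries. The positive semidefinite matrix \<open>\<Sigma>\<close> may be singular.\<close>

definition normal_law :: "nat \<Rightarrow> real Matrix.vec \<Rightarrow> real mat \<Rightarrow> real Matrix.vec measure" where
  "normal_law n \<mu> \<Sigma> =
     distr (Pi\<^sub>M {..<n} (\<lambda>_. density lborel std_normal_density)) (vec_borel n)
       (\<lambda>z. \<mu> + mat_sqrt \<Sigma> *\<^sub>v Matrix.vec n z)"

definition has_law :: "'w measure \<Rightarrow> nat \<Rightarrow> ('w \<Rightarrow> real Matrix.vec) \<Rightarrow> real Matrix.vec measure \<Rightarrow> bool" where
  "has_law \<Omega> n X N \<longleftrightarrow> X \<in> measurable \<Omega> (vec_borel n) \<and> distr \<Omega> (vec_borel n) X = N"

definition normal_vector :: "'w measure \<Rightarrow> nat \<Rightarrow> ('w \<Rightarrow> real Matrix.vec) \<Rightarrow> bool" where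
  "normal_vector \<Omega> n X \<longleftrightarrow> (\<exists>\<mu> \<Sigma>. \<mu> \<in> carrier_vec n \<and> \<Sigma> \<in> carrier_mat n n \<and>
     pos_semidef_mat \<Sigma> \<and> has_law \<Omega> n X (normal_law n \<mu> \<Sigma>))"

definition mean_vec :: "'w measure \<Rightarrow> nat \<Rightarrow> ('w \<Rightarrow> real Matrix.vec) \<Rightarrow> real Matrix.vec" where
  "mean_vec \<Omega> n X = Matrix.vec n (\<lambda>i. \<integral>\<omega>. X \<omega> $ i \<partial>\<Omega>)"

definition cov_mat :: "'w measure \<Rightarrow> nat \<Rightarrow> ('w \<Rightarrow> real Matrix.vec) \<Rightarrow> real mat" where
  "cov_mat \<Omega> n X = Matrix.mat n n (\<lambda>(i, j).
     \<integral>\<omega>. (X \<omega> $ i - mean_vec \<Omega> n X $ i) * (X \<omega> $ j - mean_vec \<Omega> n X $ j) \<partial>\<Omega>)"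

section \<open>Unbounded operators on a Hilbert space\<close>

text \<open>An operator is given by its domain \<open>D\<close> and a function \<open>T\<close>, of which only the values on \<open>D\<close>
  matter. The last conjunct says that the graph of \<open>T\<close> is the graph of the adjoint of \<open>T\<close>.\<close>

definition self_adjoint_op :: "'h::real_inner set \<Rightarrow> ('h \<Rightarrow> 'h) \<Rightarrow> bool" where
  "self_adjoint_op D T \<longleftrightarrow> subspace D \<and> closure D = UNIV \<and>
     (\<forall>x\<in>D. \<forall>y\<in>D. T (x + y) = T x + T y) \<and> (\<forall>c. \<forall>x\<in>D. T (c *\<^sub>R x) = c *\<^sub>R T x) \<and>
     (\<forall>y z. (y \<in> D \<and> z = T y) \<longleftrightarrow> (\<forall>x\<in>D. inner (T x) y = inner x z))"

definition pos_def_op :: "'h::real_inner set \<Rightarrow> ('h \<Rightarrow> 'h) \<Rightarrow> bool" where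
  "pos_def_op D T \<longleftrightarrow> (\<forall>x\<in>D. x \<noteq> 0 \<longrightarrow> 0 < inner (T x) x)"

definition has_compact_inverse :: "'h::real_inner set \<Rightarrow> ('h \<Rightarrow> 'h) \<Rightarrow> bool" where
  "has_compact_inverse D T \<longleftrightarrow> bij_betw T D UNIV \<and>
     (\<forall>B. bounded B \<longrightarrow> compact (closure (the_inv_into D T ` B)))"

text \<open>\<open>R\<close> with domain \<open>V\<close> is the (unique) nonnegative self-adjoint square root of \<open>T\<close>;
  in particular \<open>D\<close> is the natural domain of \<open>R \<circ> R\<close>.\<close>

definition is_sqrt_op :: "'h::real_inner set \<Rightarrow> ('h \<Rightarrow> 'h) \<Rightarrow> 'h set \<Rightarrow> ('h \<Rightarrow> 'h) \<Rightarrow> bool" where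
  "is_sqrt_op V R D T \<longleftrightarrow> self_adjoint_op V R \<and> (\<forall>x\<in>V. 0 \<le> inner (R x) x) \<and>
     D = {x \<in> V. R x \<in> V} \<and> (\<forall>x\<in>D. R (R x) = T x)"

section \<open>Galerkin discretisation\<close>

text \<open>Basis functions \<open>\<phi> l j\<close> and all matrix indices are numbered from 0.\<close>

definition is_basis_of :: "(nat \<Rightarrow> 'h::real_vector) \<Rightarrow> nat \<Rightarrow> 'h set \<Rightarrow> bool" where
  "is_basis_of b n U \<longleftrightarrow> inj_on b {..<n} \<and> independent (b ` {..<n}) \<and> span (b ` {..<n}) = U"

definition synth :: "(nat \<Rightarrow> nat) \<Rightarrow> (nat \<Rightarrow> nat \<Rightarrow> 'h::real_vector) \<Rightarrow> nat \<Rightarrow> real Matrix.vec \<Rightarrow> 'h" where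
  "synth n \<phi> l x = (\<Sum>j<n l. (x $ j) *\<^sub>R \<phi> l j)"

definition stiffness :: "('h::real_inner \<Rightarrow> 'h) \<Rightarrow> (nat \<Rightarrow> nat) \<Rightarrow> (nat \<Rightarrow> nat \<Rightarrow> 'h) \<Rightarrow> nat \<Rightarrow> real mat" where
  "stiffness R n \<phi> l = Matrix.mat (n l) (n l) (\<lambda>(j, k). inner (R (\<phi> l j)) (R (\<phi> l k)))"

definition load_vec :: "(nat \<Rightarrow> nat) \<Rightarrow> (nat \<Rightarrow> nat \<Rightarrow> 'h::real_inner) \<Rightarrow> 'h \<Rightarrow> nat \<Rightarrow> real Matrix.vec" where
  "load_vec n \<phi> f l = Matrix.vec (n l) (\<lambda>j. inner (\<phi> l j) f)"

text \<open>The prolongation from level \<open>l - 1\<close> to level \<open>l\<close>, for \<open>l \<ge> 1\<close>: the matrix of the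
  synthesis operator of level \<open>l - 1\<close> followed by the inverse of that of level \<open>l\<close>.\<close>

definition prolongation :: "(nat \<Rightarrow> nat) \<Rightarrow> (nat \<Rightarrow> nat \<Rightarrow> 'h::real_vector) \<Rightarrow> nat \<Rightarrow> real mat" where
  "prolongation n \<phi> l = Matrix.mat (n l) (n (l - 1)) (\<lambda>(i, j).
     the_inv_into (carrier_vec (n l)) (synth n \<phi> l)
       (synth n \<phi> (l - 1) (unit_vec (n (l - 1)) j)) $ i)"

section \<open>Multigrid Monte Carlo\<close>

definition random_smoother :: "real mat \<Rightarrow> real mat \<Rightarrow> real Matrix.vec \<Rightarrow> real Matrix.vec \<Rightarrow> real Matrix.vec \<Rightarrow> real Matrix.vec" where
  "random_smoother A M f \<xi> \<theta> = \<theta> + mat_inv M *\<^sub>v (f + \<xi> - A *\<^sub>v \<theta>)"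

text \<open>One V-cycle update as a function of the random draws \<open>w\<close> it consumes. For \<open>l \<ge> 1\<close> the draw
  \<open>w l k\<close> with \<open>k < \<nu>\<^sub>1 + \<nu>\<^sub>2\<close> is the \<open>\<xi>\<close> of the \<open>k\<close>-th smoothing step on level \<open>l\<close> (first pre-, then
  post-smoothing); \<open>w 0 0\<close> is the centred part of the exact sample on level 0. The arguments
  \<open>A\<close>, \<open>S\<close>, \<open>Pr\<close> are the families of system, splitting and prolongation matrices.\<close>

primrec mgmc :: "(nat \<Rightarrow> nat) \<Rightarrow> (nat \<Rightarrow> real mat) \<Rightarrow> (nat \<Rightarrow> real mat) \<Rightarrow> (nat \<Rightarrow> real mat) \<Rightarrow>
    nat \<Rightarrow> nat \<Rightarrow> (nat \<Rightarrow> nat \<Rightarrow> real Matrix.vec) \<Rightarrow> nat \<Rightarrow> real Matrix.vec \<Rightarrow> real Matrix.vec \<Rightarrow> real Matrix.vec" where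
  "mgmc n A S Pr \<nu>\<^sub>1 \<nu>\<^sub>2 w 0 f \<theta> = mat_inv (A 0) *\<^sub>v f + w 0 0"
| "mgmc n A S Pr \<nu>\<^sub>1 \<nu>\<^sub>2 w (Suc l) f \<theta> =
    (let smooth = (\<lambda>k. random_smoother (A (Suc l)) (S (Suc l)) f (w (Suc l) k));
         \<theta>' = fold smooth [0..<\<nu>\<^sub>1] \<theta>;
         f' = (Pr (Suc l))\<^sup>T *\<^sub>v (f - A (Suc l) *\<^sub>v \<theta>');
         \<psi> = mgmc n A S Pr \<nu>\<^sub>1 \<nu>\<^sub>2 w l f' (0\<^sub>v (n l));
         \<theta>'' = \<theta>' + Pr (Suc l) *\<^sub>v \<psi>
     in fold smooth [\<nu>\<^sub>1..<\<nu>\<^sub>1 + \<nu>\<^sub>2] \<theta>'')"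

text \<open>The chain on level \<open>L\<close>; \<open>\<xi> m\<close> are the draws used in the transition from \<open>m\<close> to \<open>m + 1\<close>.\<close>

primrec mgmc_chain :: "(nat \<Rightarrow> nat) \<Rightarrow> (nat \<Rightarrow> real mat) \<Rightarrow> (nat \<Rightarrow> real mat) \<Rightarrow> (nat \<Rightarrow> real mat) \<Rightarrow>
    nat \<Rightarrow> nat \<Rightarrow> nat \<Rightarrow> real Matrix.vec \<Rightarrow> ('w \<Rightarrow> real Matrix.vec) \<Rightarrow>
    (nat \<Rightarrow> nat \<Rightarrow> nat \<Rightarrow> 'w \<Rightarrow> real Matrix.vec) \<Rightarrow> nat \<Rightarrow> 'w \<Rightarrow> real Matrix.vec" where
  "mgmc_chain n A S Pr \<nu>\<^sub>1 \<nu>\<^sub>2 L f \<theta>0 \<xi> 0 \<omega> = \<theta>0 \<omega>"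
| "mgmc_chain n A S Pr \<nu>\<^sub>1 \<nu>\<^sub>2 L f \<theta>0 \<xi> (Suc m) \<omega> =
     mgmc n A S Pr \<nu>\<^sub>1 \<nu>\<^sub>2 (\<lambda>l k. \<xi> m l k \<omega>) L f (mgmc_chain n A S Pr \<nu>\<^sub>1 \<nu>\<^sub>2 L f \<theta>0 \<xi> m \<omega>)"

definition mgmc_draws :: "nat \<Rightarrow> nat \<Rightarrow> (nat \<times> nat \<times> nat) set" where
  "mgmc_draws \<nu> L = {(m, l, k). (l = 0 \<and> k = 0) \<or> (1 \<le> l \<and> l \<le> L \<and> k < \<nu>)}"

text \<open>The initial state is normal, all draws have the prescribed laws, and the initial state
  (index \<open>None\<close>) and all draws of all transitions are mutually independent.\<close>

definition mgmc_randomness :: "'w measure \<Rightarrow> (nat \<Rightarrow> nat) \<Rightarrow> (nat \<Rightarrow> real mat) \<Rightarrow> (nat \<Rightarrow> real mat) \<Rightarrow>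
    nat \<Rightarrow> nat \<Rightarrow> ('w \<Rightarrow> real Matrix.vec) \<Rightarrow> (nat \<Rightarrow> nat \<Rightarrow> nat \<Rightarrow> 'w \<Rightarrow> real Matrix.vec) \<Rightarrow> bool" where
  "mgmc_randomness \<Omega> n A S \<nu> L \<theta>0 \<xi> \<longleftrightarrow>
     normal_vector \<Omega> (n L) \<theta>0 \<and>
     (\<forall>m. has_law \<Omega> (n 0) (\<xi> m 0 0) (normal_law (n 0) (0\<^sub>v (n 0)) (mat_inv (A 0)))) \<and>
     (\<forall>m. \<forall>l\<in>{1..L}. \<forall>k<\<nu>. has_law \<Omega> (n l) (\<xi> m l k)
        (normal_law (n l) (0\<^sub>v (n l)) (S l + (S l)\<^sup>T - A l))) \<and>
     prob_space.indep_vars \<Omega>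
       (\<lambda>i. vec_borel (case i of None \<Rightarrow> n L | Some (m, l, k) \<Rightarrow> n l))
       (\<lambda>i. case i of None \<Rightarrow> \<theta>0 | Some (m, l, k) \<Rightarrow> \<xi> m l k)
       (insert None (Some ` mgmc_draws \<nu> L))"

end

theory Submission
  imports Defs "Jordan_Normal_Form.Determinant"
begin

text \<open>The map \<open>J\<^sub>l = R \<circ> synth\<^sub>l\<close> turns the energy inner product of level \<open>l\<close> into the inner product
  of \<open>H\<close>, so that all levels live in one space and prolongation becomes inclusion. There
  \<open>\<pi>\<^sub>l = J\<^sub>l A\<^sub>l\<^sup>-\<^sup>1 J\<^sub>l\<^sup>*\<close> is an orthogonal projection, \<open>\<kappa>\<^sub>l = J\<^sub>l M\<^sub>l\<^sup>-\<^sup>1 J\<^sub>l\<^sup>*\<close> is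
  symmetric with \<open>\<parallel>\<kappa>\<^sub>l x\<parallel>\<^sup>2 \<le> \<langle>\<kappa>\<^sub>l x, x\<rangle>\<close>, and the approximation assumption reads
  \<open>\<pi>\<^sub>l - \<pi>\<^sub>l\<^sub>-\<^sub>1 \<le> C\<^sub>A \<kappa>\<^sub>l\<close>. The error propagation of the V-cycle is \<open>e\<^sub>0 = I - \<pi>\<^sub>0\<close>,
  \<open>e\<^sub>l = s\<^sub>l\<^sup>m e\<^sub>l\<^sub>-\<^sub>1 s\<^sub>l\<^sup>m\<close> with \<open>s\<^sub>l = I - \<kappa>\<^sub>l\<close> and \<open>m = \<nu> / 2\<close>, and the argument of Braess and
  Hackbusch bounds it on the range of \<open>\<pi>\<^sub>l\<close> by \<open>C\<^sub>A / (C\<^sub>A + \<nu>)\<close>. Every step of the cycle leaves the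
  target invariant, so the noise \<open>N\<close> injected by a full cycle satisfies
  \<open>E \<langle>x, N\<rangle>\<^sup>2 = \<parallel>x\<parallel>\<^sup>2 - \<parallel>e\<^sub>L x\<parallel>\<^sup>2\<close>. Hence the second moments of the chain stay bounded in the energy
  norm, while its correlations decay geometrically, and the mean square error of the average is
  \<open>O(1/M)\<close>. Since the functional is \<open>\<theta> \<mapsto> \<langle>R\<^sup>-\<^sup>1 \<chi>, J\<^sub>L \<theta>\<rangle>\<close>, no constant depends on \<open>L\<close>.\<close>

section \<open>Real matrices\<close>

text \<open>No eigenvalue decomposition enters. Square roots of matrices, the smoothing property and
  operator norms are all obtained from quadratic forms: a nonnegative form satisfies a
  Cauchy-Schwarz inequality, which follows from the discriminant bound below, and this turns a bound
  on \<open>inner (e x) x\<close> into one on \<open>norm (e x)\<close>.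

  Contraction of the V-cycle is not a statement that can be passed from level to level, since the
  coarse correction does nothing on the complement of the coarse space. What survives the induction
  is the inequality \<open>err_le\<close> with two weights, \<open>rate\<close> on the range of the
  projection and 1 on its complement.

  Equal numbers of pre- and post-smoothing steps with one symmetric splitting make
  \<open>err l\<close> symmetric. Hence a single operator governs the propagation of errors, the
  decay of correlations and the covariance of the injected noise. Independence and normality enter
  through first and second moments: the noise of a cycle is orthogonal to everything that happened
  before it, and its second moments are known.\<close>

lemma quadratic_nonneg_imp:
  fixes a b c :: real
  assumes "\<And>t. 0 \<le> a + 2 * t * b + t\<^sup>2 * c" "0 \<le> c"
  shows "b\<^sup>2 \<le> a * c"
proof (cases "c = 0")
  case True
  have "b = 0"
  proof (rule ccontr)
    assume "b \<noteq> 0"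
    \<comment> \<open>For \<open>c = 0\<close> the polynomial is affine in \<open>t\<close>; the
      chosen \<open>t\<close> gives it the value -1.\<close>
    then show False
      using assms(1)[of "- (a + 1) / (2 * b)"] True by (simp add: field_simps)
  qed
  then show ?thesis using True by simp
next
  case False
  then have "0 < c" using assms(2) by simp
  \<comment> \<open>The minimiser \<open>t = - b / c\<close>, with the value multiplied by
    \<open>c\<close> to clear denominators.\<close>
  have "0 \<le> c * (a + 2 * (- b / c) * b + (- b / c)\<^sup>2 * c)"
    using assms(1)[of "- b / c"] \<open>0 < c\<close> by (intro mult_nonneg_nonneg) auto
  also have "\<dots> = a * c - b\<^sup>2"
    using \<open>0 < c\<close> by (simp add: field_simps power2_eq_square)
  finally show ?thesis by simp
qed

section \<open>Euclidean scalar product, spectral norm and inverses\<close>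

lemma scalar_prod_self_nonneg: "0 \<le> scalar_prod v (v :: real Matrix.vec)"
  by (simp add: scalar_prod_def sum_nonneg)

lemma vec_norm2_nonneg [simp]: "0 \<le> vec_norm2 v"
  by (simp add: vec_norm2_def scalar_prod_self_nonneg)

lemma vec_norm2_sq: "(vec_norm2 v)\<^sup>2 = scalar_prod v v"
  by (simp add: vec_norm2_def scalar_prod_self_nonneg)

lemma scalar_prod_sym_mat:
  fixes A :: "real mat"
  assumes "A \<in> carrier_mat n n" "A\<^sup>T = A" "x \<in> carrier_vec n" "y \<in> carrier_vec n"
  shows "scalar_prod (A *\<^sub>v x) y = scalar_prod x (A *\<^sub>v y)"
  using transpose_vec_mult_scalar[OF assms(1,4,3)] assms(2) by simp

lemma scalar_prod_Cauchy_Schwarz_psd: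
  fixes B :: "real mat"
  assumes B: "B \<in> carrier_mat n n" "B\<^sup>T = B"
    and psd: "\<And>v. v \<in> carrier_vec n \<Longrightarrow> 0 \<le> scalar_prod v (B *\<^sub>v v)"
    and x: "x \<in> carrier_vec n" and y: "y \<in> carrier_vec n"
  shows "(scalar_prod x (B *\<^sub>v y))\<^sup>2 \<le> scalar_prod x (B *\<^sub>v x) * scalar_prod y (B *\<^sub>v y)"
proof (rule quadratic_nonneg_imp)
  fix t :: real
  have [simp]: "scalar_prod y (B *\<^sub>v x) = scalar_prod x (B *\<^sub>v y)"
    using scalar_prod_sym_mat[OF B x y] B x y
    by (metis comm_scalar_prod mult_mat_vec_carrier)
  have "0 \<le> scalar_prod (x + t \<cdot>\<^sub>v y) (B *\<^sub>v (x + t \<cdot>\<^sub>v y))"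
    using x y by (intro psd) auto
  also have "\<dots> = scalar_prod x (B *\<^sub>v x) + 2 * t * scalar_prod x (B *\<^sub>v y)
      + t\<^sup>2 * scalar_prod y (B *\<^sub>v y)"
    using B x y by (simp add: mult_add_distrib_mat_vec[of _ n n] mult_mat_vec[of _ n n]
        add_scalar_prod_distrib[of _ n] scalar_prod_add_distrib[of _ n] power2_eq_square algebra_simps)
  finally show "0 \<le> scalar_prod x (B *\<^sub>v x) + 2 * t * scalar_prod x (B *\<^sub>v y)
      + t\<^sup>2 * scalar_prod y (B *\<^sub>v y)" .
qed (use psd y in auto)

lemma scalar_prod_Cauchy_Schwarz:
  assumes "x \<in> carrier_vec n" "y \<in> carrier_vec n"
  shows "(scalar_prod x y)\<^sup>2 \<le> scalar_prod x x * scalar_prod y (y :: real Matrix.vec)"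
  using scalar_prod_Cauchy_Schwarz_psd[of "1\<^sub>m n" n x y] assms
  by (simp add: scalar_prod_self_nonneg)

lemma scalar_prod_le_vec_norm2:
  assumes "x \<in> carrier_vec n" "y \<in> carrier_vec n"
  shows "\<bar>scalar_prod x y\<bar> \<le> vec_norm2 x * vec_norm2 y"
  using scalar_prod_Cauchy_Schwarz[OF assms]
  by (intro power2_le_imp_le[of "\<bar>_\<bar>"]) (auto simp: power_mult_distrib vec_norm2_sq)

text \<open>The Frobenius norm is such a bound, and adding 1 keeps \<open>K\<close> positive for the
  zero matrix. It makes the supremum in \<open>mat_norm2\<close> finite and supplies the scaling
  factor in \<open>mat_sqrt_props\<close>.\<close>

lemma mult_mat_vec_bound:
  fixes B :: "real mat"
  assumes B: "B \<in> carrier_mat m n"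
  obtains K where "0 < K" "\<And>v. v \<in> carrier_vec n \<Longrightarrow> vec_norm2 (B *\<^sub>v v) \<le> K * vec_norm2 v"
proof
  let ?K = "\<Sum>i<m. scalar_prod (row B i) (row B i)"
  have K0: "0 \<le> ?K" by (simp add: sum_nonneg scalar_prod_self_nonneg)
  show "0 < 1 + sqrt ?K" using K0 by (simp add: add_pos_nonneg)
  fix v :: "real Matrix.vec" assume v: "v \<in> carrier_vec n"
  have "(vec_norm2 (B *\<^sub>v v))\<^sup>2 = (\<Sum>i<m. (scalar_prod (row B i) v)\<^sup>2)"
    unfolding vec_norm2_sq scalar_prod_def[of "B *\<^sub>v v"]
    using B by (simp add: power2_eq_square lessThan_atLeast0)
  also have "\<dots> \<le> (\<Sum>i<m. scalar_prod (row B i) (row B i) * scalar_prod v v)"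
    using B v by (intro sum_mono scalar_prod_Cauchy_Schwarz[of _ n]) auto
  also have "\<dots> = (sqrt ?K * vec_norm2 v)\<^sup>2"
    using K0 by (simp add: power_mult_distrib vec_norm2_sq sum_distrib_right)
  finally have "vec_norm2 (B *\<^sub>v v) \<le> sqrt ?K * vec_norm2 v"
    by (rule power2_le_imp_le) (simp add: K0)
  then show "vec_norm2 (B *\<^sub>v v) \<le> (1 + sqrt ?K) * vec_norm2 v"
    by (rule order_trans) (simp add: mult_right_mono)
qed

lemma vec_norm2_smult: "vec_norm2 (c \<cdot>\<^sub>v v) = \<bar>c\<bar> * vec_norm2 v"
proof -
  have "scalar_prod (c \<cdot>\<^sub>v v) (c \<cdot>\<^sub>v v) = c\<^sup>2 * scalar_prod v v"
    by (simp add: scalar_prod_def sum_distrib_left power2_eq_square ac_simps)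
  then show ?thesis by (simp add: vec_norm2_def real_sqrt_mult)
qed

lemma mult_mat_vec_le_mat_norm2:
  assumes B: "B \<in> carrier_mat m n" and v: "v \<in> carrier_vec n"
  shows "vec_norm2 (B *\<^sub>v v) \<le> mat_norm2 B * vec_norm2 v"
proof (cases "vec_norm2 v = 0")
  case True
  obtain K where "vec_norm2 (B *\<^sub>v v) \<le> K * vec_norm2 v"
    using mult_mat_vec_bound[OF B] v by metis
  then show ?thesis using True by simp
next
  case False
  then have pos: "0 < vec_norm2 v" using vec_norm2_nonneg[of v] by linarith
  let ?u = "(1 / vec_norm2 v) \<cdot>\<^sub>v v"
  obtain K where K: "0 < K" "\<And>v. v \<in> carrier_vec n \<Longrightarrow> vec_norm2 (B *\<^sub>v v) \<le> K * vec_norm2 v"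
    using mult_mat_vec_bound[OF B] by metis
  have "vec_norm2 (B *\<^sub>v ?u) \<le> mat_norm2 B"
    unfolding mat_norm2_def
  proof (rule cSUP_upper)
    show "?u \<in> {v \<in> carrier_vec (dim_col B). vec_norm2 v \<le> 1}"
      using v B pos by (auto simp: vec_norm2_smult)
    have "vec_norm2 (B *\<^sub>v w) \<le> K" if "w \<in> carrier_vec n" "vec_norm2 w \<le> 1" for w
      using order_trans[OF K(2)[OF that(1)] mult_left_mono[OF that(2), of K]] K(1) by simp
    then show "bdd_above ((\<lambda>v. vec_norm2 (B *\<^sub>v v)) ` {v \<in> carrier_vec (dim_col B). vec_norm2 v \<le> 1})"
      using B by (intro bdd_aboveI[of _ K]) auto
  qed
  then show ?thesis
    using pos by (simp add: mult_mat_vec[OF B v] vec_norm2_smult field_simps)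
qed

lemma scalar_prod_le_mat_norm2:
  assumes B: "B \<in> carrier_mat n n" and v: "v \<in> carrier_vec n"
  shows "scalar_prod v (B *\<^sub>v v) \<le> mat_norm2 B * scalar_prod v v"
proof -
  have "scalar_prod v (B *\<^sub>v v) \<le> vec_norm2 v * vec_norm2 (B *\<^sub>v v)"
    using scalar_prod_le_vec_norm2[of v n "B *\<^sub>v v"] B v by auto
  also have "\<dots> \<le> vec_norm2 v * (mat_norm2 B * vec_norm2 v)"
    by (intro mult_left_mono mult_mat_vec_le_mat_norm2[OF B v]) simp
  finally show ?thesis by (simp add: vec_norm2_sq[symmetric] power2_eq_square ac_simps)
qed

text \<open>A trivial kernel gives a nonzero determinant, hence a unit of the matrix ring, and on
  units \<open>mat_inverse\<close> returns \<open>Some\<close>. Injectivity is the convenient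
  hypothesis because it can be read off from a definite quadratic form.\<close>

lemma mat_inv_props:
  fixes A :: "real mat"
  assumes A: "A \<in> carrier_mat n n" and inj: "\<And>v. v \<in> carrier_vec n \<Longrightarrow> A *\<^sub>v v = 0\<^sub>v n \<Longrightarrow> v = 0\<^sub>v n"
  shows "mat_inv A \<in> carrier_mat n n" "A * mat_inv A = 1\<^sub>m n" "mat_inv A * A = 1\<^sub>m n"
proof -
  have "det A \<noteq> 0"
    using det_0_iff_vec_prod_zero[OF A] inj by blast
  then have "A \<in> Units (ring_mat TYPE(real) n ())"
    by (rule det_non_zero_imp_unit[OF A])
  then obtain B where B: "mat_inverse A = Some B"
    using mat_inverse(1)[OF A] by (metis option.exhaust)
  have "mat_inv A = B" by (simp only: mat_inv_def B option.sel)
  then show "mat_inv A \<in> carrier_mat n n" "A * mat_inv A = 1\<^sub>m n" "mat_inv A * A = 1\<^sub>m n"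
    using mat_inverse(2)[OF A B] by blast+
qed

lemma mat_inv_sym:
  fixes A :: "real mat"
  assumes A: "A \<in> carrier_mat n n" "A\<^sup>T = A"
    and inv: "mat_inv A \<in> carrier_mat n n" "A * mat_inv A = 1\<^sub>m n"
  shows "(mat_inv A)\<^sup>T = mat_inv A"
proof -
  have T: "(mat_inv A)\<^sup>T \<in> carrier_mat n n" using inv by simp
  have "(mat_inv A)\<^sup>T * A = (A * mat_inv A)\<^sup>T"
    by (subst transpose_mult[OF A(1) inv(1)]) (simp only: A(2))
  also have "\<dots> = 1\<^sub>m n" by (simp only: inv(2) transpose_one)
  finally have "(mat_inv A)\<^sup>T * A * mat_inv A = mat_inv A"
    by (simp only: left_mult_one_mat[OF inv(1)])
  moreover have "(mat_inv A)\<^sup>T * A * mat_inv A = (mat_inv A)\<^sup>T"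
    by (simp only: assoc_mult_mat[OF T A(1) inv(1)] inv(2) right_mult_one_mat[OF T])
  ultimately show ?thesis by simp
qed

text \<open>The coefficients of the binomial series of \<open>\<surd>(1 - x)\<close>. Their absolute values are summable, so the
  series yields a square root of \<open>I - N\<close> whenever \<open>0 \<le> N \<le> I\<close>, without any spectral theory.\<close>

definition sqrt_coeff :: "nat \<Rightarrow> real" where
  "sqrt_coeff k = ((1/2) gchoose k) * (- 1) ^ k"

lemma sqrt_coeff_0 [simp]: "sqrt_coeff 0 = 1"
  by (simp add: sqrt_coeff_def)

lemma gbinomial_Suc_rec: "((a::real) gchoose Suc k) = (a gchoose k) * (a - real k) / (real k + 1)"
proof -
  have "(a gchoose Suc k) * (real k + 1) = (a gchoose k) * (a - real k)"
    using gbinomial_mult_1[of a k] by (simp add: algebra_simps)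
  then show ?thesis by (simp add: eq_divide_eq)
qed

text \<open>The coefficient of index 1 is -1/2, and each later one is its predecessor times the
  positive ratio \<open>(k + 1/2) / (k + 2)\<close>.\<close>

lemma sqrt_coeff_nonpos: "sqrt_coeff (Suc k) \<le> 0"
proof (induction k)
  case 0
  then show ?case by (simp add: sqrt_coeff_def)
next
  case (Suc k)
  have "sqrt_coeff (Suc (Suc k)) = sqrt_coeff (Suc k) * ((real k + 1/2) / (real k + 2))"
    unfolding sqrt_coeff_def gbinomial_Suc_rec[of _ "Suc k"] by (simp add: field_simps)
  then show ?case using Suc by (simp only:) (rule mult_nonpos_nonneg, auto)
qed

text \<open>The alternating partial sums of a binomial series have a closed form: here they are the
  coefficients of the series of \<open>(1 - x) powr (-1/2)\<close>, which are positive multiples of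
  each other, starting from 1.\<close>

lemma sqrt_coeff_sum_nonneg: "0 \<le> (\<Sum>k\<le>m. sqrt_coeff k)"
proof -
  have "0 \<le> (- 1) ^ m * ((- (1/2) :: real) gchoose m)"
  proof (induction m)
    case (Suc m)
    have "(- 1) ^ Suc m * ((- (1/2) :: real) gchoose Suc m) =
        ((- 1) ^ m * ((- (1/2) :: real) gchoose m)) * ((real m + 1/2) / (real m + 1))"
      unfolding gbinomial_Suc_rec by (simp add: field_simps)
    moreover have "0 \<le> \<dots>" by (rule mult_nonneg_nonneg[OF Suc]) simp
    ultimately show ?case by (simp only:)
  qed simp
  then show ?thesis
    using gbinomial_sum_lower_neg[of "1/2 :: real" m] by (simp add: sqrt_coeff_def)
qed

text \<open>Only the coefficient of index 0 is positive, so the sum of absolute values is 2 minus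
  the signed sum, and the latter is nonnegative.\<close>

lemma summable_abs_sqrt_coeff: "summable (\<lambda>k. \<bar>sqrt_coeff k\<bar>)"
proof (rule summableI_nonneg_bounded)
  fix m
  have "(\<Sum>k<m. \<bar>sqrt_coeff k\<bar>) \<le> (\<Sum>k\<le>m. \<bar>sqrt_coeff k\<bar>)"
    by (rule sum_mono2) auto
  also have "(\<Sum>k\<le>m. \<bar>sqrt_coeff k\<bar>) = 2 - (\<Sum>k\<le>m. sqrt_coeff k)"
  proof (induction m)
    case (Suc m)
    then show ?case using sqrt_coeff_nonpos[of m] by simp
  qed simp
  also have "\<dots> \<le> 2" using sqrt_coeff_sum_nonneg[of m] by simp
  finally show "(\<Sum>k<m. \<bar>sqrt_coeff k\<bar>) \<le> 2" .
qed simp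

text \<open>Squaring the series of the root must give \<open>1 - x\<close>; on coefficients this is
  the Vandermonde identity for \<open>1/2 + 1/2 = 1\<close>.\<close>

lemma sqrt_coeff_convolution:
  "(\<Sum>k\<le>p. sqrt_coeff k * sqrt_coeff (p - k)) = (if p = 0 then 1 else if p = 1 then - 1 else 0)"
proof -
  have "(\<Sum>k\<le>p. sqrt_coeff k * sqrt_coeff (p - k)) =
      (\<Sum>k\<in>{0..p}. ((1/2) gchoose k) * ((1/2) gchoose (p - k)) * (- 1) ^ p)"
    unfolding sqrt_coeff_def
    by (intro sum.cong) (auto simp: power_add[symmetric] ac_simps simp flip: power_add)
  also have "\<dots> = (1 gchoose p) * (- 1) ^ p"
    using gbinomial_Vandermonde[of "1/2 :: real" "1/2" p] by (simp flip: sum_distrib_right)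
  also have "(1 gchoose p :: real) = of_nat (1 choose p)"
    using binomial_gbinomial[of 1 p, where 'a=real] by simp
  also have "of_nat (1 choose p) * (- 1) ^ p = (if p = 0 then 1 else if p = 1 then - 1 else (0::real))"
    by (cases p; cases "p - 1") (auto simp: binomial_eq_0)
  finally show ?thesis .
qed

text \<open>The root is the entrywise sum of \<open>sqrt_coeff k\<close> times the powers of
  \<open>N\<close>. It converges because \<open>N\<close> is a contraction, it squares to
  \<open>1 - N\<close> by the Cauchy product, and it is positive semidefinite because of the signs
  of the coefficients.\<close>

lemma sqrt_one_minus_mat_exists:
  fixes N :: "real mat"
  assumes N: "N \<in> carrier_mat n n" "N\<^sup>T = N"
    and nonneg: "\<And>v. v \<in> carrier_vec n \<Longrightarrow> 0 \<le> scalar_prod v (N *\<^sub>v v)"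
    and le: "\<And>v. v \<in> carrier_vec n \<Longrightarrow> scalar_prod v (N *\<^sub>v v) \<le> scalar_prod v v"
  shows "\<exists>B \<in> carrier_mat n n. pos_semidef_mat B \<and> B * B = 1\<^sub>m n - N"
proof -
  let ?p = "\<lambda>k. N ^\<^sub>m k"
  have pc [simp]: "?p k \<in> carrier_mat n n" for k using N by simp
  have pv: "?p (Suc k) *\<^sub>v v = ?p k *\<^sub>v (N *\<^sub>v v)" if "v \<in> carrier_vec n" for k v
    using N that by (simp add: assoc_mult_mat_vec[of _ n n _ n])
  \<comment> \<open>With \<open>w = N v\<close>, Cauchy-Schwarz for the form of \<open>N\<close>
    gives \<open>|w|^4 <= <w, N w> <v, N v> <= |w|^2 |v|^2\<close>, and one factor
    \<open>|w|^2\<close> cancels.\<close>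
  have contr: "vec_norm2 (N *\<^sub>v v) \<le> vec_norm2 v" if v: "v \<in> carrier_vec n" for v
  proof (cases "scalar_prod (N *\<^sub>v v) (N *\<^sub>v v) = 0")
    case True
    then show ?thesis by (simp add: vec_norm2_def scalar_prod_self_nonneg)
  next
    case False
    let ?w = "N *\<^sub>v v"
    have w: "?w \<in> carrier_vec n" using N v by simp
    have pos: "0 < scalar_prod ?w ?w" using False scalar_prod_self_nonneg[of ?w] by linarith
    have "(scalar_prod ?w ?w)\<^sup>2 \<le> scalar_prod ?w (N *\<^sub>v ?w) * scalar_prod v (N *\<^sub>v v)"
      by (rule scalar_prod_Cauchy_Schwarz_psd[OF N nonneg w v])
    also have "\<dots> \<le> scalar_prod ?w ?w * scalar_prod v v"
      by (intro mult_mono le nonneg w v scalar_prod_self_nonneg)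
    finally have "scalar_prod ?w ?w \<le> scalar_prod v v"
      using pos by (simp add: power2_eq_square)
    then show ?thesis by (simp add: vec_norm2_def)
  qed
  have contr_pow: "vec_norm2 (?p k *\<^sub>v v) \<le> vec_norm2 v" if "v \<in> carrier_vec n" for k v
    using that
  proof (induction k arbitrary: v)
    case 0
    then show ?case using N by simp
  next
    case (Suc k)
    have "N *\<^sub>v v \<in> carrier_vec n" using N Suc.prems by simp
    from Suc.IH[OF this] contr[OF Suc.prems] show ?case
      unfolding pv[OF Suc.prems] by linarith
  qed
  have quad_le: "\<bar>scalar_prod v (?p k *\<^sub>v w)\<bar> \<le> vec_norm2 v * vec_norm2 w"
    if v: "v \<in> carrier_vec n" and w: "w \<in> carrier_vec n" for k v w
  proof -
    have "?p k *\<^sub>v w \<in> carrier_vec n" using pc w by (rule mult_mat_vec_carrier)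
    from scalar_prod_le_vec_norm2[OF v this] mult_left_mono[OF contr_pow[OF w, of k], of "vec_norm2 v"]
    show ?thesis by simp
  qed
  have entry: "?p k $$ (i, j) = scalar_prod (unit_vec n i) (?p k *\<^sub>v unit_vec n j)"
    if "i < n" "j < n" for k i j
  proof -
    have "scalar_prod (unit_vec n i) (?p k *\<^sub>v unit_vec n j) = (?p k *\<^sub>v unit_vec n j) $ i"
      by (rule scalar_prod_left_unit[OF mult_mat_vec_carrier[OF pc unit_vec_carrier] that(1)])
    also have "\<dots> = scalar_prod (row (?p k) i) (unit_vec n j)"
      using pc[of k] that(1) by (metis carrier_matD(1) index_mult_mat_vec)
    also have "\<dots> = row (?p k) i $ j"
      by (rule scalar_prod_right_unit[OF that(2)])
    also have "\<dots> = ?p k $$ (i, j)"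
      using pc[of k] that by (metis carrier_matD index_row(1))
    finally show ?thesis by simp
  qed
  have unit: "vec_norm2 (unit_vec n i) = 1" if "i < n" for i
    using that by (simp add: vec_norm2_def scalar_prod_left_unit[of _ n])
  have entry_le: "\<bar>?p k $$ (i, j)\<bar> \<le> 1" if "i < n" "j < n" for k i j
    using quad_le[of "unit_vec n i" "unit_vec n j" k] unit that by (simp add: entry[OF that])
  have pow_sym: "?p k $$ (i, j) = ?p k $$ (j, i)" if "i < n" "j < n" for k i j
  proof -
    have "(?p k)\<^sup>T = ?p k"
    proof (induction k)
      case (Suc k)
      have comm: "N * ?p k = ?p k * N" for k
      proof (induction k)
        case (Suc k)
        have "N * ?p (Suc k) = (N * ?p k) * N"
          by (simp add: assoc_mult_mat[OF N(1) pc N(1)])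
        then show ?case using Suc by simp
      qed (use N in simp)
      show ?case
        by (simp add: transpose_mult[OF pc N(1)] Suc N(2) comm)
    qed (use N in simp)
    then show ?thesis using that N pc by (metis carrier_matD index_transpose_mat(1))
  qed
  have summ: "summable (\<lambda>k. \<bar>sqrt_coeff k * ?p k $$ (i, j)\<bar>)" if "i < n" "j < n" for i j
  proof (rule summable_comparison_test[OF _ summable_abs_sqrt_coeff])
    show "\<exists>N0. \<forall>k\<ge>N0. norm \<bar>sqrt_coeff k * ?p k $$ (i, j)\<bar> \<le> \<bar>sqrt_coeff k\<bar>"
      using mult_left_le[OF entry_le[OF that] abs_ge_zero] by (auto simp: abs_mult)
  qed
  define B where "B = Matrix.mat n n (\<lambda>(i, j). \<Sum>k. sqrt_coeff k * ?p k $$ (i, j))"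
  have B: "B \<in> carrier_mat n n" by (simp add: B_def)
  have sums_entry: "(\<lambda>k. sqrt_coeff k * ?p k $$ (i, j)) sums (B $$ (i, j))" if "i < n" "j < n" for i j
    using summable_sums[OF summable_rabs_cancel[OF summ[OF that]]] that by (simp add: B_def)
  have "B * B = 1\<^sub>m n - N"
  proof (rule eq_matI)
    fix i j assume "i < dim_row (1\<^sub>m n - N)" "j < dim_col (1\<^sub>m n - N)"
    then have ij: "i < n" "j < n" using N by auto
    let ?a = "\<lambda>l k. sqrt_coeff k * ?p k $$ (i, l)" and ?b = "\<lambda>l k. sqrt_coeff k * ?p k $$ (l, j)"
    \<comment> \<open>The order-\<open>m\<close> part of the product is a multiple of the power
      \<open>N ^ m\<close>, with the convolution of the coefficients as factor; only
      \<open>m = 0\<close> and \<open>m = 1\<close> survive.\<close>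
    have conv: "(\<Sum>l<n. \<Sum>k\<le>m. ?a l k * ?b l (m - k)) =
        (if m = 0 then 1 else if m = 1 then - 1 else 0) * ?p m $$ (i, j)" for m
    proof -
      have "(\<Sum>l<n. \<Sum>k\<le>m. ?a l k * ?b l (m - k)) =
          (\<Sum>k\<le>m. (sqrt_coeff k * sqrt_coeff (m - k)) * (\<Sum>l<n. ?p k $$ (i, l) * ?p (m - k) $$ (l, j)))"
        by (subst sum.swap) (simp add: sum_distrib_left ac_simps)
      also have "\<dots> = (\<Sum>k\<le>m. (sqrt_coeff k * sqrt_coeff (m - k)) * ?p m $$ (i, j))"
      proof (intro sum.cong refl arg_cong2[of _ _ _ _ "(*)"])
        fix k assume "k \<in> {..m}"
        have padd: "?p a * ?p c = ?p (a + c)" for a c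
        proof (induction c)
          case 0
          then show ?case using N pc[of a] by simp
        next
          case (Suc c)
          have "?p a * ?p (Suc c) = ?p a * ?p c * N"
            using assoc_mult_mat[OF pc pc N(1), of a c] by simp
          then show ?case by (simp add: Suc)
        qed
        have "(\<Sum>l<n. ?p k $$ (i, l) * ?p (m - k) $$ (l, j)) = (?p k * ?p (m - k)) $$ (i, j)"
          using ij pc[of k] pc[of "m - k"] N
          by (simp add: scalar_prod_def lessThan_atLeast0)
        also have "\<dots> = ?p m $$ (i, j)" using \<open>k \<in> {..m}\<close> by (simp add: padd)
        finally show "(\<Sum>l<n. ?p k $$ (i, l) * ?p (m - k) $$ (l, j)) = ?p m $$ (i, j)" .
      qed
      finally show ?thesis by (simp add: sqrt_coeff_convolution flip: sum_distrib_right)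
    qed
    have "(\<lambda>m. \<Sum>k\<le>m. ?a l k * ?b l (m - k)) sums (B $$ (i, l) * B $$ (l, j))" if "l < n" for l
      using Cauchy_product_sums[of "?a l" "?b l"] summ that ij
        sums_unique[OF sums_entry[OF ij(1) that]] sums_unique[OF sums_entry[OF that ij(2)]]
      by simp
    then have "(\<lambda>m. \<Sum>l<n. \<Sum>k\<le>m. ?a l k * ?b l (m - k)) sums (\<Sum>l<n. B $$ (i, l) * B $$ (l, j))"
      by (intro sums_sum) auto
    then have "(\<lambda>m. (if m = 0 then 1 else if m = 1 then - 1 else 0) * ?p m $$ (i, j))
        sums ((B * B) $$ (i, j))"
      unfolding conv using ij B by (simp add: scalar_prod_def lessThan_atLeast0)
    moreover have "(\<lambda>m. (if m = 0 then 1 else if m = 1 then - 1 else 0) * ?p m $$ (i, j))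
        sums (\<Sum>m\<in>{0, 1}. (if m = 0 then 1 else if m = 1 then - 1 else 0) * ?p m $$ (i, j))"
      by (rule sums_finite) auto
    ultimately have "(B * B) $$ (i, j) = (\<Sum>m\<in>{0, 1::nat}.
        (if m = 0 then 1 else if m = 1 then - 1 else 0) * ?p m $$ (i, j))"
      by (rule sums_unique2)
    then show "(B * B) $$ (i, j) = (1\<^sub>m n - N) $$ (i, j)"
      using ij N by simp
  qed (use B N in auto)
  moreover have "pos_semidef_mat B"
    unfolding pos_semidef_mat_def
  proof (intro conjI ballI)
    show "square_mat B" using B by simp
    show "B\<^sup>T = B"
      using B by (intro eq_matI) (auto simp: B_def pow_sym intro!: suminf_cong)
    fix v :: "real Matrix.vec" assume "v \<in> carrier_vec (dim_row B)"
    then have v: "v \<in> carrier_vec n" using B by simp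
    have quad: "scalar_prod v (C *\<^sub>v v) = (\<Sum>i<n. \<Sum>j<n. v $ i * v $ j * C $$ (i, j))"
      if "C \<in> carrier_mat n n" for C
      using v that by (simp add: scalar_prod_def lessThan_atLeast0 sum_distrib_left ac_simps)
    have "(\<lambda>k. \<Sum>i<n. \<Sum>j<n. v $ i * v $ j * (sqrt_coeff k * ?p k $$ (i, j))) sums
        (\<Sum>i<n. \<Sum>j<n. v $ i * v $ j * B $$ (i, j))"
      by (intro sums_sum sums_mult sums_entry) auto
    then have sm: "(\<lambda>k. sqrt_coeff k * scalar_prod v (?p k *\<^sub>v v)) sums scalar_prod v (B *\<^sub>v v)"
      unfolding quad[OF B] quad[OF pc] by (simp add: sum_distrib_left ac_simps)
    have "summable sqrt_coeff" by (rule summable_rabs_cancel[OF summable_abs_sqrt_coeff])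
    then have sc: "(\<lambda>k. sqrt_coeff k * scalar_prod v v) sums (suminf sqrt_coeff * scalar_prod v v)"
      by (intro sums_mult2 summable_sums)
    \<comment> \<open>For \<open>k = 0\<close> both sides agree. For larger \<open>k\<close> the
      coefficient is nonpositive and reverses \<open><v, N^k v> <= <v, v>\<close>. Summing bounds
      the form of \<open>B\<close> below by the nonnegative total of the coefficients times
      \<open><v, v>\<close>.\<close>
    have "sqrt_coeff k * scalar_prod v v \<le> sqrt_coeff k * scalar_prod v (?p k *\<^sub>v v)" for k
    proof (cases k)
      case 0
      then show ?thesis using v N by simp
    next
      case (Suc k')
      have "scalar_prod v (?p k *\<^sub>v v) \<le> scalar_prod v v"
        using quad_le[OF v v, of k] by (simp add: vec_norm2_sq[symmetric] power2_eq_square)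
      then show ?thesis
        using sqrt_coeff_nonpos[of k'] Suc by (intro mult_left_mono_neg) auto
    qed
    then have "suminf sqrt_coeff * scalar_prod v v \<le> scalar_prod v (B *\<^sub>v v)"
      by (intro sums_le[OF _ sc sm]) auto
    moreover have "0 \<le> suminf sqrt_coeff"
    proof (rule LIMSEQ_le_const)
      show "(\<lambda>m. \<Sum>k\<le>m. sqrt_coeff k) \<longlonglongrightarrow> suminf sqrt_coeff"
        using \<open>summable sqrt_coeff\<close> by (rule summable_LIMSEQ')
      show "\<exists>N. \<forall>m\<ge>N. 0 \<le> (\<Sum>k\<le>m. sqrt_coeff k)" using sqrt_coeff_sum_nonneg by blast
    qed
    ultimately show "0 \<le> scalar_prod v (B *\<^sub>v v)"
      using mult_nonneg_nonneg[of "suminf sqrt_coeff" "scalar_prod v v"] scalar_prod_self_nonneg[of v]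
      by linarith
  qed
  ultimately show ?thesis using B by blast
qed

lemma smult_mat_mult_vec:
  assumes "A \<in> carrier_mat n m" "v \<in> carrier_vec m"
  shows "(k \<cdot>\<^sub>m A) *\<^sub>v v = k \<cdot>\<^sub>v (A *\<^sub>v (v :: real Matrix.vec))"
  by (rule eq_vecI) (use assms in \<open>auto simp: scalar_prod_def sum_distrib_left ac_simps\<close>)

text \<open>The choice in \<open>mat_sqrt\<close> is resolved by exhibiting a root: divide by
  \<open>K\<close> so that \<open>A / K <= I\<close>, apply the series to
  \<open>N = I - A / K\<close>, and multiply the result by \<open>sqrt K\<close>.\<close>

lemma mat_sqrt_props:
  fixes A :: "real mat"
  assumes A: "A \<in> carrier_mat n n" "pos_semidef_mat A"
  shows "mat_sqrt A \<in> carrier_mat n n" "(mat_sqrt A)\<^sup>T = mat_sqrt A" "mat_sqrt A * mat_sqrt A = A"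
proof -
  have At: "A\<^sup>T = A" and nonneg: "0 \<le> scalar_prod v (A *\<^sub>v v)" if "v \<in> carrier_vec n" for v
    using A that by (auto simp: pos_semidef_mat_def)
  have At: "A\<^sup>T = A" using A by (simp add: pos_semidef_mat_def)
  obtain K where K: "0 < K" "\<And>v. v \<in> carrier_vec n \<Longrightarrow> vec_norm2 (A *\<^sub>v v) \<le> K * vec_norm2 v"
    using mult_mat_vec_bound[OF A(1)] by metis
  let ?A = "(1 / K) \<cdot>\<^sub>m A" and ?N = "1\<^sub>m n - (1 / K) \<cdot>\<^sub>m A"
  have Nv: "scalar_prod v (?N *\<^sub>v v) = scalar_prod v v - scalar_prod v (A *\<^sub>v v) / K"
    if v: "v \<in> carrier_vec n" for v
    using A(1) v
    by (simp add: minus_mult_distrib_mat_vec[of _ n n] scalar_prod_minus_distrib[of _ n]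
        smult_mat_mult_vec[of _ n n])
  have "\<exists>B \<in> carrier_mat n n. pos_semidef_mat B \<and> B * B = 1\<^sub>m n - ?N"
  proof (rule sqrt_one_minus_mat_exists)
    show "?N \<in> carrier_mat n n"
      by (rule minus_carrier_mat[OF smult_carrier_mat[OF A(1)]])
    show "?N\<^sup>T = ?N"
    proof (rule eq_matI)
      fix i j assume "i < dim_row ?N" "j < dim_col ?N"
      then show "?N\<^sup>T $$ (i, j) = ?N $$ (i, j)"
        using A(1) arg_cong[OF At, of "\<lambda>C. C $$ (i, j)"] by auto
    qed (use A(1) in auto)
    fix v :: "real Matrix.vec" assume v: "v \<in> carrier_vec n"
    have "scalar_prod v (A *\<^sub>v v) \<le> vec_norm2 v * vec_norm2 (A *\<^sub>v v)"
      using scalar_prod_le_vec_norm2[OF v mult_mat_vec_carrier[OF A(1) v]] by simp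
    also have "\<dots> \<le> K * scalar_prod v v"
      using mult_left_mono[OF K(2)[OF v], of "vec_norm2 v"]
      by (simp add: vec_norm2_sq[symmetric] power2_eq_square ac_simps)
    finally show "0 \<le> scalar_prod v (?N *\<^sub>v v)" using K(1) by (simp add: Nv[OF v] field_simps)
    show "scalar_prod v (?N *\<^sub>v v) \<le> scalar_prod v v"
      using K(1) nonneg[OF v] by (simp add: Nv[OF v])
  qed
  then obtain B where B: "B \<in> carrier_mat n n" "pos_semidef_mat B" "B * B = ?A"
  proof -
    have "1\<^sub>m n - ?N = ?A" using A(1) by (intro eq_matI) auto
    then show thesis using \<open>\<exists>B \<in> carrier_mat n n. pos_semidef_mat B \<and> B * B = 1\<^sub>m n - ?N\<close> that by auto
  qed
  let ?B = "sqrt K \<cdot>\<^sub>m B"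
  have "pos_semidef_mat ?B"
    unfolding pos_semidef_mat_def
  proof (intro conjI ballI)
    have "B\<^sup>T = B" using B(2) by (simp add: pos_semidef_mat_def)
    then have "B $$ (j, i) = B $$ (i, j)" if "i < n" "j < n" for i j
      using that B(1) by (metis carrier_matD index_transpose_mat(1))
    then show "?B\<^sup>T = ?B" using B(1) by (intro eq_matI) auto
    fix v :: "real Matrix.vec" assume "v \<in> carrier_vec (dim_row ?B)"
    then have v: "v \<in> carrier_vec n" using B(1) by simp
    then show "0 \<le> scalar_prod v (?B *\<^sub>v v)"
      using B(1,2) K(1) by (simp add: pos_semidef_mat_def smult_mat_mult_vec[OF B(1) v])
  qed (use B(1) in simp)
  moreover have "?B * ?B = A"
  proof -
    have "?B * ?B = K \<cdot>\<^sub>m (B * B)"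
      using B(1) K(1)
      by (intro eq_matI) (auto simp: mult_smult_assoc_mat[of _ n n _ n] mult_smult_distrib[of _ n n _ n])
    also have "\<dots> = A" using K(1) A(1) unfolding B(3) by (intro eq_matI) auto
    finally show ?thesis .
  qed
  moreover have "dim_row ?B = dim_row A" using B A by simp
  ultimately have "\<exists>X. pos_semidef_mat X \<and> dim_row X = dim_row A \<and> X * X = A"
    by blast
  from someI_ex[OF this, folded mat_sqrt_def]
  have X: "pos_semidef_mat (mat_sqrt A)" "dim_row (mat_sqrt A) = dim_row A" "mat_sqrt A * mat_sqrt A = A"
    by blast+
  from X(1,2) have "dim_row (mat_sqrt A) = n" "dim_col (mat_sqrt A) = n"
    using A(1) unfolding pos_semidef_mat_def by auto
  then show "mat_sqrt A \<in> carrier_mat n n" by blast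
  show "(mat_sqrt A)\<^sup>T = mat_sqrt A" using X(1) unfolding pos_semidef_mat_def by blast
  show "mat_sqrt A * mat_sqrt A = A" by (rule X(3))
qed

section \<open>Second moments\<close>

text \<open>Membership in L2. Measurability of \<open>X\<close> is a separate conjunct because it
  does not follow from that of the square.\<close>

definition sq_integrable :: "'w measure \<Rightarrow> ('w \<Rightarrow> real) \<Rightarrow> bool" where
  "sq_integrable M X \<longleftrightarrow> X \<in> borel_measurable M \<and> integrable M (\<lambda>\<omega>. (X \<omega>)\<^sup>2)"

lemma sq_integrable_mult:
  assumes "sq_integrable M X" "sq_integrable M Y"
  shows "integrable M (\<lambda>\<omega>. X \<omega> * Y \<omega>)"
proof (rule Bochner_Integration.integrable_bound)
  show "integrable M (\<lambda>\<omega>. (X \<omega>)\<^sup>2 + (Y \<omega>)\<^sup>2)"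
    using assms by (simp add: sq_integrable_def)
  show "(\<lambda>\<omega>. X \<omega> * Y \<omega>) \<in> borel_measurable M"
    using assms by (auto simp: sq_integrable_def)
  have "\<bar>a * b\<bar> \<le> a\<^sup>2 + b\<^sup>2" for a b :: real
  proof -
    have "2 * \<bar>a * b\<bar> \<le> a\<^sup>2 + b\<^sup>2"
      using sum_squares_bound[of "\<bar>a\<bar>" "\<bar>b\<bar>"] by (simp add: abs_mult)
    then show ?thesis by linarith
  qed
  then show "AE \<omega> in M. norm (X \<omega> * Y \<omega>) \<le> norm ((X \<omega>)\<^sup>2 + (Y \<omega>)\<^sup>2)"
    by simp
qed

lemma (in finite_measure) sq_integrable_const: "sq_integrable M (\<lambda>_. c)"
  by (simp add: sq_integrable_def)

lemma (in finite_measure) sq_integrable_integrable: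
  assumes "sq_integrable M X"
  shows "integrable M X"
  using sq_integrable_mult[OF assms sq_integrable_const[of 1]] by simp

lemma sq_integrable_add:
  assumes "sq_integrable M X" "sq_integrable M Y"
  shows "sq_integrable M (\<lambda>\<omega>. X \<omega> + Y \<omega>)"
proof -
  have "integrable M (\<lambda>\<omega>. (X \<omega>)\<^sup>2 + (Y \<omega>)\<^sup>2 + 2 * (X \<omega> * Y \<omega>))"
    using assms sq_integrable_mult[OF assms] by (simp add: sq_integrable_def)
  then show ?thesis
    using assms by (auto simp: sq_integrable_def power2_sum ac_simps)
qed

lemma sq_integrable_cmult:
  assumes "sq_integrable M X"
  shows "sq_integrable M (\<lambda>\<omega>. c * X \<omega>)"
  using assms by (auto simp: sq_integrable_def power_mult_distrib)

lemma sq_integrable_sum: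
  assumes "\<And>i. i \<in> I \<Longrightarrow> sq_integrable M (X i)"
  shows "sq_integrable M (\<lambda>\<omega>. \<Sum>i\<in>I. X i \<omega>)"
  using assms
proof (induction I rule: infinite_finite_induct)
  case (insert i I)
  then show ?case by (simp add: sq_integrable_add)
qed (simp_all add: sq_integrable_def)

lemma integral_mult_le_sqrt:
  assumes "sq_integrable M X" "sq_integrable M Y"
  shows "\<bar>\<integral>\<omega>. X \<omega> * Y \<omega> \<partial>M\<bar> \<le> sqrt (\<integral>\<omega>. (X \<omega>)\<^sup>2 \<partial>M) * sqrt (\<integral>\<omega>. (Y \<omega>)\<^sup>2 \<partial>M)"
proof -
  have "(\<integral>\<omega>. X \<omega> * Y \<omega> \<partial>M)\<^sup>2 \<le> (\<integral>\<omega>. (X \<omega>)\<^sup>2 \<partial>M) * (\<integral>\<omega>. (Y \<omega>)\<^sup>2 \<partial>M)"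
  proof (rule quadratic_nonneg_imp)
    fix t :: real
    have "0 \<le> (\<integral>\<omega>. (X \<omega> + t * Y \<omega>)\<^sup>2 \<partial>M)" by simp
    also have "\<dots> = (\<integral>\<omega>. (X \<omega>)\<^sup>2 + 2 * t * (X \<omega> * Y \<omega>) + t\<^sup>2 * (Y \<omega>)\<^sup>2 \<partial>M)"
      by (intro Bochner_Integration.integral_cong) (auto simp: power2_eq_square algebra_simps)
    also have "\<dots> = (\<integral>\<omega>. (X \<omega>)\<^sup>2 \<partial>M) + 2 * t * (\<integral>\<omega>. X \<omega> * Y \<omega> \<partial>M) + t\<^sup>2 * (\<integral>\<omega>. (Y \<omega>)\<^sup>2 \<partial>M)"
      using assms sq_integrable_mult[OF assms] by (simp add: sq_integrable_def)
    finally show "0 \<le> (\<integral>\<omega>. (X \<omega>)\<^sup>2 \<partial>M) + 2 * t * (\<integral>\<omega>. X \<omega> * Y \<omega> \<partial>M) + t\<^sup>2 * (\<integral>\<omega>. (Y \<omega>)\<^sup>2 \<partial>M)" .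
  qed simp
  then have "sqrt ((\<integral>\<omega>. X \<omega> * Y \<omega> \<partial>M)\<^sup>2) \<le> sqrt ((\<integral>\<omega>. (X \<omega>)\<^sup>2 \<partial>M) * (\<integral>\<omega>. (Y \<omega>)\<^sup>2 \<partial>M))"
    by (rule real_sqrt_le_mono)
  then show ?thesis by (simp add: real_sqrt_mult)
qed

section \<open>First and second moments of normal vectors\<close>

abbreviation std_gauss :: "nat \<Rightarrow> (nat \<Rightarrow> real) measure" where
  "std_gauss n \<equiv> Pi\<^sub>M {..<n} (\<lambda>_. density lborel std_normal_density)"

lemma std_normal_prob_space: "prob_space (density lborel std_normal_density)"
  by (rule prob_space_normal_density) simp

lemma std_gauss_prob_space: "prob_space (std_gauss n)"
  by (intro prob_space_PiM std_normal_prob_space)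

lemma std_gauss_component_measurable:
  "i < n \<Longrightarrow> (\<lambda>z. z i) \<in> borel_measurable (std_gauss n)"
  using measurable_component_singleton[of i "{..<n}" "\<lambda>_. density lborel std_normal_density"]
  by (simp cong: measurable_cong_sets)

lemma std_normal_moments:
  "integrable (density lborel std_normal_density) (\<lambda>x. x)"
  "(\<integral>x. x \<partial>density lborel std_normal_density) = 0"
  "integrable (density lborel std_normal_density) (\<lambda>x. x\<^sup>2)"
  "(\<integral>x. x\<^sup>2 \<partial>density lborel std_normal_density) = 1"
proof -
  have 1: "has_bochner_integral lborel (\<lambda>x. std_normal_density x * x) 0"
    using std_normal_moment_odd[of 0] by simp
  have 2: "has_bochner_integral lborel (\<lambda>x. std_normal_density x * x\<^sup>2) 1"
    using std_normal_moment_even[of 1] by (simp add: fact_2)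
  have "has_bochner_integral (density lborel std_normal_density) (\<lambda>x. x) 0"
    by (rule has_bochner_integral_density) (use 1 in auto)
  then show "integrable (density lborel std_normal_density) (\<lambda>x. x)"
    "(\<integral>x. x \<partial>density lborel std_normal_density) = 0"
    by (simp_all add: has_bochner_integral_iff)
  have "has_bochner_integral (density lborel std_normal_density) (\<lambda>x. x\<^sup>2) 1"
    by (rule has_bochner_integral_density) (use 2 in auto)
  then show "integrable (density lborel std_normal_density) (\<lambda>x. x\<^sup>2)"
    "(\<integral>x. x\<^sup>2 \<partial>density lborel std_normal_density) = 1"
    by (simp_all add: has_bochner_integral_iff)
qed

text \<open>Fubini applies to products over all coordinates, so the factors outside \<open>J\<close>
  are filled with the constant 1, which has integral 1. One- and two-element sets \<open>J\<close>
  yield the moments below.\<close>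

lemma std_gauss_prod:
  assumes J: "J \<subseteq> {..<n}"
    and g: "\<And>k. k \<in> J \<Longrightarrow> integrable (density lborel std_normal_density) (g k :: real \<Rightarrow> real)"
  shows "integrable (std_gauss n) (\<lambda>z. \<Prod>k\<in>J. g k (z k))"
    "(\<integral>z. (\<Prod>k\<in>J. g k (z k)) \<partial>std_gauss n) = (\<Prod>k\<in>J. \<integral>x. g k x \<partial>density lborel std_normal_density)"
proof -
  interpret N: prob_space "density lborel std_normal_density" by (rule std_normal_prob_space)
  interpret product_sigma_finite "\<lambda>_::nat. density lborel std_normal_density"
    by standard
  let ?f = "\<lambda>k. if k \<in> J then g k else (\<lambda>_. 1)"
  have eq: "(\<lambda>z. \<Prod>k<n. ?f k (z k)) = (\<lambda>z. \<Prod>k\<in>J. g k (z k))"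
    using J by (intro ext prod.mono_neutral_cong_right) auto
  have int: "integrable (density lborel std_normal_density) (?f k)" for k
    using g by (simp add: N.integrable_const)
  show "integrable (std_gauss n) (\<lambda>z. \<Prod>k\<in>J. g k (z k))"
    using product_integrable_prod[of "{..<n}" ?f] int unfolding eq by simp
  have "(\<integral>z. (\<Prod>k<n. ?f k (z k)) \<partial>std_gauss n) = (\<Prod>k<n. \<integral>x. ?f k x \<partial>density lborel std_normal_density)"
    using int by (intro product_integral_prod) auto
  also have "\<dots> = (\<Prod>k\<in>J. \<integral>x. g k x \<partial>density lborel std_normal_density)"
    using J by (intro prod.mono_neutral_cong_right) (use N.prob_space in \<open>auto\<close>)
  finally show "(\<integral>z. (\<Prod>k\<in>J. g k (z k)) \<partial>std_gauss n) =
      (\<Prod>k\<in>J. \<integral>x. g k x \<partial>density lborel std_normal_density)"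
    unfolding eq .
qed

lemma std_gauss_moments:
  assumes "i < n" "j < n"
  shows "integrable (std_gauss n) (\<lambda>z. z i)" "(\<integral>z. z i \<partial>std_gauss n) = 0"
    "integrable (std_gauss n) (\<lambda>z. z i * z j)"
    "(\<integral>z. z i * z j \<partial>std_gauss n) = (if i = j then 1 else 0)"
proof -
  show "integrable (std_gauss n) (\<lambda>z. z i)" "(\<integral>z. z i \<partial>std_gauss n) = 0"
    using std_gauss_prod[of "{i}" n "\<lambda>_ x. x"] assms std_normal_moments by auto
  have "integrable (std_gauss n) (\<lambda>z. z i * z j) \<and>
      (\<integral>z. z i * z j \<partial>std_gauss n) = (if i = j then 1 else 0)"
  proof (cases "i = j")
    case True
    then show ?thesis
      using std_gauss_prod[of "{i}" n "\<lambda>_ x. x\<^sup>2"] assms std_normal_moments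
      by (auto simp: power2_eq_square)
  next
    case False
    then show ?thesis
      using std_gauss_prod[of "{i, j}" n "\<lambda>_ x. x"] assms std_normal_moments by auto
  qed
  then show "integrable (std_gauss n) (\<lambda>z. z i * z j)"
    "(\<integral>z. z i * z j \<partial>std_gauss n) = (if i = j then 1 else 0)" by auto
qed

lemma std_gauss_linear:
  assumes r: "r \<in> carrier_vec n"
  shows "sq_integrable (std_gauss n) (\<lambda>z. scalar_prod r (Matrix.vec n z))"
    "(\<integral>z. scalar_prod r (Matrix.vec n z) \<partial>std_gauss n) = 0"
    "(\<integral>z. (scalar_prod r (Matrix.vec n z))\<^sup>2 \<partial>std_gauss n) = scalar_prod r r"
proof -
  have eq: "scalar_prod r (Matrix.vec n z) = (\<Sum>i<n. r $ i * z i)" for z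
    by (simp add: scalar_prod_def lessThan_atLeast0)
  have sq: "(scalar_prod r (Matrix.vec n z))\<^sup>2 = (\<Sum>i<n. \<Sum>j<n. r $ i * r $ j * (z i * z j))" for z
    unfolding eq power2_eq_square sum_product by (simp add: ac_simps)
  have meas: "(\<lambda>z. scalar_prod r (Matrix.vec n z)) \<in> borel_measurable (std_gauss n)"
    unfolding eq by (intro borel_measurable_sum borel_measurable_times std_gauss_component_measurable) auto
  show "sq_integrable (std_gauss n) (\<lambda>z. scalar_prod r (Matrix.vec n z))"
    unfolding sq_integrable_def using meas unfolding sq
    by (auto intro!: Bochner_Integration.integrable_sum integrable_mult_right std_gauss_moments)
  show "(\<integral>z. scalar_prod r (Matrix.vec n z) \<partial>std_gauss n) = 0"
    unfolding eq by (subst Bochner_Integration.integral_sum) (auto simp: std_gauss_moments)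
  have "(\<integral>z. (scalar_prod r (Matrix.vec n z))\<^sup>2 \<partial>std_gauss n) =
      (\<Sum>i<n. \<Sum>j<n. r $ i * r $ j * (if i = j then 1 else 0))"
    unfolding sq
    by (subst Bochner_Integration.integral_sum
        | auto simp: std_gauss_moments intro!: Bochner_Integration.integrable_sum sum.cong)+
  also have "\<dots> = scalar_prod r r"
    using r by (simp add: scalar_prod_def lessThan_atLeast0 if_distrib cong: if_cong)
  finally show "(\<integral>z. (scalar_prod r (Matrix.vec n z))\<^sup>2 \<partial>std_gauss n) = scalar_prod r r" .
qed

lemma vec_borel_component_measurable:
  assumes "i < n"
  shows "(\<lambda>v. v $ i) \<in> borel_measurable (vec_borel n)"
proof -
  have "(\<lambda>v. \<lambda>i\<in>{..<n}. v $ i) \<in> measurable (vec_borel n) (Pi\<^sub>M {..<n} (\<lambda>_. borel))"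
    unfolding vec_borel_def by (rule measurable_vimage_algebra1) (auto simp: space_PiM)
  from measurable_compose[OF this measurable_component_singleton[of i "{..<n}" "\<lambda>_. borel"]] assms
  show ?thesis by simp
qed

lemma space_vec_borel: "space (vec_borel n) = carrier_vec n"
  by (simp add: vec_borel_def)

lemma measurable_into_vec_borel:
  assumes "\<And>\<omega>. \<omega> \<in> space M \<Longrightarrow> X \<omega> \<in> carrier_vec n"
    and "\<And>i. i < n \<Longrightarrow> (\<lambda>\<omega>. X \<omega> $ i) \<in> borel_measurable M"
  shows "X \<in> measurable M (vec_borel n)"
  unfolding vec_borel_def
  by (rule measurable_vimage_algebra2) (use assms in \<open>auto intro!: measurable_restrict\<close>)

lemma scalar_prod_measurable_vec_borel:
  assumes "q \<in> carrier_vec n"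
  shows "(\<lambda>v. scalar_prod q v) \<in> borel_measurable (vec_borel n)"
proof -
  have "(\<lambda>v. scalar_prod q v) \<in> borel_measurable (vec_borel n) \<longleftrightarrow>
      (\<lambda>v. \<Sum>i<n. q $ i * v $ i) \<in> borel_measurable (vec_borel n)"
    by (intro measurable_cong) (auto simp: space_vec_borel scalar_prod_def lessThan_atLeast0)
  then show ?thesis
    by (auto intro!: borel_measurable_sum borel_measurable_times vec_borel_component_measurable)
qed

text \<open>Moving the symmetric root \<open>R\<close> of the covariance to the other side gives
  \<open><q, mu + R z> = <q, mu> + <R q, z>\<close>, and \<open>|R q|^2 = <q, Sigma q>\<close>. A
  singular covariance causes no difficulty.\<close>

lemma normal_law_linear:
  assumes \<mu>: "\<mu> \<in> carrier_vec n" and \<Sigma>: "\<Sigma> \<in> carrier_mat n n" "pos_semidef_mat \<Sigma>"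
    and q: "q \<in> carrier_vec n"
  shows "sq_integrable (normal_law n \<mu> \<Sigma>) (\<lambda>v. scalar_prod q v)"
    "(\<integral>v. scalar_prod q v \<partial>normal_law n \<mu> \<Sigma>) = scalar_prod q \<mu>"
    "(\<integral>v. (scalar_prod q v)\<^sup>2 \<partial>normal_law n \<mu> \<Sigma>) = (scalar_prod q \<mu>)\<^sup>2 + scalar_prod q (\<Sigma> *\<^sub>v q)"
proof -
  interpret G: prob_space "std_gauss n" by (rule std_gauss_prob_space)
  note R = mat_sqrt_props[OF \<Sigma>]
  let ?R = "mat_sqrt \<Sigma>" and ?T = "\<lambda>z. \<mu> + mat_sqrt \<Sigma> *\<^sub>v Matrix.vec n z"
  let ?r = "?R *\<^sub>v q"
  have r: "?r \<in> carrier_vec n" using R(1) q by simp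
  have T: "?T \<in> measurable (std_gauss n) (vec_borel n)"
  proof (rule measurable_into_vec_borel)
    show "?T z \<in> carrier_vec n" for z using \<mu> R(1) by simp
    fix i assume i: "i < n"
    have "?T z $ i = \<mu> $ i + (\<Sum>j<n. ?R $$ (i, j) * z j)" for z
      using \<mu> R(1) i by (simp add: scalar_prod_def lessThan_atLeast0)
    then show "(\<lambda>z. ?T z $ i) \<in> borel_measurable (std_gauss n)"
      by (auto intro!: borel_measurable_add borel_measurable_sum borel_measurable_times
          std_gauss_component_measurable)
  qed
  have lin: "scalar_prod q (?T z) = scalar_prod q \<mu> + scalar_prod ?r (Matrix.vec n z)" for z
  proof -
    have "scalar_prod q (?R *\<^sub>v Matrix.vec n z) = scalar_prod ?r (Matrix.vec n z)"
      by (rule scalar_prod_sym_mat[OF R(1,2) q, symmetric]) simp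
    then show ?thesis using scalar_prod_add_distrib[OF q \<mu>, of "?R *\<^sub>v Matrix.vec n z"] R(1) by simp
  qed
  have rr: "scalar_prod ?r ?r = scalar_prod q (\<Sigma> *\<^sub>v q)"
    using scalar_prod_sym_mat[OF R(1,2) q r] assoc_mult_mat_vec[OF R(1) R(1) q] R(3) by simp
  note sm = scalar_prod_measurable_vec_borel[OF q]
  note mom = std_gauss_linear[OF r]
  have "sq_integrable (std_gauss n) (\<lambda>z. scalar_prod q (?T z))"
    unfolding lin by (intro sq_integrable_add mom G.sq_integrable_const)
  then show "sq_integrable (normal_law n \<mu> \<Sigma>) (\<lambda>v. scalar_prod q v)"
    unfolding sq_integrable_def normal_law_def using sm T
    by (auto simp: integrable_distr_eq)
  have int: "integrable (std_gauss n) (\<lambda>z. scalar_prod ?r (Matrix.vec n z))"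
    by (rule G.sq_integrable_integrable[OF mom(1)])
  show "(\<integral>v. scalar_prod q v \<partial>normal_law n \<mu> \<Sigma>) = scalar_prod q \<mu>"
    unfolding normal_law_def integral_distr[OF T sm] lin
    using int mom by (simp add: G.prob_space)
  have "(\<integral>v. (scalar_prod q v)\<^sup>2 \<partial>normal_law n \<mu> \<Sigma>) = (\<integral>z. (scalar_prod q (?T z))\<^sup>2 \<partial>std_gauss n)"
    unfolding normal_law_def using sm by (intro integral_distr[OF T]) auto
  also have "\<dots> = (\<integral>z. (scalar_prod q \<mu>)\<^sup>2 + (2 * scalar_prod q \<mu> * scalar_prod ?r (Matrix.vec n z)
      + (scalar_prod ?r (Matrix.vec n z))\<^sup>2) \<partial>std_gauss n)"
    unfolding lin by (intro Bochner_Integration.integral_cong) (auto simp: power2_sum)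
  also have "\<dots> = (scalar_prod q \<mu>)\<^sup>2 + scalar_prod q (\<Sigma> *\<^sub>v q)"
    using int mom rr by (simp add: sq_integrable_def G.prob_space)
  finally show "(\<integral>v. (scalar_prod q v)\<^sup>2 \<partial>normal_law n \<mu> \<Sigma>) =
      (scalar_prod q \<mu>)\<^sup>2 + scalar_prod q (\<Sigma> *\<^sub>v q)" .
qed

lemma has_law_normal_linear:
  assumes X: "has_law \<Omega> n X (normal_law n \<mu> \<Sigma>)"
    and \<mu>: "\<mu> \<in> carrier_vec n" and \<Sigma>: "\<Sigma> \<in> carrier_mat n n" "pos_semidef_mat \<Sigma>"
    and q: "q \<in> carrier_vec n"
  shows "sq_integrable \<Omega> (\<lambda>\<omega>. scalar_prod q (X \<omega>))"
    "(\<integral>\<omega>. scalar_prod q (X \<omega>) \<partial>\<Omega>) = scalar_prod q \<mu>"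
    "(\<integral>\<omega>. (scalar_prod q (X \<omega>))\<^sup>2 \<partial>\<Omega>) = (scalar_prod q \<mu>)\<^sup>2 + scalar_prod q (\<Sigma> *\<^sub>v q)"
proof -
  have m: "X \<in> measurable \<Omega> (vec_borel n)" and d: "normal_law n \<mu> \<Sigma> = distr \<Omega> (vec_borel n) X"
    using X by (auto simp: has_law_def)
  note sm = scalar_prod_measurable_vec_borel[OF q]
  note N = normal_law_linear[OF \<mu> \<Sigma> q, unfolded d]
  show "sq_integrable \<Omega> (\<lambda>\<omega>. scalar_prod q (X \<omega>))"
    using N(1) sm m by (auto simp: sq_integrable_def integrable_distr_eq)
  show "(\<integral>\<omega>. scalar_prod q (X \<omega>) \<partial>\<Omega>) = scalar_prod q \<mu>"
    using N(2) by (simp add: integral_distr[OF m sm])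
  show "(\<integral>\<omega>. (scalar_prod q (X \<omega>))\<^sup>2 \<partial>\<Omega>) = (scalar_prod q \<mu>)\<^sup>2 + scalar_prod q (\<Sigma> *\<^sub>v q)"
    using N(3) integral_distr[OF m, of "\<lambda>v. (scalar_prod q v)\<^sup>2"] sm by simp
qed

lemma has_law_normal_component:
  assumes X: "has_law \<Omega> n X (normal_law n \<mu> \<Sigma>)"
    and \<mu>: "\<mu> \<in> carrier_vec n" and \<Sigma>: "\<Sigma> \<in> carrier_mat n n" "pos_semidef_mat \<Sigma>"
    and i: "i < n"
  shows "sq_integrable \<Omega> (\<lambda>\<omega>. X \<omega> $ i)" "(\<integral>\<omega>. X \<omega> $ i \<partial>\<Omega>) = \<mu> $ i"
proof -
  have "X \<in> measurable \<Omega> (vec_borel n)" using X by (simp add: has_law_def)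
  then have c: "\<omega> \<in> space \<Omega> \<Longrightarrow> X \<omega> \<in> carrier_vec n" for \<omega>
    using measurable_space[of X \<Omega> "vec_borel n" \<omega>] by (simp add: space_vec_borel)
  then have eq: "\<omega> \<in> space \<Omega> \<Longrightarrow> scalar_prod (unit_vec n i) (X \<omega>) = X \<omega> $ i" for \<omega>
    using scalar_prod_left_unit[OF _ i] by blast
  note L = has_law_normal_linear[OF X \<mu> \<Sigma> unit_vec_carrier, of i]
  have "(\<integral>\<omega>. X \<omega> $ i \<partial>\<Omega>) = (\<integral>\<omega>. scalar_prod (unit_vec n i) (X \<omega>) \<partial>\<Omega>)"
    by (intro Bochner_Integration.integral_cong) (auto simp: eq)
  then show "(\<integral>\<omega>. X \<omega> $ i \<partial>\<Omega>) = \<mu> $ i" using L(2) \<mu> i by simp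
  show "sq_integrable \<Omega> (\<lambda>\<omega>. X \<omega> $ i)"
    using L(1) unfolding sq_integrable_def
    by (simp add: eq cong: measurable_cong Bochner_Integration.integrable_cong)
qed

section \<open>Convergence of the V-cycle\<close>

definition sym_op :: "('h::real_inner \<Rightarrow> 'h) \<Rightarrow> bool" where
  "sym_op e \<longleftrightarrow> linear e \<and> (\<forall>x y. inner (e x) y = inner x (e y))"

lemma sym_op_linear: "sym_op e \<Longrightarrow> linear e"
  by (simp add: sym_op_def)

lemma sym_op_inner: "sym_op e \<Longrightarrow> inner (e x) y = inner x (e y)"
  by (simp add: sym_op_def)

lemma sym_op_id_minus: "sym_op e \<Longrightarrow> sym_op (\<lambda>x. x - e x)"
  unfolding sym_op_def by (auto simp: inner_diff_left inner_diff_right intro!: linear_compose_sub linear_ident)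

lemma sym_op_funpow: "sym_op s \<Longrightarrow> sym_op (s ^^ m)"
proof (induction m)
  case 0
  then show ?case by (simp add: sym_op_def linear_id[unfolded id_def] id_def)
next
  case (Suc m)
  then have "sym_op (s ^^ m)" by simp
  moreover have "linear (s \<circ> s ^^ m)"
    using Suc by (intro linear_compose) (auto simp: sym_op_def)
  ultimately show ?case
    using Suc.prems unfolding sym_op_def by (simp add: funpow_swap1)
qed

lemma sym_op_conj:
  assumes "sym_op s" "sym_op e"
  shows "sym_op (\<lambda>x. s (e (s x)))"
  using assms linear_compose[OF linear_compose[of s e] , of s] unfolding sym_op_def by (simp add: o_def)

text \<open>Cauchy-Schwarz for the form of \<open>e\<close> at \<open>x\<close> and
  \<open>e x\<close> bounds \<open>|e x|^4\<close> by \<open>r |x|^2 * r |e x|^2\<close>. The upper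
  bound is assumed only at these two vectors, so that the lemma can be applied on an invariant
  subspace.\<close>

lemma sym_op_norm_bound:
  fixes e :: "'h::real_inner \<Rightarrow> 'h"
  assumes e: "sym_op e" and nonneg: "\<And>x. 0 \<le> inner (e x) x"
    and le: "inner (e x) x \<le> r * (norm x)\<^sup>2" "inner (e (e x)) (e x) \<le> r * (norm (e x))\<^sup>2"
    and r: "0 \<le> r"
  shows "norm (e x) \<le> r * norm x"
proof (cases "e x = 0")
  case False
  interpret e: linear e using e by (rule sym_op_linear)
  have "(inner (e x) (e x))\<^sup>2 \<le> inner (e x) x * inner (e (e x)) (e x)"
  proof (rule quadratic_nonneg_imp)
    fix t :: real
    have "0 \<le> inner (e (x + t *\<^sub>R e x)) (x + t *\<^sub>R e x)" by (rule nonneg)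
    also have "\<dots> = inner (e x) x + 2 * t * inner (e x) (e x) + t\<^sup>2 * inner (e (e x)) (e x)"
      using sym_op_inner[OF e, of "e x" x]
      by (simp add: e.add e.scale inner_add_left inner_add_right power2_eq_square algebra_simps)
    finally show "0 \<le> inner (e x) x + 2 * t * inner (e x) (e x) + t\<^sup>2 * inner (e (e x)) (e x)" .
  qed (rule nonneg)
  also have "\<dots> \<le> (r * (norm x)\<^sup>2) * (r * (norm (e x))\<^sup>2)"
    using r by (intro mult_mono le nonneg) auto
  also have "(inner (e x) (e x))\<^sup>2 = (norm (e x))\<^sup>2 * (norm (e x))\<^sup>2"
    by (simp only: power2_norm_eq_inner power2_eq_square[of "inner (e x) (e x)"])
  also have "r * (norm x)\<^sup>2 * (r * (norm (e x))\<^sup>2) = (r * norm x)\<^sup>2 * (norm (e x))\<^sup>2"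
    by (simp add: power2_eq_square)
  finally have "(norm (e x))\<^sup>2 \<le> (r * norm x)\<^sup>2"
    by (rule mult_right_le_imp_le) (simp add: False)
  then show ?thesis using r by (simp add: power2_le_iff_abs_le)
qed (use r in simp)

text \<open>With \<open>d j = \<langle>s\<^sup>j x, x\<rangle>\<close>, a convex sequence, this bounds the decrease
  \<open>d \<nu> - d (\<nu> + 1)\<close> by the average of the first \<open>\<nu>\<close> decreases, which replaces the spectral
  calculus in the usual proof of the smoothing property.\<close>

lemma smoothing_property:
  fixes k :: "'h::real_inner \<Rightarrow> 'h"
  assumes k: "sym_op k" "\<And>x. (norm (k x))\<^sup>2 \<le> inner (k x) x"
  defines "s \<equiv> \<lambda>x. x - k x"
  shows "real (2 * m) * inner (k ((s ^^ m) x)) ((s ^^ m) x) + (norm ((s ^^ m) x))\<^sup>2 \<le> (norm x)\<^sup>2"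
proof -
  have s: "sym_op s" unfolding s_def by (rule sym_op_id_minus[OF k(1)])
  have sp: "sym_op (s ^^ j)" for j by (rule sym_op_funpow[OF s])
  \<comment> \<open>The hypothesis on \<open>k\<close> forces
    \<open>norm (k z) \<le> norm z\<close>, hence
    \<open>inner (k z) z \<le> (norm z)\<^sup>2\<close>, which is nonnegativity of
    \<open>s\<close>.\<close>
  have s_nonneg: "0 \<le> inner (s z) z" for z
  proof -
    have "inner (k z) z \<le> norm (k z) * norm z" by (rule norm_cauchy_schwarz)
    moreover have "norm (k z) \<le> norm z"
    proof (rule ccontr)
      assume "\<not> norm (k z) \<le> norm z"
      then have "norm (k z) * norm z < norm (k z) * norm (k z)"
        using norm_ge_zero[of z] by (intro mult_strict_left_mono) linarith+
      then show False using calculation k(2)[of z] by (simp add: power2_eq_square)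
    qed
    ultimately have "inner (k z) z \<le> norm z * norm z"
      using mult_right_mono[of "norm (k z)" "norm z" "norm z"] by simp
    then show ?thesis by (simp add: s_def inner_diff_left dot_square_norm power2_eq_square)
  qed
  \<comment> \<open>Two factors \<open>s\<close> are moved symmetrically onto \<open>z\<close>,
    which lowers the exponent by 2; the parities end at the identity and at
    \<open>s\<close>.\<close>
  have pow_nonneg: "0 \<le> inner ((s ^^ j) z) z" for j z
  proof (induction j arbitrary: z rule: less_induct)
    case (less j)
    consider "j = 0" | "j = 1" | i where "j = Suc (Suc i)" by (cases j; cases "j - 1") auto
    then show ?case
    proof cases
      case 3
      have "inner ((s ^^ j) z) z = inner ((s ^^ i) (s z)) (s z)"
      proof -
        have "(s ^^ j) z = s ((s ^^ i) (s z))" using 3 by (simp add: funpow_swap1)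
        then show ?thesis by (simp add: sym_op_inner[OF s])
      qed
      then show ?thesis using less[of i "s z"] 3 by simp
    qed (use s_nonneg in auto)
  qed
  define d where "d j = inner ((s ^^ j) x) x" for j
  \<comment> \<open>The second difference of \<open>d\<close> at \<open>j\<close> is the form of
    \<open>s ^^ j\<close> at \<open>k x\<close>, which is nonnegative.\<close>
  have convex: "d (Suc j) - d (Suc (Suc j)) \<le> d j - d (Suc j)" for j
  proof -
    have kx: "k x = x - s x" by (simp add: s_def)
    have "(s ^^ j) (k x) = (s ^^ j) x - (s ^^ Suc j) x"
      unfolding kx using linear_diff[OF sym_op_linear[OF sp[of j]]] by (simp add: funpow_swap1)
    then have "inner ((s ^^ j) (k x)) (k x) = d j - 2 * d (Suc j) + d (Suc (Suc j))"
    proof -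
      have "inner ((s ^^ j) x) (s x) = d (Suc j)" "inner ((s ^^ Suc j) x) (s x) = d (Suc (Suc j))"
        using sym_op_inner[OF s, of "(s ^^ j) x" x] sym_op_inner[OF s, of "(s ^^ Suc j) x" x]
        by (simp_all add: d_def)
      moreover have "inner ((s ^^ j) x) x = d j" "inner ((s ^^ Suc j) x) x = d (Suc j)"
        by (simp_all only: d_def)
      ultimately show ?thesis
        unfolding \<open>(s ^^ j) (k x) = _\<close> by (simp only: kx inner_diff_left inner_diff_right)
    qed
    then show ?thesis using pow_nonneg[of j "k x"] by simp
  qed
  have dec: "d (j + i) - d (Suc (j + i)) \<le> d j - d (Suc j)" for i j
  proof (induction i)
    case (Suc i)
    then show ?case using convex[of "j + i"] by simp
  qed simp
  \<comment> \<open>The decreases of a convex sequence get smaller, so each of the first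
    \<open>n\<close> is at least the one at \<open>n\<close>, and their sum telescopes.\<close>
  have "real n * (d n - d (Suc n)) \<le> d 0 - d n" for n
  proof -
    have "real n * (d n - d (Suc n)) = (\<Sum>j<n. d n - d (Suc n))" by simp
    also have "\<dots> \<le> (\<Sum>j<n. d j - d (Suc j))"
      using dec[of _ "n - _"] by (intro sum_mono) (metis le_add_diff_inverse lessThan_iff less_imp_le)
    also have "\<dots> = d 0 - d n" by (induction n) auto
    finally show ?thesis .
  qed
  \<comment> \<open>Splitting \<open>2 * m\<close> evenly by symmetry turns \<open>d (2 * m)\<close>
    into the squared norm of \<open>(s ^^ m) x\<close> and the next decrease into the form of
    \<open>k\<close> at that vector.\<close>
  from this[of "2 * m"] have "real (2 * m) * (d (2 * m) - d (Suc (2 * m))) \<le> d 0 - d (2 * m)" .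
  moreover have "inner ((s ^^ m) (s ((s ^^ m) x))) x = d (Suc (2 * m))"
    by (simp add: d_def mult_2 funpow_add funpow_swap1)
  moreover have "inner ((s ^^ m) ((s ^^ m) x)) x = d (2 * m)"
    by (simp add: d_def mult_2 funpow_add)
  moreover have "inner (k ((s ^^ m) x)) ((s ^^ m) x) =
      inner ((s ^^ m) ((s ^^ m) x)) x - inner ((s ^^ m) (s ((s ^^ m) x))) x"
  proof -
    have "k z = z - s z" for z by (simp add: s_def)
    then show ?thesis by (simp only: sym_op_inner[OF sp] inner_diff_left)
  qed
  moreover have "(norm ((s ^^ m) x))\<^sup>2 = inner ((s ^^ m) ((s ^^ m) x)) x"
    by (simp add: sym_op_inner[OF sp] power2_norm_eq_inner)
  ultimately show ?thesis by (simp add: d_def power2_norm_eq_inner)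
qed

text \<open>\<open>p l\<close> is the orthogonal projection onto the space of level
  \<open>l\<close>; by symmetry \<open>p_nested\<close> expresses that these spaces increase, and
  \<open>k_p\<close> that smoothing acts only inside its own level. The smoother axioms start at
  \<open>Suc l\<close> because level 0 is solved exactly. \<open>m\<close> counts the smoothing
  steps on each side of the coarse correction.\<close>

locale multilevel =
  fixes p k :: "nat \<Rightarrow> 'h::real_inner \<Rightarrow> 'h" and C :: real and m :: nat
  assumes C_pos: "0 < C" and m_pos: "0 < m"
    and p_sym: "\<And>l. sym_op (p l)" and p_idem: "\<And>l x. p l (p l x) = p l x"
    and p_nested: "\<And>l x. p l (p (Suc l) x) = p l x"
    and k_sym: "\<And>l. sym_op (k (Suc l))"
    and k_bound: "\<And>l x. (norm (k (Suc l) x))\<^sup>2 \<le> inner (k (Suc l) x) x"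
    and k_p: "\<And>l x. k (Suc l) (p (Suc l) x) = k (Suc l) x"
    and approx: "\<And>l x. inner (p (Suc l) x) x - inner (p l x) x \<le> C * inner (k (Suc l) x) x"
begin

definition smooth :: "nat \<Rightarrow> 'h \<Rightarrow> 'h" where
  "smooth l x = x - k l x"

text \<open>The error propagation of a V-cycle. Since \<open>err l\<close> is the identity on the kernel of \<open>p l\<close>,
  no projection is needed when it is used as the coarse grid correction on level \<open>l + 1\<close>.\<close>

primrec err :: "nat \<Rightarrow> 'h \<Rightarrow> 'h" where
  "err 0 = (\<lambda>x. x - p 0 x)"
| "err (Suc l) = (\<lambda>x. (smooth (Suc l) ^^ m) (err l ((smooth (Suc l) ^^ m) x)))"

text \<open>The solution of the balance equation
  \<open>(1 - rate) * C = real (2 * m) * rate\<close>, at which the cost of the approximation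
  property in \<open>err_le\<close> equals the gain from smoothing.\<close>

definition rate :: real where
  "rate = C / (C + real (2 * m))"

lemma rate_bounds: "0 \<le> rate" "rate < 1" "(1 - rate) * C = real (2 * m) * rate"
  using C_pos m_pos by (auto simp: rate_def field_simps)

lemma smooth_sym: "sym_op (smooth (Suc l))"
  unfolding smooth_def[abs_def] by (rule sym_op_id_minus[OF k_sym])

lemma smooth_pow_sym: "sym_op (smooth (Suc l) ^^ j)"
  by (rule sym_op_funpow[OF smooth_sym])

lemma err_sym: "sym_op (err l)"
  by (induction l) (auto intro: sym_op_id_minus[OF p_sym] sym_op_conj[OF smooth_pow_sym])

lemma err_add: "err l (x + y) = err l x + err l y"
  by (rule linear_add[OF sym_op_linear[OF err_sym]])

lemma err_diff: "err l (x - y) = err l x - err l y"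
  by (rule linear_diff[OF sym_op_linear[OF err_sym]])

lemma p_minus_p: "p l (x - p l x) = 0"
  by (simp add: linear_diff[OF sym_op_linear[OF p_sym]] p_idem)

lemma smooth_pow_kernel:
  assumes "p (Suc l) x = 0"
  shows "(smooth (Suc l) ^^ j) x = x"
proof -
  have "k (Suc l) x = k (Suc l) 0" using k_p[of l x] assms by simp
  then have "smooth (Suc l) x = x"
    by (simp add: smooth_def linear_0[OF sym_op_linear[OF k_sym]])
  then show ?thesis by (induction j) auto
qed

text \<open>The kernel of a finer projection is contained in the kernels of all coarser ones, so
  neither smoothing nor coarse correction moves such a vector.\<close>

lemma err_kernel: "p l x = 0 \<Longrightarrow> err l x = x"
proof (induction l)
  case (Suc l)
  have "p l x = p l 0" using p_nested[of l x] Suc.prems by simp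
  then have "p l x = 0" by (simp add: linear_0[OF sym_op_linear[OF p_sym]])
  then show ?case using Suc.IH by (simp add: smooth_pow_kernel[OF Suc.prems])
qed simp

text \<open>By \<open>err_kernel\<close>, \<open>e p = e - I + p\<close>. The right-hand side is
  symmetric, so \<open>e p\<close> equals its adjoint \<open>p e\<close>.\<close>

lemma err_p: "err l (p l x) = p l (err l x)"
proof -
  have 1: "err l (p l y) = err l y - y + p l y" for y
    using err_diff[of l y "y - p l y"] err_kernel[OF p_minus_p, of l y] by (simp add: algebra_simps)
  have "inner (p l (err l x)) y = inner (err l (p l x)) y" for y
    by (simp add: sym_op_inner[OF p_sym] sym_op_inner[OF err_sym] 1 inner_diff_right inner_add_right)
       (simp add: 1 inner_diff_left inner_add_left sym_op_inner[OF p_sym] sym_op_inner[OF err_sym])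
  then show ?thesis by (metis inner_commute vector_eq_rdot)
qed

lemma err_minus_err_p: "err l x - err l (p l x) = x - p l x"
  using err_kernel[OF p_minus_p, of l x] by (simp add: err_diff)

lemma norm_minus_p: "(norm (x - p l x))\<^sup>2 = (norm x)\<^sup>2 - inner (p l x) x"
proof -
  have "inner (p l x) (p l x) = inner (p l x) x"
    by (metis p_idem p_sym sym_op_inner)
  then show ?thesis
    by (simp add: power2_norm_eq_inner inner_diff_left inner_diff_right inner_commute[of x "p l x"])
qed

lemma err_nonneg: "0 \<le> inner (err l x) x"
proof (induction l arbitrary: x)
  case 0
  then show ?case
    using norm_minus_p[of x 0] zero_le_power2[of "norm (x - p 0 x)"]
    by (simp add: inner_diff_left power2_norm_eq_inner del: zero_le_power2)
next
  case (Suc l)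
  then show ?case by (simp add: sym_op_inner[OF smooth_pow_sym])
qed

text \<open>The right-hand side is \<open>rate |p x|^2 + |x - p x|^2\<close>, so the bound is
  \<open>rate\<close> on the range of \<open>p l\<close> and 1 on its complement. In the step from
  \<open>l\<close> to \<open>l + 1\<close>, the part between the two spaces is charged to the
  smoother by \<open>approx\<close>, and \<open>smoothing_property\<close> pays for it.\<close>

lemma err_le: "inner (err l x) x \<le> rate * (norm x)\<^sup>2 + (1 - rate) * (norm (x - p l x))\<^sup>2"
proof (induction l arbitrary: x)
  case 0
  have "inner (err 0 x) x = (norm (x - p 0 x))\<^sup>2"
    unfolding norm_minus_p by (simp add: inner_diff_left power2_norm_eq_inner)
  moreover have "(norm (x - p 0 x))\<^sup>2 \<le> (norm x)\<^sup>2"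
    by (metis norm_minus_p p_idem p_sym sym_op_inner inner_ge_zero diff_le_eq le_add_same_cancel1)
  then have "rate * (norm (x - p 0 x))\<^sup>2 \<le> rate * (norm x)\<^sup>2"
    using rate_bounds by (intro mult_left_mono)
  ultimately show ?case by (simp add: algebra_simps)
next
  case (Suc l)
  let ?y = "(smooth (Suc l) ^^ m) x"
  have "inner (err (Suc l) x) x = inner (err l ?y) ?y"
    by (simp add: sym_op_inner[OF smooth_pow_sym])
  also have "\<dots> \<le> rate * (norm ?y)\<^sup>2 + (1 - rate) * (norm (?y - p l ?y))\<^sup>2"
    by (rule Suc.IH)
  \<comment> \<open>By \<open>norm_minus_p\<close> the complements of two consecutive levels differ
    by exactly the left-hand side of \<open>approx\<close>.\<close>
  also have "\<dots> \<le> rate * (norm ?y)\<^sup>2 +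
      (1 - rate) * ((norm (?y - p (Suc l) ?y))\<^sup>2 + C * inner (k (Suc l) ?y) ?y)"
    using approx[of l ?y] rate_bounds by (intro add_left_mono mult_left_mono) (auto simp: norm_minus_p)
  \<comment> \<open>The smoother commutes with its projection and is the identity on the complement,
    so the complementary component of \<open>x\<close> is untouched.\<close>
  also have "?y - p (Suc l) ?y = x - p (Suc l) x"
  proof -
    have "(smooth (Suc l) ^^ m) (p (Suc l) x) = p (Suc l) ?y"
    proof (induction m)
      case (Suc m)
      have "k (Suc l) z = p (Suc l) (k (Suc l) z)" for z
        by (metis (no_types, lifting) inner_commute k_p k_sym p_sym sym_op_inner vector_eq_rdot)
      then have "smooth (Suc l) (p (Suc l) z) = p (Suc l) (smooth (Suc l) z)" for z
        by (simp add: smooth_def k_p linear_diff[OF sym_op_linear[OF p_sym]])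
      then show ?case using Suc by simp
    qed simp
    moreover have "(smooth (Suc l) ^^ m) (x - p (Suc l) x) = x - p (Suc l) x"
      by (rule smooth_pow_kernel[OF p_minus_p])
    ultimately show ?thesis
      by (simp add: linear_diff[OF sym_op_linear[OF smooth_pow_sym]])
  qed
  \<comment> \<open>The balance equation for \<open>rate\<close> replaces the weight
    \<open>(1 - rate) * C\<close> by \<open>real (2 * m) * rate\<close>, which produces the
    left-hand side of \<open>smoothing_property\<close>.\<close>
  also have "rate * (norm ?y)\<^sup>2 + (1 - rate) * ((norm (x - p (Suc l) x))\<^sup>2 + C * inner (k (Suc l) ?y) ?y)
      = rate * (real (2 * m) * inner (k (Suc l) ?y) ?y + (norm ?y)\<^sup>2)
        + (1 - rate) * (norm (x - p (Suc l) x))\<^sup>2"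
  proof -
    have "rate * c + (1 - rate) * (a + C * b) = rate * (real (2 * m) * b + c) + (1 - rate) * a"
      for a b c
    proof -
      have "(1 - rate) * (C * b) = rate * (real (2 * m) * b)"
        using arg_cong[OF rate_bounds(3), of "\<lambda>t. t * b"] by (simp only: ac_simps)
      then show ?thesis by (simp only: distrib_left ac_simps)
    qed
    then show ?thesis .
  qed
  also have "\<dots> \<le> rate * (norm x)\<^sup>2 + (1 - rate) * (norm (x - p (Suc l) x))\<^sup>2"
  proof -
    have "smooth (Suc l) = (\<lambda>x. x - k (Suc l) x)" by (simp add: smooth_def fun_eq_iff)
    note smoothing_property[OF k_sym k_bound, of m l x, folded this]
    then show ?thesis using rate_bounds by (intro add_right_mono mult_left_mono)
  qed
  finally show ?case .
qed

text \<open>On the range of \<open>p l\<close> the complementary term of \<open>err_le\<close>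
  vanishes, at \<open>x\<close> as well as at \<open>err l x\<close>, because \<open>err l\<close>
  commutes with \<open>p l\<close>.\<close>

lemma err_contraction:
  assumes "p l x = x"
  shows "norm (err l x) \<le> rate * norm x"
proof (rule sym_op_norm_bound[OF err_sym err_nonneg])
  show "inner (err l x) x \<le> rate * (norm x)\<^sup>2"
    using err_le[of l x] assms by simp
  have "p l (err l x) = err l x" using err_p[of l x] assms by simp
  then show "inner (err l (err l x)) (err l x) \<le> rate * (norm (err l x))\<^sup>2"
    using err_le[of l "err l x"] by simp
qed (rule rate_bounds)

end

section \<open>Galerkin hierarchies\<close>

definition comb :: "nat \<Rightarrow> (nat \<Rightarrow> 'h::real_inner) \<Rightarrow> real Matrix.vec \<Rightarrow> 'h" where
  "comb n b x = (\<Sum>j<n. (x $ j) *\<^sub>R b j)"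

text \<open>The adjoint of \<open>comb n b\<close>, see \<open>inner_comb\<close>. These are not
  coordinates with respect to \<open>b\<close>; for vectors in the span they are the Gram matrix
  applied to the coordinates, see \<open>coef_comb\<close>.\<close>

definition coef :: "nat \<Rightarrow> (nat \<Rightarrow> 'h::real_inner) \<Rightarrow> 'h \<Rightarrow> real Matrix.vec" where
  "coef n b y = Matrix.vec n (\<lambda>j. inner (b j) y)"

definition gram :: "nat \<Rightarrow> (nat \<Rightarrow> 'h::real_inner) \<Rightarrow> real mat" where
  "gram n b = Matrix.mat n n (\<lambda>(j, k). inner (b j) (b k))"

definition sandwich :: "nat \<Rightarrow> (nat \<Rightarrow> 'h::real_inner) \<Rightarrow> real mat \<Rightarrow> 'h \<Rightarrow> 'h" where
  "sandwich n b B y = comb n b (B *\<^sub>v coef n b y)"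

lemma coef_carrier [simp]: "coef n b y \<in> carrier_vec n"
  by (simp add: coef_def)

lemma gram_carrier [simp]: "gram n b \<in> carrier_mat n n"
  by (simp add: gram_def)

lemma gram_sym: "(gram n b)\<^sup>T = gram n b"
  by (rule eq_matI) (auto simp: gram_def inner_commute)

lemma comb_add:
  "x \<in> carrier_vec n \<Longrightarrow> y \<in> carrier_vec n \<Longrightarrow> comb n b (x + y) = comb n b x + comb n b y"
  by (simp add: comb_def scaleR_left_distrib sum.distrib)

lemma comb_diff:
  "x \<in> carrier_vec n \<Longrightarrow> y \<in> carrier_vec n \<Longrightarrow> comb n b (x - y) = comb n b x - comb n b y"
  by (simp add: comb_def scaleR_left_diff_distrib sum_subtractf)

lemma comb_smult: "x \<in> carrier_vec n \<Longrightarrow> comb n b (c \<cdot>\<^sub>v x) = c *\<^sub>R comb n b x"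
  by (simp add: comb_def scaleR_sum_right)

lemma comb_0 [simp]: "comb n b (0\<^sub>v n) = 0"
  by (simp add: comb_def)

lemma coef_add: "coef n b (x + y) = coef n b x + coef n b y"
  by (rule eq_vecI) (auto simp: coef_def inner_add_right)

lemma coef_diff: "coef n b (x - y) = coef n b x - coef n b y"
  by (rule eq_vecI) (auto simp: coef_def inner_diff_right)

lemma coef_scaleR: "coef n b (c *\<^sub>R x) = c \<cdot>\<^sub>v coef n b x"
  by (rule eq_vecI) (auto simp: coef_def)

lemma inner_comb: "x \<in> carrier_vec n \<Longrightarrow> inner (comb n b x) y = scalar_prod x (coef n b y)"
  by (simp add: comb_def coef_def scalar_prod_def inner_sum_left lessThan_atLeast0)

lemma coef_comb: "x \<in> carrier_vec n \<Longrightarrow> coef n b (comb n b x) = gram n b *\<^sub>v x"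
  by (rule eq_vecI) (auto simp: coef_def comb_def gram_def scalar_prod_def inner_sum_right
      lessThan_atLeast0 ac_simps)

lemma inner_comb_comb:
  assumes "x \<in> carrier_vec n" "y \<in> carrier_vec n"
  shows "inner (comb n b x) (comb n b y) = scalar_prod x (gram n b *\<^sub>v y)"
  using assms by (simp add: inner_comb coef_comb)

lemma sandwich_sym:
  assumes B: "B \<in> carrier_mat n n" "B\<^sup>T = B"
  shows "sym_op (sandwich n b B)"
  unfolding sym_op_def
proof (intro conjI allI)
  have m: "B *\<^sub>v v \<in> carrier_vec n" if "v \<in> carrier_vec n" for v using B that by simp
  show "linear (sandwich n b B)"
    by (rule linearI)
      (simp_all add: sandwich_def coef_add coef_scaleR mult_add_distrib_mat_vec[OF B(1)]
        mult_mat_vec[OF B(1)] comb_add comb_smult m)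
  fix x y
  have "inner (sandwich n b B x) y = scalar_prod (B *\<^sub>v coef n b x) (coef n b y)"
    by (simp add: sandwich_def inner_comb m)
  also have "\<dots> = scalar_prod (coef n b x) (B *\<^sub>v coef n b y)"
    by (rule scalar_prod_sym_mat[OF B]) simp_all
  also have "\<dots> = scalar_prod (B *\<^sub>v coef n b y) (coef n b x)"
    by (rule comm_scalar_prod[of _ n]) (simp_all add: m)
  also have "\<dots> = inner x (sandwich n b B y)"
    by (simp add: sandwich_def inner_comb m inner_commute[of x])
  finally show "inner (sandwich n b B x) y = inner x (sandwich n b B y)" .
qed

lemma vec_eq_scalar_prodI:
  assumes u: "u \<in> carrier_vec n" and v: "v \<in> carrier_vec n"
    and eq: "\<And>x. x \<in> carrier_vec n \<Longrightarrow> scalar_prod x u = scalar_prod x (v :: real Matrix.vec)"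
  shows "u = v"
proof (rule eq_vecI)
  fix i assume "i < dim_vec v"
  then have i: "i < n" using v by simp
  show "u $ i = v $ i"
    using eq[OF unit_vec_carrier] scalar_prod_left_unit[OF u i] scalar_prod_left_unit[OF v i] by simp
qed (use u v in simp)

text \<open>The operators \<open>T\<close> and \<open>R\<close> have disappeared:
  \<open>b l j\<close> stands for \<open>R (\<phi> l j)\<close>, which makes the stiffness matrix a
  plain Gram matrix. \<open>comb_Pr\<close> is the form in which prolongation becomes
  inclusion.\<close>

locale galerkin_hierarchy =
  fixes n :: "nat \<Rightarrow> nat" and b :: "nat \<Rightarrow> nat \<Rightarrow> 'h::real_inner"
    and A S Pr :: "nat \<Rightarrow> real mat" and C :: real and m :: nat
  assumes A_gram: "\<And>l. A l = gram (n l) (b l)"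
    and comb_inj: "\<And>l x. x \<in> carrier_vec (n l) \<Longrightarrow> comb (n l) (b l) x = 0 \<Longrightarrow> x = 0\<^sub>v (n l)"
    and Pr_carrier: "\<And>l. Pr (Suc l) \<in> carrier_mat (n (Suc l)) (n l)"
    and comb_Pr: "\<And>l x. x \<in> carrier_vec (n l) \<Longrightarrow>
      comb (n (Suc l)) (b (Suc l)) (Pr (Suc l) *\<^sub>v x) = comb (n l) (b l) x"
    and S_carrier: "\<And>l. S (Suc l) \<in> carrier_mat (n (Suc l)) (n (Suc l))"
    and S_sym: "\<And>l. (S (Suc l))\<^sup>T = S (Suc l)"
    and A_le_S: "\<And>l. loewner_le (A (Suc l)) (S (Suc l))"
    and C_gt_0: "0 < C" and m_gt_0: "0 < m"
    and approx_norm: "\<And>l. mat_norm2 (mat_sqrt (S (Suc l)) *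
      (mat_inv (A (Suc l)) - Pr (Suc l) * mat_inv (A l) * (Pr (Suc l))\<^sup>T) * mat_sqrt (S (Suc l))) \<le> C"
begin

section \<open>Transport of the matrices to the energy space\<close>

abbreviation "J l \<equiv> comb (n l) (b l)"
abbreviation "Jt l \<equiv> coef (n l) (b l)"
abbreviation "Ai l \<equiv> mat_inv (A l)"
abbreviation "Mi l \<equiv> mat_inv (S l)"

lemma A_carrier [simp]: "A l \<in> carrier_mat (n l) (n l)"
  and A_sym: "(A l)\<^sup>T = A l"
  by (simp_all add: A_gram gram_sym)

lemma inner_J_J:
  "x \<in> carrier_vec (n l) \<Longrightarrow> y \<in> carrier_vec (n l) \<Longrightarrow> inner (J l x) (J l y) = scalar_prod x (A l *\<^sub>v y)"
  by (simp add: A_gram inner_comb_comb)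

lemma norm_J_sq: "x \<in> carrier_vec (n l) \<Longrightarrow> (norm (J l x))\<^sup>2 = scalar_prod x (A l *\<^sub>v x)"
  by (simp add: power2_norm_eq_inner inner_J_J)

lemma A_psd: "pos_semidef_mat (A l)"
  unfolding pos_semidef_mat_def
proof (intro conjI ballI)
  show "square_mat (A l)" by (simp add: A_gram gram_def)
  fix v :: "real Matrix.vec" assume "v \<in> carrier_vec (dim_row (A l))"
  then have v: "v \<in> carrier_vec (n l)" by (simp add: A_gram gram_def)
  show "0 \<le> scalar_prod v (A l *\<^sub>v v)" by (simp flip: norm_J_sq[OF v])
qed (rule A_sym)

lemma A_kernel:
  assumes "x \<in> carrier_vec (n l)" "A l *\<^sub>v x = 0\<^sub>v (n l)"
  shows "x = 0\<^sub>v (n l)"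
  using norm_J_sq[OF assms(1)] assms by (intro comb_inj) auto

lemma Ai_carrier [simp]: "Ai l \<in> carrier_mat (n l) (n l)"
  and A_Ai: "A l * Ai l = 1\<^sub>m (n l)" and Ai_A: "Ai l * A l = 1\<^sub>m (n l)"
  using mat_inv_props[OF A_carrier A_kernel] by blast+

lemma Ai_sym: "(Ai l)\<^sup>T = Ai l"
  by (rule mat_inv_sym[OF A_carrier A_sym Ai_carrier A_Ai])

lemma A_Ai_vec: "x \<in> carrier_vec (n l) \<Longrightarrow> A l *\<^sub>v (Ai l *\<^sub>v x) = x"
  by (simp add: A_Ai flip: assoc_mult_mat_vec[OF A_carrier Ai_carrier])

lemma Ai_A_vec: "x \<in> carrier_vec (n l) \<Longrightarrow> Ai l *\<^sub>v (A l *\<^sub>v x) = x"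
  by (simp add: Ai_A flip: assoc_mult_mat_vec[OF Ai_carrier A_carrier])

lemma Ai_psd: "pos_semidef_mat (Ai l)"
  unfolding pos_semidef_mat_def
proof (intro conjI ballI)
  show "square_mat (Ai l)" using carrier_matD[OF Ai_carrier[of l]] by simp
  fix v :: "real Matrix.vec" assume "v \<in> carrier_vec (dim_row (Ai l))"
  then have v: "v \<in> carrier_vec (n l)" using Ai_carrier[of l] by auto
  then have w: "Ai l *\<^sub>v v \<in> carrier_vec (n l)" by (rule mult_mat_vec_carrier[OF Ai_carrier])
  have "0 \<le> scalar_prod (Ai l *\<^sub>v v) (A l *\<^sub>v (Ai l *\<^sub>v v))" by (simp flip: norm_J_sq[OF w])
  also have "\<dots> = scalar_prod v (Ai l *\<^sub>v v)"
    using comm_scalar_prod[OF w v] by (simp add: A_Ai_vec[OF v])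
  finally show "0 \<le> scalar_prod v (Ai l *\<^sub>v v)" .
qed (rule Ai_sym)

lemma norm_J_le_S:
  assumes x: "x \<in> carrier_vec (n (Suc l))"
  shows "(norm (J (Suc l) x))\<^sup>2 \<le> scalar_prod x (S (Suc l) *\<^sub>v x)"
proof -
  have "pos_semidef_mat (S (Suc l) - A (Suc l))" using A_le_S[of l] by (simp add: loewner_le_def)
  then have "0 \<le> scalar_prod x ((S (Suc l) - A (Suc l)) *\<^sub>v x)"
    using x A_carrier[of "Suc l"] unfolding pos_semidef_mat_def by auto
  also have "\<dots> = scalar_prod x (S (Suc l) *\<^sub>v x) - scalar_prod x (A (Suc l) *\<^sub>v x)"
    using x S_carrier[of l]
    by (simp add: minus_mult_distrib_mat_vec[OF _ A_carrier]
        scalar_prod_minus_distrib[OF x _ mult_mat_vec_carrier[OF A_carrier x]])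
  finally show ?thesis by (simp add: norm_J_sq[OF x])
qed

lemma S_psd: "pos_semidef_mat (S (Suc l))"
  unfolding pos_semidef_mat_def
proof (intro conjI ballI)
  show "square_mat (S (Suc l))" using carrier_matD[OF S_carrier[of l]] by simp
  fix v :: "real Matrix.vec" assume "v \<in> carrier_vec (dim_row (S (Suc l)))"
  then have v: "v \<in> carrier_vec (n (Suc l))" using S_carrier[of l] by auto
  show "0 \<le> scalar_prod v (S (Suc l) *\<^sub>v v)"
    using norm_J_le_S[OF v] zero_le_power2 by (rule order_trans[rotated])
qed (rule S_sym)

lemma S_kernel:
  assumes "x \<in> carrier_vec (n (Suc l))" "S (Suc l) *\<^sub>v x = 0\<^sub>v (n (Suc l))"
  shows "x = 0\<^sub>v (n (Suc l))"
  using norm_J_le_S[OF assms(1)] assms by (intro comb_inj) auto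

lemma Mi_carrier [simp]: "Mi (Suc l) \<in> carrier_mat (n (Suc l)) (n (Suc l))"
  and S_Mi: "S (Suc l) * Mi (Suc l) = 1\<^sub>m (n (Suc l))" and Mi_S: "Mi (Suc l) * S (Suc l) = 1\<^sub>m (n (Suc l))"
  using mat_inv_props[OF S_carrier S_kernel] by blast+

lemma Mi_sym: "(Mi (Suc l))\<^sup>T = Mi (Suc l)"
  by (rule mat_inv_sym[OF S_carrier S_sym Mi_carrier S_Mi])

lemma S_Mi_vec: "x \<in> carrier_vec (n (Suc l)) \<Longrightarrow> S (Suc l) *\<^sub>v (Mi (Suc l) *\<^sub>v x) = x"
  by (simp add: S_Mi flip: assoc_mult_mat_vec[OF S_carrier Mi_carrier])

lemma Ai_vec_carrier [simp]: "x \<in> carrier_vec (n l) \<Longrightarrow> Ai l *\<^sub>v x \<in> carrier_vec (n l)"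
  by (rule mult_mat_vec_carrier[OF Ai_carrier])

lemma A_vec_carrier [simp]: "x \<in> carrier_vec (n l) \<Longrightarrow> A l *\<^sub>v x \<in> carrier_vec (n l)"
  by (rule mult_mat_vec_carrier[OF A_carrier])

lemma Mi_vec_carrier [simp]:
  "x \<in> carrier_vec (n (Suc l)) \<Longrightarrow> Mi (Suc l) *\<^sub>v x \<in> carrier_vec (n (Suc l))"
  by (rule mult_mat_vec_carrier[OF Mi_carrier])

lemma Pr_vec_carrier [simp]: "x \<in> carrier_vec (n l) \<Longrightarrow> Pr (Suc l) *\<^sub>v x \<in> carrier_vec (n (Suc l))"
  by (rule mult_mat_vec_carrier[OF Pr_carrier])

lemma PrT_vec_carrier [simp]:
  "x \<in> carrier_vec (n (Suc l)) \<Longrightarrow> (Pr (Suc l))\<^sup>T *\<^sub>v x \<in> carrier_vec (n l)"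
  using Pr_carrier[of l] by simp

definition proj :: "nat \<Rightarrow> 'h \<Rightarrow> 'h" where
  "proj l = sandwich (n l) (b l) (Ai l)"

definition sinv :: "nat \<Rightarrow> 'h \<Rightarrow> 'h" where
  "sinv l = sandwich (n l) (b l) (Mi l)"

lemma Jt_J: "x \<in> carrier_vec (n l) \<Longrightarrow> Jt l (J l x) = A l *\<^sub>v x"
  by (simp add: A_gram coef_comb)

lemma proj_J: "x \<in> carrier_vec (n l) \<Longrightarrow> proj l (J l x) = J l x"
  by (simp add: proj_def sandwich_def Jt_J Ai_A_vec)

lemma proj_range: "\<exists>x \<in> carrier_vec (n l). proj l y = J l x"
  by (intro bexI[of _ "Ai l *\<^sub>v Jt l y"]) (simp_all add: proj_def sandwich_def)

lemma Jt_proj: "Jt l (proj l y) = Jt l y"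
  by (simp add: proj_def sandwich_def Jt_J A_Ai_vec)

text \<open>The adjoint of \<open>comb_Pr\<close>, tested against an arbitrary coarse vector. It
  identifies the restricted residual with the coarse load of the same element of the energy
  space.\<close>

lemma PrT_Jt: "(Pr (Suc l))\<^sup>T *\<^sub>v Jt (Suc l) y = Jt l y"
proof (rule vec_eq_scalar_prodI)
  fix x :: "real Matrix.vec" assume x: "x \<in> carrier_vec (n l)"
  have "scalar_prod x ((Pr (Suc l))\<^sup>T *\<^sub>v Jt (Suc l) y) = scalar_prod ((Pr (Suc l))\<^sup>T *\<^sub>v Jt (Suc l) y) x"
    by (rule comm_scalar_prod[OF x]) simp
  also have "\<dots> = scalar_prod (Jt (Suc l) y) (Pr (Suc l) *\<^sub>v x)"
    by (rule transpose_vec_mult_scalar[OF Pr_carrier x]) simp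
  also have "\<dots> = scalar_prod (Pr (Suc l) *\<^sub>v x) (Jt (Suc l) y)"
    by (rule comm_scalar_prod[of _ "n (Suc l)"]) (simp_all add: x)
  also have "\<dots> = inner (J (Suc l) (Pr (Suc l) *\<^sub>v x)) y"
    by (simp add: inner_comb x)
  also have "\<dots> = scalar_prod x (Jt l y)" by (simp add: comb_Pr x inner_comb)
  finally show "scalar_prod x ((Pr (Suc l))\<^sup>T *\<^sub>v Jt (Suc l) y) = scalar_prod x (Jt l y)" .
qed simp_all

lemma proj_sym: "sym_op (proj l)"
  unfolding proj_def by (rule sandwich_sym[OF Ai_carrier Ai_sym])

lemma proj_Suc_proj: "proj (Suc l) (proj l y) = proj l y"
proof -
  obtain x where x: "x \<in> carrier_vec (n l)" "proj l y = J l x" using proj_range by blast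
  then show ?thesis
    using proj_J[OF Pr_vec_carrier[OF x(1)]] by (simp add: comb_Pr)
qed

text \<open>Put \<open>y = Jt x\<close> and \<open>w = S^(1/2) S^(-1) y\<close>, so that
  \<open>S^(1/2) w = y\<close> and \<open>|w|^2 = <sinv x, x>\<close>. Then the form of the unscaled
  matrix difference at \<open>y\<close> is the form of the scaled one at \<open>w\<close>, to which
  the spectral norm bound applies.\<close>

lemma proj_approx:
  "inner (proj (Suc l) x) x - inner (proj l x) x \<le> C * inner (sinv (Suc l) x) x"
proof -
  let ?N = "n (Suc l)" and ?R = "mat_sqrt (S (Suc l))" and ?y = "Jt (Suc l) x"
  let ?D = "Ai (Suc l) - Pr (Suc l) * Ai l * (Pr (Suc l))\<^sup>T"
  have y: "?y \<in> carrier_vec ?N" by simp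
  note R = mat_sqrt_props[OF S_carrier S_psd, of l]
  have PAP: "Pr (Suc l) * Ai l * (Pr (Suc l))\<^sup>T \<in> carrier_mat ?N ?N"
    using Pr_carrier[of l] Ai_carrier[of l] by (metis mult_carrier_mat transpose_carrier_mat)
  then have D: "?D \<in> carrier_mat ?N ?N" by (rule minus_carrier_mat)
  let ?z = "Mi (Suc l) *\<^sub>v ?y"
  let ?w = "?R *\<^sub>v ?z"
  have z: "?z \<in> carrier_vec ?N" by simp
  have w: "?w \<in> carrier_vec ?N" by (rule mult_mat_vec_carrier[OF R(1) z])
  have Rw: "?R *\<^sub>v ?w = ?y"
    using assoc_mult_mat_vec[OF R(1) R(1) z] by (simp add: R(3) S_Mi_vec)
  have ww: "scalar_prod ?w ?w = inner (sinv (Suc l) x) x"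
  proof -
    have "scalar_prod ?w ?w = scalar_prod ?z ?y"
      using scalar_prod_sym_mat[OF R(1,2) z w] by (simp add: Rw)
    then show ?thesis by (simp add: sinv_def sandwich_def inner_comb)
  qed
  have RDR: "?R * ?D * ?R \<in> carrier_mat ?N ?N"
    using R(1) D by (metis mult_carrier_mat)
  have "scalar_prod ?w (?R * ?D * ?R *\<^sub>v ?w) \<le> mat_norm2 (?R * ?D * ?R) * scalar_prod ?w ?w"
    by (rule scalar_prod_le_mat_norm2[OF RDR w])
  also have "\<dots> \<le> C * scalar_prod ?w ?w"
    by (rule mult_right_mono[OF approx_norm scalar_prod_self_nonneg])
  also have "scalar_prod ?w (?R * ?D * ?R *\<^sub>v ?w) = scalar_prod ?y (?D *\<^sub>v ?y)"
  proof -
    have "?R * ?D * ?R *\<^sub>v ?w = ?R *\<^sub>v (?D *\<^sub>v ?y)"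
      using assoc_mult_mat_vec[OF mult_carrier_mat[OF R(1) D] R(1) w] assoc_mult_mat_vec[OF R(1) D y]
      by (simp add: Rw)
    then show ?thesis
      using scalar_prod_sym_mat[OF R(1,2) w mult_mat_vec_carrier[OF D y]] by (simp add: Rw)
  qed
  also have "\<dots> = inner (proj (Suc l) x) x - inner (proj l x) x"
  proof -
    have PAPy: "Pr (Suc l) * Ai l * (Pr (Suc l))\<^sup>T *\<^sub>v ?y = Pr (Suc l) *\<^sub>v (Ai l *\<^sub>v Jt l x)"
    proof -
      have PT: "(Pr (Suc l))\<^sup>T \<in> carrier_mat (n l) ?N" using Pr_carrier[of l] by simp
      show ?thesis
        unfolding assoc_mult_mat_vec[OF mult_carrier_mat[OF Pr_carrier Ai_carrier] PT y] PrT_Jt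
        by (rule assoc_mult_mat_vec[OF Pr_carrier Ai_carrier coef_carrier])
    qed
    have "scalar_prod ?y (?D *\<^sub>v ?y) = scalar_prod ?y (Ai (Suc l) *\<^sub>v ?y) - scalar_prod ?y (Pr (Suc l) *\<^sub>v (Ai l *\<^sub>v Jt l x))"
      unfolding minus_mult_distrib_mat_vec[OF Ai_carrier PAP y] PAPy
      by (rule scalar_prod_minus_distrib[OF y]) simp_all
    also have "scalar_prod ?y (Ai (Suc l) *\<^sub>v ?y) = inner (proj (Suc l) x) x"
      using comm_scalar_prod[OF y Ai_vec_carrier[OF y]] by (simp add: proj_def sandwich_def inner_comb)
    also have "scalar_prod ?y (Pr (Suc l) *\<^sub>v (Ai l *\<^sub>v Jt l x)) = inner (proj l x) x"
    proof -
      have "scalar_prod ?y (Pr (Suc l) *\<^sub>v (Ai l *\<^sub>v Jt l x)) = inner (J (Suc l) (Pr (Suc l) *\<^sub>v (Ai l *\<^sub>v Jt l x))) x"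
        using comm_scalar_prod[OF y Pr_vec_carrier[OF Ai_vec_carrier[of "Jt l x"]]]
        by (simp add: inner_comb)
      then show ?thesis by (simp add: comb_Pr proj_def sandwich_def)
    qed
    finally show ?thesis .
  qed
  finally show ?thesis by (simp add: ww)
qed

sublocale multilevel proj sinv C m
proof
  show "0 < C" "0 < m" by (rule C_gt_0 m_gt_0)+
  show "sym_op (proj l)" for l by (rule proj_sym)
  show "proj l (proj l x) = proj l x" for l x
    using proj_range[of l x] proj_J by auto
  show "proj l (proj (Suc l) x) = proj l x" for l x
  proof -
    have "inner (proj l (proj (Suc l) x)) y = inner (proj l x) y" for y
      by (simp only: sym_op_inner[OF proj_sym] proj_Suc_proj)
    then show ?thesis by (metis inner_commute vector_eq_rdot)
  qed
  show "sym_op (sinv (Suc l))" for l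
    unfolding sinv_def by (rule sandwich_sym[OF Mi_carrier Mi_sym])
  show "(norm (sinv (Suc l) x))\<^sup>2 \<le> inner (sinv (Suc l) x) x" for l x
  proof -
    let ?z = "Mi (Suc l) *\<^sub>v Jt (Suc l) x"
    have "(norm (J (Suc l) ?z))\<^sup>2 \<le> scalar_prod ?z (S (Suc l) *\<^sub>v ?z)"
      by (rule norm_J_le_S) simp
    then show ?thesis by (simp add: sinv_def sandwich_def inner_comb S_Mi_vec)
  qed
  show "sinv (Suc l) (proj (Suc l) x) = sinv (Suc l) x" for l x
    by (simp add: sinv_def sandwich_def Jt_proj)
qed (rule proj_approx)

section \<open>The V-cycle acting on errors\<close>

definition smooth_step :: "nat \<Rightarrow> real Matrix.vec \<Rightarrow> 'h \<Rightarrow> 'h" where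
  "smooth_step l \<xi> v = smooth l v + J l (Mi l *\<^sub>v \<xi>)"

text \<open>The V-cycle in terms of the deviation from the target mean. The right-hand side drops
  out, and the coarse cycle acts on the whole fine error instead of on its projection with zero
  start; \<open>mgmc_error\<close> shows that this is the same process.\<close>

primrec cycle :: "(nat \<Rightarrow> nat \<Rightarrow> real Matrix.vec) \<Rightarrow> nat \<Rightarrow> 'h \<Rightarrow> 'h" where
  "cycle w 0 v = v - proj 0 v + J 0 (w 0 0)"
| "cycle w (Suc l) v = fold (\<lambda>k. smooth_step (Suc l) (w (Suc l) k)) [m..<m + m]
     (cycle w l (fold (\<lambda>k. smooth_step (Suc l) (w (Suc l) k)) [0..<m] v))"

lemma fold_smooth_step_affine:
  "fold (\<lambda>k. smooth_step (Suc l) (w k)) ks v =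
     (smooth (Suc l) ^^ length ks) v + fold (\<lambda>k. smooth_step (Suc l) (w k)) ks 0"
proof (induction ks rule: rev_induct)
  case (snoc k ks)
  show ?case
    by (subst fold_append, subst fold_append, simp, subst snoc)
      (simp add: smooth_step_def linear_add[OF sym_op_linear[OF smooth_sym]])
qed simp

text \<open>Separates the deterministic propagation \<open>err l\<close> from the injected noise,
  which is the cycle started at error 0.\<close>

lemma cycle_affine: "cycle w l v = err l v + cycle w l 0"
proof (induction l arbitrary: v)
  case 0
  then show ?case by (simp add: linear_0[OF sym_op_linear[OF proj_sym]])
next
  case (Suc l)
  note lin = linear_add[OF sym_op_linear[OF smooth_pow_sym]]
  let ?F = "fold (\<lambda>k. smooth_step (Suc l) (w (Suc l) k))"
  let ?s = "smooth (Suc l) ^^ m"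
  have "cycle w (Suc l) v = ?F [m..<m + m] (err l (?s v + ?F [0..<m] 0) + cycle w l 0)"
    unfolding cycle.simps Suc.IH[of "?F [0..<m] v"]
    by (subst fold_smooth_step_affine[of _ _ "[0..<m]" v]) simp
  also have "\<dots> = ?s (err l (?s v)) + ?s (err l (?F [0..<m] 0) + cycle w l 0) + ?F [m..<m + m] 0"
    by (subst fold_smooth_step_affine) (simp add: lin err_add)
  also have "?s (err l (?F [0..<m] 0) + cycle w l 0) + ?F [m..<m + m] 0 = cycle w (Suc l) 0"
    unfolding cycle.simps Suc.IH[of "?F [0..<m] 0"]
    by (subst (2) fold_smooth_step_affine) simp
  ultimately show ?case by (simp add: add.assoc)
qed

definition exact :: "nat \<Rightarrow> real Matrix.vec \<Rightarrow> 'h" where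
  "exact l f = J l (Ai l *\<^sub>v f)"

lemma Jt_exact: "f \<in> carrier_vec (n l) \<Longrightarrow> Jt l (exact l f) = f"
  by (simp add: exact_def Jt_J A_Ai_vec)

lemma random_smoother_carrier:
  assumes "f \<in> carrier_vec (n (Suc l))" "\<xi> \<in> carrier_vec (n (Suc l))" "\<theta> \<in> carrier_vec (n (Suc l))"
  shows "random_smoother (A (Suc l)) (S (Suc l)) f \<xi> \<theta> \<in> carrier_vec (n (Suc l))"
  unfolding random_smoother_def using assms
  by (intro add_carrier_vec Mi_vec_carrier minus_carrier_vec A_vec_carrier)

text \<open>The residual \<open>f - A \<theta>\<close> is \<open>Jt\<close> of the negative error,
  so the correction \<open>M^(-1)\<close> times the residual subtracts \<open>sinv\<close> of the
  error.\<close>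

lemma random_smoother_error:
  assumes f: "f \<in> carrier_vec (n (Suc l))" and \<xi>: "\<xi> \<in> carrier_vec (n (Suc l))"
    and \<theta>: "\<theta> \<in> carrier_vec (n (Suc l))"
  shows "J (Suc l) (random_smoother (A (Suc l)) (S (Suc l)) f \<xi> \<theta>) - exact (Suc l) f =
    smooth_step (Suc l) \<xi> (J (Suc l) \<theta> - exact (Suc l) f)"
proof -
  let ?u = "exact (Suc l) f"
  have r: "f - A (Suc l) *\<^sub>v \<theta> \<in> carrier_vec (n (Suc l))" using f \<theta> by (intro minus_carrier_vec) simp_all
  have "f + \<xi> - A (Suc l) *\<^sub>v \<theta> = (f - A (Suc l) *\<^sub>v \<theta>) + \<xi>"
    using f \<xi> carrier_vecD[OF A_vec_carrier[OF \<theta>]] by (intro eq_vecI) (auto simp del: dim_mult_mat_vec)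
  then have "Mi (Suc l) *\<^sub>v (f + \<xi> - A (Suc l) *\<^sub>v \<theta>) =
      Mi (Suc l) *\<^sub>v (f - A (Suc l) *\<^sub>v \<theta>) + Mi (Suc l) *\<^sub>v \<xi>"
    by (simp add: mult_add_distrib_mat_vec[OF Mi_carrier r \<xi>])
  then have "J (Suc l) (random_smoother (A (Suc l)) (S (Suc l)) f \<xi> \<theta>) =
      J (Suc l) \<theta> + (J (Suc l) (Mi (Suc l) *\<^sub>v (f - A (Suc l) *\<^sub>v \<theta>)) + J (Suc l) (Mi (Suc l) *\<^sub>v \<xi>))"
    unfolding random_smoother_def using r \<xi> \<theta> by (simp add: comb_add)
  moreover have "sinv (Suc l) (J (Suc l) \<theta> - ?u) = - J (Suc l) (Mi (Suc l) *\<^sub>v (f - A (Suc l) *\<^sub>v \<theta>))"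
  proof -
    have "sinv (Suc l) (?u - J (Suc l) \<theta>) = J (Suc l) (Mi (Suc l) *\<^sub>v (f - A (Suc l) *\<^sub>v \<theta>))"
      unfolding sinv_def sandwich_def by (simp add: coef_diff Jt_exact[OF f] Jt_J[OF \<theta>])
    then show ?thesis
      using linear_neg[OF sym_op_linear[OF k_sym], of l "?u - J (Suc l) \<theta>"] by simp
  qed
  ultimately show ?thesis by (simp add: smooth_step_def smooth_def)
qed

lemma fold_random_smoother_error:
  assumes f: "f \<in> carrier_vec (n (Suc l))" and w: "\<And>k. k \<in> set ks \<Longrightarrow> w k \<in> carrier_vec (n (Suc l))"
    and \<theta>: "\<theta> \<in> carrier_vec (n (Suc l))"
  shows "fold (\<lambda>k. random_smoother (A (Suc l)) (S (Suc l)) f (w k)) ks \<theta> \<in> carrier_vec (n (Suc l))"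
    and "J (Suc l) (fold (\<lambda>k. random_smoother (A (Suc l)) (S (Suc l)) f (w k)) ks \<theta>) - exact (Suc l) f =
      fold (\<lambda>k. smooth_step (Suc l) (w k)) ks (J (Suc l) \<theta> - exact (Suc l) f)"
  using w
  by (induction ks rule: rev_induct)
    (simp_all add: \<theta> random_smoother_carrier[OF f] random_smoother_error[OF f])

text \<open>If \<open>v\<close> is the fine error after pre-smoothing, the coarse target is
  \<open>- p v\<close>, so the zero start has coarse error \<open>p v\<close>. The coarse sample is
  then \<open>- p v + e (p v)\<close> plus noise, and adding it to \<open>v\<close> gives
  \<open>e v\<close> plus noise because \<open>e v - e (p v) = v - p v\<close>.\<close>

lemma mgmc_error:
  assumes "f \<in> carrier_vec (n l)" "\<theta> \<in> carrier_vec (n l)" "w 0 0 \<in> carrier_vec (n 0)"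
    and "\<And>l' k. 1 \<le> l' \<Longrightarrow> l' \<le> l \<Longrightarrow> k < m + m \<Longrightarrow> w l' k \<in> carrier_vec (n l')"
  shows "mgmc n A S Pr m m w l f \<theta> \<in> carrier_vec (n l) \<and>
    J l (mgmc n A S Pr m m w l f \<theta>) - exact l f = cycle w l (J l \<theta> - exact l f)"
  using assms
proof (induction l arbitrary: f \<theta>)
  case 0
  have "proj 0 (J 0 \<theta> - exact 0 f) = J 0 \<theta> - exact 0 f"
    using 0 by (simp add: exact_def proj_J flip: comb_diff)
  then show ?case using 0 by (simp add: exact_def comb_add)
next
  case (Suc l)
  note w = Suc.prems(4)[of "Suc l"]
  let ?sm = "fold (\<lambda>k. random_smoother (A (Suc l)) (S (Suc l)) f (w (Suc l) k))"
  let ?F = "fold (\<lambda>k. smooth_step (Suc l) (w (Suc l) k))"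
  define \<theta>' where "\<theta>' = ?sm [0..<m] \<theta>"
  define f' where "f' = (Pr (Suc l))\<^sup>T *\<^sub>v (f - A (Suc l) *\<^sub>v \<theta>')"
  define \<psi> where "\<psi> = mgmc n A S Pr m m w l f' (0\<^sub>v (n l))"
  define \<theta>'' where "\<theta>'' = \<theta>' + Pr (Suc l) *\<^sub>v \<psi>"
  let ?u = "exact (Suc l) f"
  have \<theta>': "\<theta>' \<in> carrier_vec (n (Suc l))"
    unfolding \<theta>'_def by (rule fold_random_smoother_error(1)) (use Suc.prems w in auto)
  have e': "J (Suc l) \<theta>' - ?u = ?F [0..<m] (J (Suc l) \<theta> - ?u)"
    unfolding \<theta>'_def by (rule fold_random_smoother_error(2)) (use Suc.prems w in auto)
  have r: "f - A (Suc l) *\<^sub>v \<theta>' \<in> carrier_vec (n (Suc l))"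
    using Suc.prems \<theta>' by (intro minus_carrier_vec) simp_all
  have f': "f' \<in> carrier_vec (n l)" unfolding f'_def by (rule PrT_vec_carrier[OF r])
  have IH: "\<psi> \<in> carrier_vec (n l)" "J l \<psi> - exact l f' = cycle w l (J l (0\<^sub>v (n l)) - exact l f')"
    unfolding \<psi>_def using Suc.IH[OF f', of "0\<^sub>v (n l)"] Suc.prems(3,4) by simp_all
  have \<theta>'': "\<theta>'' \<in> carrier_vec (n (Suc l))"
    unfolding \<theta>''_def using \<theta>' IH(1) by simp
  \<comment> \<open>The coarse right-hand side is the coarse load of the negative fine error, hence
    the coarse solution is its projection.\<close>
  have fp: "exact l f' = - proj l (J (Suc l) \<theta>' - ?u)"
  proof -
    have "f - A (Suc l) *\<^sub>v \<theta>' = Jt (Suc l) (?u - J (Suc l) \<theta>')"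
      using Suc.prems(1) \<theta>' by (simp add: coef_diff Jt_exact Jt_J)
    then have "exact l f' = proj l (?u - J (Suc l) \<theta>')"
      by (simp add: f'_def PrT_Jt exact_def proj_def sandwich_def)
    then show ?thesis
      using linear_neg[OF sym_op_linear[OF proj_sym], of l "?u - J (Suc l) \<theta>'"] by simp
  qed
  have "J (Suc l) \<theta>'' - ?u = cycle w l (J (Suc l) \<theta>' - ?u)"
  proof -
    let ?v = "J (Suc l) \<theta>' - ?u"
    have "J (Suc l) \<theta>'' - ?u = ?v + J l \<psi>"
      unfolding \<theta>''_def using \<theta>' IH(1) by (simp add: comb_add comb_Pr)
    also have "J l \<psi> = - proj l ?v + (err l (proj l ?v) + cycle w l 0)"
      using IH(2) cycle_affine[of w l "proj l ?v"] by (simp add: fp algebra_simps)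
    also have "?v + \<dots> = err l ?v + cycle w l 0"
      using err_minus_err_p[of l ?v] by (simp add: algebra_simps)
    finally show ?thesis by (simp add: cycle_affine[of w l ?v])
  qed
  moreover have "mgmc n A S Pr m m w (Suc l) f \<theta> = ?sm [m..<m + m] \<theta>''"
    by (simp add: Let_def \<theta>'_def f'_def \<psi>_def \<theta>''_def)
  moreover have "?sm [m..<m + m] \<theta>'' \<in> carrier_vec (n (Suc l))"
    by (rule fold_random_smoother_error(1)) (use Suc.prems w \<theta>'' in auto)
  moreover have "J (Suc l) (?sm [m..<m + m] \<theta>'') - ?u = ?F [m..<m + m] (J (Suc l) \<theta>'' - ?u)"
    by (rule fold_random_smoother_error(2)) (use Suc.prems w \<theta>'' in auto)
  ultimately show ?case by (simp add: e')
qed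

end

section \<open>Second moments of the chain\<close>

text \<open>The rule \<open>cong\<close> is needed because random vectors have the right dimension only on the sample
  space.\<close>

inductive_set lin_span :: "'w measure \<Rightarrow> ('w \<Rightarrow> real) set \<Rightarrow> ('w \<Rightarrow> real) set"
  for M :: "'w measure" and B :: "('w \<Rightarrow> real) set" where
  zero: "(\<lambda>_. 0) \<in> lin_span M B"
| step: "X \<in> lin_span M B \<Longrightarrow> Y \<in> B \<Longrightarrow> (\<lambda>\<omega>. X \<omega> + c * Y \<omega>) \<in> lin_span M B"
| cong: "X \<in> lin_span M B \<Longrightarrow> (\<And>\<omega>. \<omega> \<in> space M \<Longrightarrow> X \<omega> = Y \<omega>) \<Longrightarrow> Y \<in> lin_span M B"

lemma lin_span_base: "Y \<in> B \<Longrightarrow> (\<lambda>\<omega>. c * Y \<omega>) \<in> lin_span M B"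
  using lin_span.step[OF lin_span.zero, where Y = Y and c = c] by simp

lemma lin_span_add:
  assumes "X \<in> lin_span M B" "Y \<in> lin_span M B"
  shows "(\<lambda>\<omega>. X \<omega> + Y \<omega>) \<in> lin_span M B"
  using assms(2)
proof induction
  case zero
  then show ?case using assms(1) by simp
next
  case (step Y Z c)
  then show ?case using lin_span.step[OF step.IH step.hyps(2), of c] by (simp add: add.assoc)
next
  case (cong Y Z)
  show ?case by (rule lin_span.cong[OF cong.IH]) (simp add: cong.hyps)
qed

lemma lin_span_sum:
  assumes "\<And>i. i \<in> I \<Longrightarrow> X i \<in> lin_span M B"
  shows "(\<lambda>\<omega>. \<Sum>i\<in>I. X i \<omega>) \<in> lin_span M B"
  using assms
  by (induction I rule: infinite_finite_induct) (auto intro: lin_span.zero lin_span_add)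

lemma lin_span_mono:
  assumes "B \<subseteq> B'" "X \<in> lin_span M B"
  shows "X \<in> lin_span M B'"
  using assms(2)
proof induction
  case (cong X Y)
  then show ?case using lin_span.cong by blast
qed (use assms(1) in \<open>auto intro: lin_span.zero lin_span.step\<close>)

lemma sq_integrable_cong:
  assumes "sq_integrable M X" "\<And>\<omega>. \<omega> \<in> space M \<Longrightarrow> X \<omega> = Y \<omega>"
  shows "sq_integrable M Y"
  using assms(1) unfolding sq_integrable_def
  by (simp add: assms(2) cong: measurable_cong Bochner_Integration.integrable_cong)

lemma lin_span_sq_integrable:
  assumes "X \<in> lin_span M B" "\<And>Y. Y \<in> B \<Longrightarrow> sq_integrable M Y"
  shows "sq_integrable M X"
  using assms(1)
proof induction
  case zero
  then show ?case by (simp add: sq_integrable_def)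
next
  case (step X Y c)
  then show ?case using assms(2) by (intro sq_integrable_add sq_integrable_cmult)
next
  case (cong X Y)
  then show ?case using sq_integrable_cong by blast
qed

lemma lin_span_orthogonal_left:
  assumes X: "X \<in> lin_span M B" and B: "\<And>Y. Y \<in> B \<Longrightarrow> sq_integrable M Y"
    and Z: "sq_integrable M Z" and orth: "\<And>Y. Y \<in> B \<Longrightarrow> (\<integral>\<omega>. Y \<omega> * Z \<omega> \<partial>M) = 0"
  shows "(\<integral>\<omega>. X \<omega> * Z \<omega> \<partial>M) = 0"
  using X
proof induction
  case (step X Y c)
  have int: "integrable M (\<lambda>\<omega>. X \<omega> * Z \<omega>)" "integrable M (\<lambda>\<omega>. Y \<omega> * Z \<omega>)"
    using step lin_span_sq_integrable B Z by (auto intro!: sq_integrable_mult)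
  have "(\<integral>\<omega>. (X \<omega> + c * Y \<omega>) * Z \<omega> \<partial>M) = (\<integral>\<omega>. X \<omega> * Z \<omega> + c * (Y \<omega> * Z \<omega>) \<partial>M)"
    by (simp add: algebra_simps)
  also have "\<dots> = 0" using int step orth by simp
  finally show ?case .
next
  case (cong X Y)
  have "(\<integral>\<omega>. Y \<omega> * Z \<omega> \<partial>M) = (\<integral>\<omega>. X \<omega> * Z \<omega> \<partial>M)"
    by (intro Bochner_Integration.integral_cong) (simp_all add: cong.hyps(2))
  then show ?case using cong.IH by simp
qed simp

lemma lin_span_orthogonal:
  assumes X: "X \<in> lin_span M B" and Z: "Z \<in> lin_span M B'"
    and B: "\<And>Y. Y \<in> B \<union> B' \<Longrightarrow> sq_integrable M Y"
    and orth: "\<And>Y Y'. Y \<in> B \<Longrightarrow> Y' \<in> B' \<Longrightarrow> (\<integral>\<omega>. Y \<omega> * Y' \<omega> \<partial>M) = 0"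
  shows "(\<integral>\<omega>. X \<omega> * Z \<omega> \<partial>M) = 0"
proof (rule lin_span_orthogonal_left[OF X])
  show Zs: "sq_integrable M Z" by (rule lin_span_sq_integrable[OF Z]) (use B in auto)
  fix Y assume Y: "Y \<in> B"
  then show "sq_integrable M Y" using B by auto
  have "(\<integral>\<omega>. Z \<omega> * Y \<omega> \<partial>M) = 0"
  proof (rule lin_span_orthogonal_left[OF Z])
    fix Y' assume "Y' \<in> B'"
    then show "(\<integral>\<omega>. Y' \<omega> * Y \<omega> \<partial>M) = 0" using orth[OF Y, of Y'] by (simp add: mult.commute)
  qed (use B Y in auto)
  then show "(\<integral>\<omega>. Y \<omega> * Z \<omega> \<partial>M) = 0" by (simp add: mult.commute)
qed

lemma integral_add_sq_orthogonal:
  assumes "sq_integrable M X" "sq_integrable M Y" "(\<integral>\<omega>. X \<omega> * Y \<omega> \<partial>M) = 0"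
  shows "(\<integral>\<omega>. (X \<omega> + Y \<omega>)\<^sup>2 \<partial>M) = (\<integral>\<omega>. (X \<omega>)\<^sup>2 \<partial>M) + (\<integral>\<omega>. (Y \<omega>)\<^sup>2 \<partial>M)"
proof -
  have "(\<integral>\<omega>. (X \<omega> + Y \<omega>)\<^sup>2 \<partial>M) = (\<integral>\<omega>. (X \<omega>)\<^sup>2 + (Y \<omega>)\<^sup>2 + 2 * (X \<omega> * Y \<omega>) \<partial>M)"
    by (simp add: power2_sum algebra_simps)
  then show ?thesis
    using assms sq_integrable_mult[OF assms(1,2)] by (simp add: sq_integrable_def)
qed

section \<open>Averages of sequences with geometrically decaying correlations\<close>

lemma sum_powers_le:
  fixes r :: real
  assumes "0 \<le> r" "r < 1" "finite I" "inj_on e I"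
  shows "(\<Sum>i\<in>I. r ^ e i) \<le> 1 / (1 - r)"
proof -
  have "(\<Sum>i\<in>I. r ^ e i) = (\<Sum>k\<in>e ` I. r ^ k)" using assms(4) by (simp add: sum.reindex)
  also have "\<dots> \<le> (\<Sum>k. r ^ k)"
    using assms by (intro sum_le_suminf summable_geometric) auto
  also have "\<dots> = 1 / (1 - r)" using assms by (intro suminf_geometric) simp
  finally show ?thesis .
qed

text \<open>In a row of the correlation matrix every distance from the diagonal occurs at most
  twice, so each row sums to at most \<open>2 * V / (1 - r)\<close>. There are \<open>N\<close>
  rows, and the prefactor is \<open>1 / N^2\<close>.\<close>

lemma (in prob_space) second_moment_average:
  fixes a :: "nat \<Rightarrow> 'a \<Rightarrow> real"
  assumes sq: "\<And>j. sq_integrable M (a j)"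
    and corr: "\<And>i j. (\<integral>\<omega>. a (i + j) \<omega> * a i \<omega> \<partial>M) \<le> V * r ^ j"
    and V: "0 \<le> V" and r: "0 \<le> r" "r < 1" and N: "1 \<le> N"
  shows "(\<integral>\<omega>. (1 / real N * (\<Sum>j = 1..N. a j \<omega>))\<^sup>2 \<partial>M) \<le> 2 * V / (1 - r) / real N"
proof -
  \<comment> \<open>The distance between \<open>i\<close> and \<open>j\<close>; the case split
    avoids truncated subtraction.\<close>
  let ?d = "\<lambda>i j. if i \<le> j then j - i else i - j"
  have c: "(\<integral>\<omega>. a i \<omega> * a j \<omega> \<partial>M) \<le> V * r ^ ?d i j" for i j
    using corr[of i "j - i"] corr[of j "i - j"] by (auto simp: mult.commute)
  have row: "(\<Sum>j = 1..N. r ^ ?d i j) \<le> 2 / (1 - r)" for i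
  proof -
    have "(\<Sum>j = 1..N. r ^ ?d i j) = (\<Sum>j\<in>{1..N} \<inter> {j. i \<le> j}. r ^ (j - i)) + (\<Sum>j\<in>{1..N} \<inter> - {j. i \<le> j}. r ^ (i - j))"
      by (simp add: if_distrib[of "\<lambda>k. r ^ k"] sum.If_cases cong: if_cong)
    also have "\<dots> \<le> 1 / (1 - r) + 1 / (1 - r)"
      by (intro add_mono sum_powers_le r) (auto simp: inj_on_def)
    finally show ?thesis by simp
  qed
  have "(\<integral>\<omega>. (1 / real N * (\<Sum>j = 1..N. a j \<omega>))\<^sup>2 \<partial>M) =
      (\<integral>\<omega>. (1 / real N)\<^sup>2 * (\<Sum>i = 1..N. \<Sum>j = 1..N. a i \<omega> * a j \<omega>) \<partial>M)"
    by (simp only: power_mult_distrib) (simp only: power2_eq_square sum_product)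
  also have "\<dots> = (1 / real N)\<^sup>2 * (\<Sum>i = 1..N. \<Sum>j = 1..N. \<integral>\<omega>. a i \<omega> * a j \<omega> \<partial>M)"
    using sq_integrable_mult[OF sq sq] by (simp add: Bochner_Integration.integral_sum)
  also have "\<dots> \<le> (1 / real N)\<^sup>2 * (\<Sum>i = 1..N. V * (2 / (1 - r)))"
  proof (intro mult_left_mono sum_mono)
    fix i
    have "(\<Sum>j = 1..N. \<integral>\<omega>. a i \<omega> * a j \<omega> \<partial>M) \<le> (\<Sum>j = 1..N. V * r ^ ?d i j)"
      by (intro sum_mono c)
    also have "\<dots> \<le> V * (2 / (1 - r))"
      unfolding sum_distrib_left[symmetric] by (rule mult_left_mono[OF row V])
    finally show "(\<Sum>j = 1..N. \<integral>\<omega>. a i \<omega> * a j \<omega> \<partial>M) \<le> V * (2 / (1 - r))" .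
  qed simp
  also have "\<dots> = 2 * V / (1 - r) / real N" using N by (simp add: power2_eq_square ac_simps)
  finally show ?thesis .
qed

lemma (in prob_space) indep_components:
  assumes ind: "indep_vars (\<lambda>i. vec_borel (d i)) Z I" and ij: "i \<in> I" "j \<in> I" "i \<noteq> j"
    and ac: "a < d i" "c < d j"
    and int: "integrable M (\<lambda>\<omega>. Z i \<omega> $ a)" "integrable M (\<lambda>\<omega>. Z j \<omega> $ c)"
  shows "(\<integral>\<omega>. Z i \<omega> $ a * Z j \<omega> $ c \<partial>M) = (\<integral>\<omega>. Z i \<omega> $ a \<partial>M) * (\<integral>\<omega>. Z j \<omega> $ c \<partial>M)"
proof -
  \<comment> \<open>One component selector per index, as the composition rule for independent
    families requires.\<close>
  define u where "u i' = (if i' = i then a else c)" for i'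
  have u: "u i = a" "u j = c" using ij by (auto simp: u_def)
  have "indep_vars (\<lambda>i. vec_borel (d i)) Z {i, j}"
    using ij by (intro indep_vars_subset[OF ind]) auto
  then have "indep_vars (\<lambda>_. borel) (\<lambda>i' \<omega>. Z i' \<omega> $ u i') {i, j}"
    by (rule indep_vars_compose2) (use ac u in \<open>auto intro: vec_borel_component_measurable\<close>)
  then have "(\<integral>\<omega>. (\<Prod>i'\<in>{i, j}. Z i' \<omega> $ u i') \<partial>M) = (\<Prod>i'\<in>{i, j}. \<integral>\<omega>. Z i' \<omega> $ u i' \<partial>M)"
    by (rule indep_vars_lebesgue_integral[rotated]) (use int u in auto)
  then show ?thesis using ij u by simp
qed

locale mgmc_process = galerkin_hierarchy n b A S Pr C m + prob_space \<Omega>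
  for n and b :: "nat \<Rightarrow> nat \<Rightarrow> 'h::real_inner" and A S Pr C m and \<Omega> :: "'w measure" +
  fixes L :: nat and f :: "real Matrix.vec" and \<theta>0 :: "'w \<Rightarrow> real Matrix.vec"
    and \<xi> :: "nat \<Rightarrow> nat \<Rightarrow> nat \<Rightarrow> 'w \<Rightarrow> real Matrix.vec"
  assumes f_carrier: "f \<in> carrier_vec (n L)"
    and randomness: "mgmc_randomness \<Omega> n A S (m + m) L \<theta>0 \<xi>"
begin

definition draw_cov :: "nat \<Rightarrow> real mat" where
  "draw_cov l = (if l = 0 then Ai 0 else S l + (S l)\<^sup>T - A l)"

lemma draw_cov_Suc:
  "draw_cov (Suc l) \<in> carrier_mat (n (Suc l)) (n (Suc l))"
  "v \<in> carrier_vec (n (Suc l)) \<Longrightarrow>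
    scalar_prod v (draw_cov (Suc l) *\<^sub>v v) = 2 * scalar_prod v (S (Suc l) *\<^sub>v v) - scalar_prod v (A (Suc l) *\<^sub>v v)"
proof -
  let ?S = "S (Suc l)" and ?A = "A (Suc l)"
  have SS: "?S + ?S \<in> carrier_mat (n (Suc l)) (n (Suc l))"
    using S_carrier by (intro add_carrier_mat)
  show "draw_cov (Suc l) \<in> carrier_mat (n (Suc l)) (n (Suc l))"
    unfolding draw_cov_def by (simp only: nat.simps if_False) (rule minus_carrier_mat[OF A_carrier])
  assume v: "v \<in> carrier_vec (n (Suc l))"
  have Sv: "?S *\<^sub>v v \<in> carrier_vec (n (Suc l))" by (rule mult_mat_vec_carrier[OF S_carrier v])
  have "draw_cov (Suc l) *\<^sub>v v = ?S *\<^sub>v v + ?S *\<^sub>v v - ?A *\<^sub>v v"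
    unfolding draw_cov_def S_sym
    by (simp only: nat.simps if_False minus_mult_distrib_mat_vec[OF SS A_carrier v]
        add_mult_distrib_mat_vec[OF S_carrier S_carrier v])
  then show "scalar_prod v (draw_cov (Suc l) *\<^sub>v v) = 2 * scalar_prod v (?S *\<^sub>v v) - scalar_prod v (?A *\<^sub>v v)"
    using scalar_prod_minus_distrib[OF v add_carrier_vec[OF Sv Sv] A_vec_carrier[OF v]]
      scalar_prod_add_distrib[OF v Sv Sv] by simp
qed

lemma draw_cov_carrier: "draw_cov l \<in> carrier_mat (n l) (n l)"
proof (cases l)
  case 0
  then show ?thesis by (simp add: draw_cov_def)
next
  case (Suc l')
  then show ?thesis by (simp only: draw_cov_Suc(1))
qed

text \<open>Since \<open>A <= S\<close>, also \<open>2 S - A >= A >= 0\<close>. Without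
  semidefiniteness the root in \<open>normal_law\<close> would carry no information.\<close>

lemma draw_cov_psd: "pos_semidef_mat (draw_cov l)"
proof (cases l)
  case 0
  then show ?thesis by (simp add: draw_cov_def Ai_psd)
next
  case (Suc l')
  show ?thesis
    unfolding pos_semidef_mat_def Suc
  proof (intro conjI ballI)
    note c = carrier_matD[OF draw_cov_Suc(1)[of l']]
    show "square_mat (draw_cov (Suc l'))" using c by simp
    show "(draw_cov (Suc l'))\<^sup>T = draw_cov (Suc l')"
    proof (rule eq_matI)
      fix i j assume "i < dim_row (draw_cov (Suc l'))" "j < dim_col (draw_cov (Suc l'))"
      then have ij: "i < n (Suc l')" "j < n (Suc l')" using c by auto
      have "S (Suc l') $$ (j, i) = S (Suc l') $$ (i, j)" "A (Suc l') $$ (j, i) = A (Suc l') $$ (i, j)"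
        using ij carrier_matD[OF S_carrier[of l']] carrier_matD[OF A_carrier[of "Suc l'"]]
          arg_cong[OF S_sym[of l'], of "\<lambda>B. B $$ (i, j)"] arg_cong[OF A_sym[of "Suc l'"], of "\<lambda>B. B $$ (i, j)"]
        by simp_all
      then show "(draw_cov (Suc l'))\<^sup>T $$ (i, j) = draw_cov (Suc l') $$ (i, j)"
        using ij c carrier_matD[OF S_carrier[of l']] carrier_matD[OF A_carrier[of "Suc l'"]]
        by (simp add: draw_cov_def S_sym)
    qed (use c in simp_all)
    fix v :: "real Matrix.vec" assume "v \<in> carrier_vec (dim_row (draw_cov (Suc l')))"
    then have v: "v \<in> carrier_vec (n (Suc l'))" using c by simp
    show "0 \<le> scalar_prod v (draw_cov (Suc l') *\<^sub>v v)"
      using draw_cov_Suc(2)[OF v] norm_J_le_S[OF v] norm_J_sq[OF v] zero_le_power2[of "norm (J (Suc l') v)"]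
      by linarith
  qed
qed

section \<open>Linear functionals of the initial state and the draws\<close>

definition draws :: "(nat \<times> nat \<times> nat) set" where
  "draws = mgmc_draws (m + m) L"

lemma draw_law:
  assumes "(j, l, k) \<in> draws"
  shows "has_law \<Omega> (n l) (\<xi> j l k) (normal_law (n l) (0\<^sub>v (n l)) (draw_cov l))"
  using assms randomness
  by (auto simp: draws_def mgmc_draws_def mgmc_randomness_def draw_cov_def)

text \<open>Scalar generators contributed by one source of randomness. The constant 1 sits with the
  initial state, so that affine functionals of that state are covered; the draws are centred, hence
  orthogonal to it.\<close>

definition gen :: "(nat \<times> nat \<times> nat) option \<Rightarrow> ('w \<Rightarrow> real) set" where
  "gen i = (case i of None \<Rightarrow> insert (\<lambda>_. 1) ((\<lambda>a \<omega>. \<theta>0 \<omega> $ a) ` {..<n L})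
     | Some (j, l, k) \<Rightarrow> (\<lambda>a \<omega>. \<xi> j l k \<omega> $ a) ` {..<n l})"

definition indices :: "(nat \<times> nat \<times> nat) option set" where
  "indices = insert None (Some ` draws)"

definition lin :: "(nat \<times> nat \<times> nat) option set \<Rightarrow> ('w \<Rightarrow> real) set" where
  "lin K = lin_span \<Omega> (\<Union>i\<in>K. gen i)"

lemma initial_law:
  obtains \<mu> \<Sigma> where "\<mu> \<in> carrier_vec (n L)" "\<Sigma> \<in> carrier_mat (n L) (n L)" "pos_semidef_mat \<Sigma>"
    "has_law \<Omega> (n L) \<theta>0 (normal_law (n L) \<mu> \<Sigma>)"
  using randomness by (auto simp: mgmc_randomness_def normal_vector_def)

lemma initial_sq_integrable: "a < n L \<Longrightarrow> sq_integrable \<Omega> (\<lambda>\<omega>. \<theta>0 \<omega> $ a)"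
  using initial_law has_law_normal_component(1) by metis

lemma draw_component:
  assumes "(j, l, k) \<in> draws" "a < n l"
  shows "sq_integrable \<Omega> (\<lambda>\<omega>. \<xi> j l k \<omega> $ a)" "(\<integral>\<omega>. \<xi> j l k \<omega> $ a \<partial>\<Omega>) = 0"
  using has_law_normal_component[OF draw_law[OF assms(1)] _ draw_cov_carrier draw_cov_psd assms(2)]
    assms(2) by simp_all

lemma gen_sq_integrable:
  assumes "i \<in> indices" "X \<in> gen i"
  shows "sq_integrable \<Omega> X"
proof (cases i)
  case None
  then show ?thesis
    using assms(2) initial_sq_integrable sq_integrable_const by (auto simp: gen_def)
next
  case (Some d)
  then show ?thesis
    using assms draw_component(1) by (cases d) (auto simp: gen_def indices_def)
qed

text \<open>Of two different indices at least one is a draw, with mean 0. Against the constant this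
  mean is the integral itself; against any other generator independence makes the integral a product
  with this mean as a factor.\<close>

lemma gen_orthogonal:
  assumes "i \<in> indices" "j \<in> indices" "i \<noteq> j" "X \<in> gen i" "Y \<in> gen j"
  shows "(\<integral>\<omega>. X \<omega> * Y \<omega> \<partial>\<Omega>) = 0"
proof -
  have *: "(\<integral>\<omega>. X \<omega> * Y \<omega> \<partial>\<Omega>) = 0"
    if i: "i \<in> indices" and j: "j \<in> indices" and neq: "i \<noteq> j" and X: "X \<in> gen i" and Y: "Y \<in> gen j"
      and jN: "j \<noteq> None" for i j X Y
  proof -
    obtain d1 d2 d3 where d: "j = Some (d1, d2, d3)" using jN by (cases j) auto
    then have dd: "(d1, d2, d3) \<in> draws" using j by (auto simp: indices_def)
    obtain a where a: "a < n d2" "Y = (\<lambda>\<omega>. \<xi> d1 d2 d3 \<omega> $ a)"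
      using Y d by (auto simp: gen_def)
    have EY: "(\<integral>\<omega>. Y \<omega> \<partial>\<Omega>) = 0" using draw_component(2)[OF dd a(1)] by (simp add: a(2))
    let ?dim = "\<lambda>i. case i of None \<Rightarrow> n L | Some (m, l, k) \<Rightarrow> n l"
    let ?Z = "\<lambda>i. case i of None \<Rightarrow> \<theta>0 | Some (m, l, k) \<Rightarrow> \<xi> m l k"
    show ?thesis
    proof (cases "X = (\<lambda>_. 1)")
      case True
      then show ?thesis using EY by simp
    next
      case False
      then obtain c where c: "c < ?dim i" "X = (\<lambda>\<omega>. ?Z i \<omega> $ c)"
        using X by (cases i) (auto simp: gen_def)
      have ind: "indep_vars (\<lambda>i. vec_borel (?dim i)) ?Z indices"
        using randomness unfolding mgmc_randomness_def indices_def draws_def by blast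
      have "integrable \<Omega> X" "integrable \<Omega> Y"
        using gen_sq_integrable i j X Y sq_integrable_integrable by blast+
      then have "(\<integral>\<omega>. ?Z i \<omega> $ c * ?Z j \<omega> $ a \<partial>\<Omega>) = (\<integral>\<omega>. ?Z i \<omega> $ c \<partial>\<Omega>) * (\<integral>\<omega>. ?Z j \<omega> $ a \<partial>\<Omega>)"
        by (intro indep_components[OF ind i j neq c(1)]) (simp_all add: c(2) a d)
      then show ?thesis using EY by (simp add: c(2) a(2) d)
    qed
  qed
  show ?thesis
  proof (cases "j = None")
    case True
    then have "(\<integral>\<omega>. Y \<omega> * X \<omega> \<partial>\<Omega>) = 0" using assms by (intro *[of j i]) auto
    then show ?thesis by (simp add: mult.commute)
  qed (use assms * in blast)
qed

lemma lin_sq_integrable: "K \<subseteq> indices \<Longrightarrow> X \<in> lin K \<Longrightarrow> sq_integrable \<Omega> X"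
  unfolding lin_def by (rule lin_span_sq_integrable) (auto intro: gen_sq_integrable)

lemma lin_orthogonal:
  assumes "K \<subseteq> indices" "K' \<subseteq> indices" "K \<inter> K' = {}" "X \<in> lin K" "Y \<in> lin K'"
  shows "(\<integral>\<omega>. X \<omega> * Y \<omega> \<partial>\<Omega>) = 0"
  using assms(4,5) unfolding lin_def
proof (rule lin_span_orthogonal)
  fix X Y assume "X \<in> (\<Union>i\<in>K. gen i)" "Y \<in> (\<Union>i\<in>K'. gen i)"
  then show "(\<integral>\<omega>. X \<omega> * Y \<omega> \<partial>\<Omega>) = 0"
    using assms(1-3) gen_orthogonal by blast
qed (use assms(1,2) gen_sq_integrable in blast)

lemma lin_mono: "K \<subseteq> K' \<Longrightarrow> X \<in> lin K \<Longrightarrow> X \<in> lin K'"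
  unfolding lin_def by (rule lin_span_mono[of "\<Union> (gen ` K)"]) auto

lemma lin_add: "X \<in> lin K \<Longrightarrow> Y \<in> lin K \<Longrightarrow> (\<lambda>\<omega>. X \<omega> + Y \<omega>) \<in> lin K"
  unfolding lin_def by (rule lin_span_add)

lemma lin_cong: "X \<in> lin K \<Longrightarrow> (\<And>\<omega>. \<omega> \<in> space \<Omega> \<Longrightarrow> X \<omega> = Y \<omega>) \<Longrightarrow> Y \<in> lin K"
  unfolding lin_def by (rule lin_span.cong)

lemma draw_carrier: "(j, l, k) \<in> draws \<Longrightarrow> \<omega> \<in> space \<Omega> \<Longrightarrow> \<xi> j l k \<omega> \<in> carrier_vec (n l)"
  using draw_law[of j l k] measurable_space[of "\<xi> j l k" \<Omega> "vec_borel (n l)" \<omega>]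
  by (simp add: has_law_def space_vec_borel)

lemma initial_carrier: "\<omega> \<in> space \<Omega> \<Longrightarrow> \<theta>0 \<omega> \<in> carrier_vec (n L)"
  using initial_law measurable_space[of \<theta>0 \<Omega> "vec_borel (n L)" \<omega>]
  by (metis has_law_def space_vec_borel)

lemma lin_scalar_prod:
  assumes X: "\<And>\<omega>. \<omega> \<in> space \<Omega> \<Longrightarrow> X \<omega> \<in> carrier_vec N"
    and gen: "\<And>a. a < N \<Longrightarrow> (\<lambda>\<omega>. X \<omega> $ a) \<in> gen i"
  shows "(\<lambda>\<omega>. scalar_prod q (X \<omega>)) \<in> lin {i}"
proof (rule lin_cong)
  show "(\<lambda>\<omega>. \<Sum>a<N. q $ a * X \<omega> $ a) \<in> lin {i}"
    unfolding lin_def by (intro lin_span_sum lin_span_base) (use gen in auto)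
  show "(\<Sum>a<N. q $ a * X \<omega> $ a) = scalar_prod q (X \<omega>)" if "\<omega> \<in> space \<Omega>" for \<omega>
    using X[OF that] by (simp add: scalar_prod_def lessThan_atLeast0)
qed

lemma lin_draw:
  assumes "(j, l, k) \<in> draws"
  shows "(\<lambda>\<omega>. scalar_prod q (\<xi> j l k \<omega>)) \<in> lin {Some (j, l, k)}"
  by (rule lin_scalar_prod[where N = "n l"]) (auto simp: draw_carrier[OF assms] gen_def)

text \<open>\<open>N\<close> is the centred randomness injected by an affine update whose linear part has adjoint \<open>e\<close>.
  The second clause says that the update leaves the second moments of the target invariant:
  in the energy inner product the target has covariance operator \<open>I\<close>.\<close>

definition noise :: "(nat \<times> nat \<times> nat) option set \<Rightarrow> ('h \<Rightarrow> 'h) \<Rightarrow> ('w \<Rightarrow> 'h) \<Rightarrow> bool" where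
  "noise K e N \<longleftrightarrow> (\<forall>x. (\<lambda>\<omega>. inner x (N \<omega>)) \<in> lin K \<and>
     (\<integral>\<omega>. (inner x (N \<omega>))\<^sup>2 \<partial>\<Omega>) = (norm x)\<^sup>2 - (norm (e x))\<^sup>2)"

lemma noise_zero: "noise {} (\<lambda>x. x) (\<lambda>_. 0)"
  by (simp add: noise_def lin_def lin_span.zero)

text \<open>The second moments telescope:
  \<open>(|g x|^2 - |e (g x)|^2) + (|x|^2 - |g x|^2)\<close>. Mixed terms vanish since the two
  noises use disjoint sources. Adjoints compose in reverse order, hence \<open>e\<close> after
  \<open>g\<close>.\<close>

lemma noise_compose:
  assumes N1: "noise K e N1" and N2: "noise K' g N2" and g: "sym_op g"
    and K: "K \<subseteq> indices" "K' \<subseteq> indices" "K \<inter> K' = {}"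
  shows "noise (K \<union> K') (\<lambda>x. e (g x)) (\<lambda>\<omega>. g (N1 \<omega>) + N2 \<omega>)"
  unfolding noise_def
proof (intro allI conjI)
  fix x
  have eq: "inner x (g (N1 \<omega>) + N2 \<omega>) = inner (g x) (N1 \<omega>) + inner x (N2 \<omega>)" for \<omega>
    by (simp add: inner_add_right sym_op_inner[OF g])
  have l1: "(\<lambda>\<omega>. inner (g x) (N1 \<omega>)) \<in> lin K" and l2: "(\<lambda>\<omega>. inner x (N2 \<omega>)) \<in> lin K'"
    using N1 N2 by (auto simp: noise_def)
  show "(\<lambda>\<omega>. inner x (g (N1 \<omega>) + N2 \<omega>)) \<in> lin (K \<union> K')"
    unfolding eq by (intro lin_add lin_mono[OF _ l1] lin_mono[OF _ l2]) auto
  have "(\<integral>\<omega>. (inner (g x) (N1 \<omega>) + inner x (N2 \<omega>))\<^sup>2 \<partial>\<Omega>) =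
      (\<integral>\<omega>. (inner (g x) (N1 \<omega>))\<^sup>2 \<partial>\<Omega>) + (\<integral>\<omega>. (inner x (N2 \<omega>))\<^sup>2 \<partial>\<Omega>)"
    by (rule integral_add_sq_orthogonal[OF lin_sq_integrable[OF K(1) l1] lin_sq_integrable[OF K(2) l2]
          lin_orthogonal[OF K l1 l2]])
  then show "(\<integral>\<omega>. (inner x (g (N1 \<omega>) + N2 \<omega>))\<^sup>2 \<partial>\<Omega>) = (norm x)\<^sup>2 - (norm (e (g x)))\<^sup>2"
    unfolding eq using N1 N2 by (simp add: noise_def)
qed

lemma draw_second_moment:
  assumes "(j, l, k) \<in> draws" "q \<in> carrier_vec (n l)"
  shows "(\<integral>\<omega>. (scalar_prod q (\<xi> j l k \<omega>))\<^sup>2 \<partial>\<Omega>) = scalar_prod q (draw_cov l *\<^sub>v q)"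
  using has_law_normal_linear(3)[OF draw_law[OF assms(1)] _ draw_cov_carrier draw_cov_psd assms(2)]
    assms(2) by simp

text \<open>This is where the covariance \<open>M + M^T - A\<close> is needed: transported to the
  energy space it reads \<open>2 <k x, x> - |k x|^2 = |x|^2 - |x - k x|^2\<close> with
  \<open>k = sinv (Suc l)\<close>.\<close>

lemma smoother_noise:
  assumes d: "(j, Suc l, k) \<in> draws"
  shows "noise {Some (j, Suc l, k)} (smooth (Suc l)) (\<lambda>\<omega>. J (Suc l) (Mi (Suc l) *\<^sub>v \<xi> j (Suc l) k \<omega>))"
  unfolding noise_def
proof (intro allI conjI)
  fix x
  let ?q = "Mi (Suc l) *\<^sub>v Jt (Suc l) x"
  have q: "?q \<in> carrier_vec (n (Suc l))" by simp
  have eq: "inner x (J (Suc l) (Mi (Suc l) *\<^sub>v \<xi> j (Suc l) k \<omega>)) = scalar_prod ?q (\<xi> j (Suc l) k \<omega>)"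
    if "\<omega> \<in> space \<Omega>" for \<omega>
  proof -
    note c = draw_carrier[OF d that]
    show ?thesis
      using scalar_prod_sym_mat[OF Mi_carrier Mi_sym c coef_carrier[of _ "b (Suc l)" x]]
        comm_scalar_prod[OF c q]
      by (simp add: inner_comb c inner_commute[of x])
  qed
  show "(\<lambda>\<omega>. inner x (J (Suc l) (Mi (Suc l) *\<^sub>v \<xi> j (Suc l) k \<omega>))) \<in> lin {Some (j, Suc l, k)}"
    by (rule lin_cong[OF lin_draw[OF d, of ?q]]) (simp add: eq)
  have "(\<integral>\<omega>. (inner x (J (Suc l) (Mi (Suc l) *\<^sub>v \<xi> j (Suc l) k \<omega>)))\<^sup>2 \<partial>\<Omega>) =
      (\<integral>\<omega>. (scalar_prod ?q (\<xi> j (Suc l) k \<omega>))\<^sup>2 \<partial>\<Omega>)"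
    by (intro Bochner_Integration.integral_cong) (simp_all add: eq)
  also have "\<dots> = 2 * scalar_prod ?q (S (Suc l) *\<^sub>v ?q) - scalar_prod ?q (A (Suc l) *\<^sub>v ?q)"
    by (simp add: draw_second_moment[OF d q] draw_cov_Suc(2)[OF q])
  also have "scalar_prod ?q (S (Suc l) *\<^sub>v ?q) = inner (sinv (Suc l) x) x"
    by (simp add: S_Mi_vec sinv_def sandwich_def inner_comb)
  also have "scalar_prod ?q (A (Suc l) *\<^sub>v ?q) = (norm (sinv (Suc l) x))\<^sup>2"
    by (simp add: sinv_def sandwich_def norm_J_sq)
  also have "2 * inner (sinv (Suc l) x) x - (norm (sinv (Suc l) x))\<^sup>2 = (norm x)\<^sup>2 - (norm (smooth (Suc l) x))\<^sup>2"
    by (simp add: smooth_def power2_norm_eq_inner inner_diff_left inner_diff_right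
        inner_commute[of x "sinv (Suc l) x"])
  finally show "(\<integral>\<omega>. (inner x (J (Suc l) (Mi (Suc l) *\<^sub>v \<xi> j (Suc l) k \<omega>)))\<^sup>2 \<partial>\<Omega>) =
      (norm x)\<^sup>2 - (norm (smooth (Suc l) x))\<^sup>2" .
qed

lemma exact_sampler_noise:
  assumes d: "(j, 0, 0) \<in> draws"
  shows "noise {Some (j, 0, 0)} (err 0) (\<lambda>\<omega>. J 0 (\<xi> j 0 0 \<omega>))"
  unfolding noise_def
proof (intro allI conjI)
  fix x
  let ?q = "Jt 0 x"
  have q: "?q \<in> carrier_vec (n 0)" by simp
  have eq: "inner x (J 0 (\<xi> j 0 0 \<omega>)) = scalar_prod ?q (\<xi> j 0 0 \<omega>)" if "\<omega> \<in> space \<Omega>" for \<omega>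
    using comm_scalar_prod[OF draw_carrier[OF d that] q] draw_carrier[OF d that]
    by (simp add: inner_comb inner_commute[of x])
  show "(\<lambda>\<omega>. inner x (J 0 (\<xi> j 0 0 \<omega>))) \<in> lin {Some (j, 0, 0)}"
    by (rule lin_cong[OF lin_draw[OF d, of ?q]]) (simp add: eq)
  have "(\<integral>\<omega>. (inner x (J 0 (\<xi> j 0 0 \<omega>)))\<^sup>2 \<partial>\<Omega>) = (\<integral>\<omega>. (scalar_prod ?q (\<xi> j 0 0 \<omega>))\<^sup>2 \<partial>\<Omega>)"
    by (intro Bochner_Integration.integral_cong) (simp_all add: eq)
  also have "\<dots> = scalar_prod ?q (Ai 0 *\<^sub>v ?q)"
    by (simp add: draw_second_moment[OF d q] draw_cov_def)
  also have "\<dots> = inner (proj 0 x) x"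
    using comm_scalar_prod[OF q Ai_vec_carrier[OF q]] by (simp add: proj_def sandwich_def inner_comb)
  finally show "(\<integral>\<omega>. (inner x (J 0 (\<xi> j 0 0 \<omega>)))\<^sup>2 \<partial>\<Omega>) = (norm x)\<^sup>2 - (norm (err 0 x))\<^sup>2"
    by (simp add: norm_minus_p)
qed

text \<open>The incoming noise \<open>N\<close> is arbitrary, so the lemma serves pre-smoothing
  (from 0) and post-smoothing. Distinctness and \<open>disj\<close> guarantee that each step brings
  in a new source, as \<open>noise_compose\<close> demands.\<close>

lemma fold_smooth_step_noise:
  assumes N: "noise K e N" and K: "K \<subseteq> indices"
    and ks: "distinct ks" "\<And>k. k \<in> set ks \<Longrightarrow> (j, Suc l, k) \<in> draws"
    and disj: "\<And>k. k \<in> set ks \<Longrightarrow> Some (j, Suc l, k) \<notin> K"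
  shows "noise (K \<union> (\<lambda>k. Some (j, Suc l, k)) ` set ks) (\<lambda>x. e ((smooth (Suc l) ^^ length ks) x))
    (\<lambda>\<omega>. fold (\<lambda>k. smooth_step (Suc l) (\<xi> j (Suc l) k \<omega>)) ks (N \<omega>))"
  using ks disj
proof (induction ks rule: rev_induct)
  case Nil
  then show ?case using N by simp
next
  case (snoc k ks)
  let ?K = "K \<union> (\<lambda>k. Some (j, Suc l, k)) ` set ks"
  have "noise (?K \<union> {Some (j, Suc l, k)}) (\<lambda>x. e ((smooth (Suc l) ^^ length ks) (smooth (Suc l) x)))
    (\<lambda>\<omega>. smooth (Suc l) (fold (\<lambda>k. smooth_step (Suc l) (\<xi> j (Suc l) k \<omega>)) ks (N \<omega>)) +
      J (Suc l) (Mi (Suc l) *\<^sub>v \<xi> j (Suc l) k \<omega>))"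
  proof (rule noise_compose[where g = "smooth (Suc l)" and e = "\<lambda>x. e ((smooth (Suc l) ^^ length ks) x)"])
    show "noise ?K (\<lambda>x. e ((smooth (Suc l) ^^ length ks) x))
        (\<lambda>\<omega>. fold (\<lambda>k. smooth_step (Suc l) (\<xi> j (Suc l) k \<omega>)) ks (N \<omega>))"
      using snoc by simp
    show "noise {Some (j, Suc l, k)} (smooth (Suc l)) (\<lambda>\<omega>. J (Suc l) (Mi (Suc l) *\<^sub>v \<xi> j (Suc l) k \<omega>))"
      using snoc.prems by (intro smoother_noise) simp
    show "?K \<subseteq> indices" "{Some (j, Suc l, k)} \<subseteq> indices"
      using K snoc.prems by (auto simp: indices_def)
    show "?K \<inter> {Some (j, Suc l, k)} = {}" using snoc.prems by auto
  qed (rule smooth_sym)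
  then show ?case
    by (simp add: smooth_step_def[where v = "fold u ks v" for u v] funpow_swap1 Un_assoc)
qed

definition fresh :: "nat \<Rightarrow> nat \<Rightarrow> (nat \<times> nat \<times> nat) option set" where
  "fresh j l = Some ` {(j', l', k) \<in> draws. j' = j \<and> l' \<le> l}"

lemma fresh_subset: "fresh j l \<subseteq> indices"
  by (auto simp: fresh_def indices_def)

lemma draws_iff: "(j, l, k) \<in> draws \<longleftrightarrow> (l = 0 \<and> k = 0) \<or> (1 \<le> l \<and> l \<le> L \<and> k < m + m)"
  by (simp add: draws_def mgmc_draws_def)

text \<open>A cycle is pre-smoothing, coarse correction and post-smoothing in succession, with
  disjoint draws. The adjoints accumulate to \<open>s^m (err l (s^m x))\<close>, which is again
  \<open>err (Suc l)\<close> since the cycle is symmetric.\<close>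

lemma cycle_noise: "l \<le> L \<Longrightarrow> noise (fresh j l) (err l) (\<lambda>\<omega>. cycle (\<lambda>l k. \<xi> j l k \<omega>) l 0)"
proof (induction l)
  case 0
  have "fresh j 0 = {Some (j, 0, 0)}" by (auto simp: fresh_def draws_iff)
  then show ?case
    using exact_sampler_noise[of j] by (simp add: draws_iff linear_0[OF sym_op_linear[OF proj_sym]])
next
  case (Suc l)
  let ?st = "\<lambda>\<omega> k. smooth_step (Suc l) (\<xi> j (Suc l) k \<omega>)"
  let ?D = "\<lambda>ks. (\<lambda>k. Some (j, Suc l, k)) ` set ks"
  let ?s = "smooth (Suc l) ^^ m"
  have d: "(j, Suc l, k) \<in> draws" if "k < m + m" for k using that Suc.prems by (simp add: draws_iff)
  have 1: "noise (?D [0..<m]) ?s (\<lambda>\<omega>. fold (?st \<omega>) [0..<m] 0)"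
    using fold_smooth_step_noise[OF noise_zero, of "[0..<m]" j l] d by simp
  \<comment> \<open>By \<open>cycle_affine\<close> the coarse correction is the linear map
    \<open>err l\<close> followed by noise from lower levels only.\<close>
  have 2: "noise (?D [0..<m] \<union> fresh j l) (\<lambda>x. ?s (err l x))
      (\<lambda>\<omega>. err l (fold (?st \<omega>) [0..<m] 0) + cycle (\<lambda>l k. \<xi> j l k \<omega>) l 0)"
  proof (rule noise_compose[OF 1 _ err_sym _ fresh_subset])
    show "noise (fresh j l) (err l) (\<lambda>\<omega>. cycle (\<lambda>l k. \<xi> j l k \<omega>) l 0)"
      using Suc by simp
    show "?D [0..<m] \<subseteq> indices" using d by (auto simp: indices_def)
    show "?D [0..<m] \<inter> fresh j l = {}" by (auto simp: fresh_def)
  qed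
  have 3: "noise (?D [0..<m] \<union> fresh j l \<union> ?D [m..<m + m]) (\<lambda>x. ?s (err l ((smooth (Suc l) ^^ length [m..<m + m]) x)))
      (\<lambda>\<omega>. fold (?st \<omega>) [m..<m + m] (err l (fold (?st \<omega>) [0..<m] 0) + cycle (\<lambda>l k. \<xi> j l k \<omega>) l 0))"
  proof (rule fold_smooth_step_noise[OF 2])
    show "?D [0..<m] \<union> fresh j l \<subseteq> indices"
      using d fresh_subset[of j l] by (auto simp: indices_def)
    show "(j, Suc l, k) \<in> draws" if "k \<in> set [m..<m + m]" for k using that by (intro d) simp
    show "Some (j, Suc l, k) \<notin> ?D [0..<m] \<union> fresh j l" if "k \<in> set [m..<m + m]" for k
      using that by (auto simp: fresh_def)
  qed simp
  have D: "?D [0..<m] \<union> ?D [m..<m + m] = (\<lambda>k. Some (j, Suc l, k)) ` {..<m + m}"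
  proof -
    have "set [0..<m] \<union> set [m..<m + m] = {..<m + m}" by auto
    then show ?thesis unfolding image_Un[symmetric] by (rule arg_cong)
  qed
  have F: "fresh j (Suc l) = fresh j l \<union> (\<lambda>k. Some (j, Suc l, k)) ` {..<m + m}"
  proof -
    have "{(j', l', k) \<in> draws. j' = j \<and> l' \<le> Suc l} =
        {(j', l', k) \<in> draws. j' = j \<and> l' \<le> l} \<union> (\<lambda>k. (j, Suc l, k)) ` {..<m + m}"
      (is "?l = ?r")
    proof (rule Set.set_eqI)
      have dS: "(j', Suc l, k) \<in> draws \<longleftrightarrow> k < m + m" for j' k
        using Suc.prems by (simp add: draws_iff)
      fix x :: "nat \<times> nat \<times> nat"
      obtain a c k where x: "x = (a, c, k)" by (cases x) auto
      have "x \<in> ?l \<longleftrightarrow> (a, c, k) \<in> draws \<and> a = j \<and> (c \<le> l \<or> c = Suc l)"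
        unfolding x le_Suc_eq by simp
      also have "\<dots> \<longleftrightarrow> ((a, c, k) \<in> draws \<and> a = j \<and> c \<le> l) \<or> (a = j \<and> c = Suc l \<and> k < m + m)"
        using dS by auto
      also have "\<dots> \<longleftrightarrow> x \<in> ?r" unfolding x by (simp add: image_iff)
      finally show "x \<in> ?l \<longleftrightarrow> x \<in> ?r" .
    qed
    then show ?thesis unfolding fresh_def by (simp only: image_Un image_image)
  qed
  have K: "?D [0..<m] \<union> fresh j l \<union> ?D [m..<m + m] = fresh j (Suc l)"
    unfolding F D[symmetric] by (rule Set.set_eqI) (simp only: Un_iff disj_ac)
  have len: "length [m..<m + m] = m" by simp
  show ?case
    using 3 unfolding K len cycle.simps err.simps
    by (subst cycle_affine)
qed

section \<open>The chain of deviations from the target mean\<close>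

definition state :: "nat \<Rightarrow> 'w \<Rightarrow> real Matrix.vec" where
  "state j \<omega> = mgmc_chain n A S Pr m m L f \<theta>0 \<xi> j \<omega>"

definition dev :: "nat \<Rightarrow> 'w \<Rightarrow> 'h" where
  "dev j \<omega> = J L (state j \<omega>) - exact L f"

definition past :: "nat \<Rightarrow> (nat \<times> nat \<times> nat) option set" where
  "past j = insert None (Some ` {(j', l, k) \<in> draws. j' < j})"

lemma past_subset: "past j \<subseteq> indices"
  by (auto simp: past_def indices_def)

lemma state_step:
  assumes "\<omega> \<in> space \<Omega>"
  shows "state j \<omega> \<in> carrier_vec (n L)"
    and "dev (Suc j) \<omega> = err L (dev j \<omega>) + cycle (\<lambda>l k. \<xi> j l k \<omega>) L 0"
proof -
  have step: "state (Suc j) \<omega> \<in> carrier_vec (n L) \<and> dev (Suc j) \<omega> = cycle (\<lambda>l k. \<xi> j l k \<omega>) L (dev j \<omega>)"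
    if "state j \<omega> \<in> carrier_vec (n L)" for j
    unfolding dev_def state_def mgmc_chain.simps
    by (rule mgmc_error[OF f_carrier that[unfolded state_def]])
      (auto intro!: draw_carrier assms simp: draws_iff)
  show c: "state j \<omega> \<in> carrier_vec (n L)" for j
  proof (induction j)
    case 0
    then show ?case using initial_carrier[OF assms] by (simp add: state_def)
  qed (use step in blast)
  show "dev (Suc j) \<omega> = err L (dev j \<omega>) + cycle (\<lambda>l k. \<xi> j l k \<omega>) L 0"
    by (rule trans[OF conjunct2[OF step[OF c]] cycle_affine])
qed

lemma inner_dev_0:
  "\<omega> \<in> space \<Omega> \<Longrightarrow> inner x (dev 0 \<omega>) = scalar_prod (Jt L x) (\<theta>0 \<omega>) - inner x (exact L f)"
  using initial_carrier[of \<omega>] comm_scalar_prod[of "\<theta>0 \<omega>" "n L" "Jt L x"]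
  by (simp add: dev_def state_def inner_diff_right inner_comb inner_commute[of x "J L _"])

lemma dev_lin: "(\<lambda>\<omega>. inner x (dev j \<omega>)) \<in> lin (past j)"
proof (induction j arbitrary: x)
  case 0
  have "(\<lambda>\<omega>. scalar_prod (Jt L x) (\<theta>0 \<omega>)) \<in> lin {None}"
    by (rule lin_scalar_prod[where N = "n L"]) (auto simp: initial_carrier gen_def)
  \<comment> \<open>Centring at the target mean adds a constant, which the generator 1 of index
    \<open>None\<close> accounts for.\<close>
  moreover have "(\<lambda>\<omega>. (- inner x (exact L f)) * 1) \<in> lin {None}"
    unfolding lin_def by (rule lin_span_base) (simp add: gen_def)
  ultimately have "(\<lambda>\<omega>. scalar_prod (Jt L x) (\<theta>0 \<omega>) + (- inner x (exact L f)) * 1) \<in> lin {None}"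
    by (rule lin_add)
  then have "(\<lambda>\<omega>. inner x (dev 0 \<omega>)) \<in> lin {None}"
    by (rule lin_cong) (simp add: inner_dev_0)
  moreover have "past 0 = {None}" by (auto simp: past_def)
  ultimately show ?case by simp
next
  case (Suc j)
  have "(\<lambda>\<omega>. inner (err L x) (dev j \<omega>)) \<in> lin (past (Suc j))"
    by (rule lin_mono[OF _ Suc.IH]) (auto simp: past_def)
  moreover have "(\<lambda>\<omega>. inner x (cycle (\<lambda>l k. \<xi> j l k \<omega>) L 0)) \<in> lin (past (Suc j))"
    by (rule lin_mono[of "fresh j L"]) (use cycle_noise[of L j] in \<open>auto simp: noise_def past_def fresh_def\<close>)
  ultimately have "(\<lambda>\<omega>. inner (err L x) (dev j \<omega>) + inner x (cycle (\<lambda>l k. \<xi> j l k \<omega>) L 0)) \<in> lin (past (Suc j))"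
    by (rule lin_add)
  then show ?case
    by (rule lin_cong) (simp add: state_step(2) inner_add_right sym_op_inner[OF err_sym])
qed

lemma dev_sq_integrable: "sq_integrable \<Omega> (\<lambda>\<omega>. inner x (dev j \<omega>))"
  by (rule lin_sq_integrable[OF past_subset dev_lin])

text \<open>The deviation at time \<open>i\<close> involves the transitions before \<open>i\<close>
  only, and the noise here belongs to transition \<open>j\<close>; hence \<open>i = j\<close> is
  still allowed.\<close>

lemma noise_dev_orthogonal:
  assumes "i \<le> j"
  shows "(\<integral>\<omega>. inner x (cycle (\<lambda>l k. \<xi> j l k \<omega>) L 0) * inner y (dev i \<omega>) \<partial>\<Omega>) = 0"
proof (rule lin_orthogonal[OF fresh_subset past_subset])
  show "fresh j L \<inter> past i = {}" using assms by (auto simp: fresh_def past_def)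
qed (use cycle_noise[of L j] dev_lin in \<open>auto simp: noise_def\<close>)

lemma noise_sq_integrable: "sq_integrable \<Omega> (\<lambda>\<omega>. inner x (cycle (\<lambda>l k. \<xi> j l k \<omega>) L 0))"
  by (rule lin_sq_integrable[OF fresh_subset]) (use cycle_noise[of L j] in \<open>auto simp: noise_def\<close>)

text \<open>One transition gives \<open>|x|^2 - |e x|^2 + G |e x|^2\<close> as a bound, which is at
  most \<open>G |x|^2\<close> when \<open>G\<close> is at least 1: the target covariance, with value
  1, is a fixed point below \<open>G\<close>.\<close>

lemma dev_second_moment:
  assumes G: "1 \<le> G" and init: "\<And>x. (\<integral>\<omega>. (inner x (dev 0 \<omega>))\<^sup>2 \<partial>\<Omega>) \<le> G * (norm x)\<^sup>2"
  shows "(\<integral>\<omega>. (inner x (dev j \<omega>))\<^sup>2 \<partial>\<Omega>) \<le> G * (norm x)\<^sup>2"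
proof (induction j arbitrary: x)
  case (Suc j)
  let ?N = "\<lambda>\<omega>. cycle (\<lambda>l k. \<xi> j l k \<omega>) L 0"
  have N: "(\<integral>\<omega>. (inner x (?N \<omega>))\<^sup>2 \<partial>\<Omega>) = (norm x)\<^sup>2 - (norm (err L x))\<^sup>2"
    using cycle_noise[of L j] by (simp add: noise_def)
  \<comment> \<open>Nonnegativity of the noise's second moment shows
    \<open>norm (err L x) \<le> norm x\<close> on the whole space.\<close>
  moreover have "0 \<le> (\<integral>\<omega>. (inner x (?N \<omega>))\<^sup>2 \<partial>\<Omega>)" by simp
  ultimately have "(G - 1) * (norm (err L x))\<^sup>2 \<le> (G - 1) * (norm x)\<^sup>2"
    using G by (intro mult_left_mono) auto
  moreover have "(\<integral>\<omega>. (inner x (dev (Suc j) \<omega>))\<^sup>2 \<partial>\<Omega>) =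
      (\<integral>\<omega>. (inner x (?N \<omega>) + inner (err L x) (dev j \<omega>))\<^sup>2 \<partial>\<Omega>)"
    by (intro Bochner_Integration.integral_cong)
      (simp_all add: state_step(2) inner_add_right sym_op_inner[OF err_sym] add.commute)
  moreover have "\<dots> = (norm x)\<^sup>2 - (norm (err L x))\<^sup>2 + (\<integral>\<omega>. (inner (err L x) (dev j \<omega>))\<^sup>2 \<partial>\<Omega>)"
    using integral_add_sq_orthogonal[OF noise_sq_integrable dev_sq_integrable noise_dev_orthogonal[OF order_refl]] N
    by simp
  ultimately show ?case using Suc.IH[of "err L x"] by (simp add: algebra_simps)
qed (rule init)

text \<open>Peel off the last transition: its noise is orthogonal to the earlier deviation, and its
  linear part moves to \<open>x\<close> by symmetry.\<close>

lemma dev_correlation_shift: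
  "(\<integral>\<omega>. inner x (dev (i + j) \<omega>) * inner y (dev i \<omega>) \<partial>\<Omega>) =
   (\<integral>\<omega>. inner ((err L ^^ j) x) (dev i \<omega>) * inner y (dev i \<omega>) \<partial>\<Omega>)"
proof (induction j arbitrary: x)
  case (Suc j)
  let ?N = "\<lambda>\<omega>. cycle (\<lambda>l k. \<xi> (i + j) l k \<omega>) L 0"
  have "(\<integral>\<omega>. inner x (dev (i + Suc j) \<omega>) * inner y (dev i \<omega>) \<partial>\<Omega>) =
      (\<integral>\<omega>. inner (err L x) (dev (i + j) \<omega>) * inner y (dev i \<omega>) + inner x (?N \<omega>) * inner y (dev i \<omega>) \<partial>\<Omega>)"
    by (intro Bochner_Integration.integral_cong)
      (simp_all add: state_step(2) inner_add_right sym_op_inner[OF err_sym] distrib_right)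
  also have "\<dots> = (\<integral>\<omega>. inner (err L x) (dev (i + j) \<omega>) * inner y (dev i \<omega>) \<partial>\<Omega>)"
    using sq_integrable_mult[OF dev_sq_integrable dev_sq_integrable]
      sq_integrable_mult[OF noise_sq_integrable dev_sq_integrable]
    by (simp add: noise_dev_orthogonal)
  also have "\<dots> = (\<integral>\<omega>. inner ((err L ^^ j) (err L x)) (dev i \<omega>) * inner y (dev i \<omega>) \<partial>\<Omega>)"
    by (rule Suc.IH)
  finally show ?case by (simp add: funpow_swap1)
qed simp

text \<open>Deviations lie in the range of \<open>proj L\<close>, so test vectors may be projected
  first. This makes \<open>err_contraction\<close> applicable, which holds only on that
  range.\<close>

lemma inner_dev_proj: "\<omega> \<in> space \<Omega> \<Longrightarrow> inner (proj L x) (dev j \<omega>) = inner x (dev j \<omega>)"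
proof -
  assume "\<omega> \<in> space \<Omega>"
  from state_step(1)[OF this] have "proj L (dev j \<omega>) = dev j \<omega>"
    using f_carrier by (simp add: dev_def exact_def proj_J flip: comb_diff)
  then show ?thesis by (simp add: sym_op_inner[OF proj_sym])
qed

lemma norm_proj_le: "norm (proj l x) \<le> norm x"
proof -
  have "inner (proj l x) x = (norm (proj l x))\<^sup>2"
    by (metis p_idem proj_sym sym_op_inner power2_norm_eq_inner)
  then have "(norm (proj l x))\<^sup>2 \<le> (norm x)\<^sup>2"
    using norm_minus_p[of x l] zero_le_power2[of "norm (x - proj l x)"] by linarith
  then show ?thesis by (rule power2_le_imp_le) simp
qed

lemma err_pow_contraction:
  assumes "proj L x = x"
  shows "norm ((err L ^^ j) x) \<le> rate ^ j * norm x"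
proof -
  have "proj L ((err L ^^ j) x) = (err L ^^ j) x \<and> norm ((err L ^^ j) x) \<le> rate ^ j * norm x"
  proof (induction j)
    case (Suc j)
    have "norm (err L ((err L ^^ j) x)) \<le> rate * norm ((err L ^^ j) x)"
      using Suc by (intro err_contraction) simp
    also have "\<dots> \<le> rate * (rate ^ j * norm x)"
      using Suc rate_bounds by (intro mult_left_mono) auto
    finally show ?case using Suc err_p[of L "(err L ^^ j) x", symmetric] by (simp add: mult.assoc)
  qed (use assms in simp)
  then show ?thesis by simp
qed

text \<open>At lag \<open>j\<close> the correlation pairs \<open>(err L ^^ j) (proj L h)\<close>
  with \<open>proj L h\<close> at one time. Cauchy-Schwarz, the uniform second moment bound and the
  contraction give \<open>G * (norm h)\<^sup>2 * rate ^ j\<close>.\<close>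

lemma average_second_moment:
  assumes G: "1 \<le> G" and init: "\<And>x. (\<integral>\<omega>. (inner x (dev 0 \<omega>))\<^sup>2 \<partial>\<Omega>) \<le> G * (norm x)\<^sup>2"
    and N: "1 \<le> N"
  shows "(\<integral>\<omega>. (1 / real N * (\<Sum>j = 1..N. inner h (dev j \<omega>)))\<^sup>2 \<partial>\<Omega>) \<le> 2 * (G * (norm h)\<^sup>2) / (1 - rate) / real N"
proof (rule second_moment_average)
  fix i j
  let ?x = "proj L h"
  let ?e = "(err L ^^ j) ?x"
  have "(\<integral>\<omega>. inner h (dev (i + j) \<omega>) * inner h (dev i \<omega>) \<partial>\<Omega>) =
      (\<integral>\<omega>. inner ?x (dev (i + j) \<omega>) * inner ?x (dev i \<omega>) \<partial>\<Omega>)"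
    by (intro Bochner_Integration.integral_cong) (simp_all add: inner_dev_proj)
  also have "\<dots> = (\<integral>\<omega>. inner ?e (dev i \<omega>) * inner ?x (dev i \<omega>) \<partial>\<Omega>)"
    by (rule dev_correlation_shift)
  also have "\<dots> \<le> sqrt (\<integral>\<omega>. (inner ?e (dev i \<omega>))\<^sup>2 \<partial>\<Omega>) * sqrt (\<integral>\<omega>. (inner ?x (dev i \<omega>))\<^sup>2 \<partial>\<Omega>)"
    using integral_mult_le_sqrt[OF dev_sq_integrable[of ?e i] dev_sq_integrable[of ?x i]] by linarith
  also have "\<dots> \<le> sqrt (G * (norm ?e)\<^sup>2) * sqrt (G * (norm ?x)\<^sup>2)"
    by (rule mult_mono[OF real_sqrt_le_mono[OF dev_second_moment[OF G init]]
          real_sqrt_le_mono[OF dev_second_moment[OF G init]]]) (use G in simp_all)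
  also have "\<dots> = G * (norm ?e * norm ?x)"
    using G by (simp add: real_sqrt_mult)
  also have "\<dots> \<le> G * (rate ^ j * norm h * norm h)"
  proof (intro mult_left_mono mult_mono norm_proj_le)
    have "norm ?e \<le> rate ^ j * norm ?x" by (rule err_pow_contraction[OF p_idem])
    also have "\<dots> \<le> rate ^ j * norm h" using rate_bounds(1) norm_proj_le by (intro mult_left_mono) simp_all
    finally show "norm ?e \<le> rate ^ j * norm h" .
  qed (use G rate_bounds(1) in simp_all)
  finally show "(\<integral>\<omega>. inner h (dev (i + j) \<omega>) * inner h (dev i \<omega>) \<partial>\<Omega>) \<le> G * (norm h)\<^sup>2 * rate ^ j"
    by (simp add: power2_eq_square ac_simps)
  show "sq_integrable \<Omega> (\<lambda>\<omega>. inner h (dev j \<omega>))" for j by (rule dev_sq_integrable)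
qed (use G N rate_bounds(1,2) in simp_all)

text \<open>With \<open>q = Jt L x\<close> and \<open>w = A^(1/2) A^(-1) q\<close> one has
  \<open>A^(1/2) w = q\<close> and \<open>|w| = |proj L x| <= |x|\<close>. Thus the scaled
  hypotheses on covariance and mean apply at \<open>w\<close> and yield bounds in terms of
  \<open>norm x\<close>.\<close>

lemma initial_second_moment:
  assumes cov: "mat_norm2 (mat_sqrt (A L) * cov_mat \<Omega> (n L) \<theta>0 * mat_sqrt (A L)) < C0"
    and mean: "vec_norm2 (mean_vec \<Omega> (n L) (\<lambda>\<omega>. mat_sqrt (A L) *\<^sub>v \<theta>0 \<omega>)) < C0"
  shows "(\<integral>\<omega>. (inner x (dev 0 \<omega>))\<^sup>2 \<partial>\<Omega>) \<le> (C0 + (C0 + norm (exact L f))\<^sup>2) * (norm x)\<^sup>2"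
proof -
  let ?N = "n L" and ?R = "mat_sqrt (A L)" and ?K = "cov_mat \<Omega> (n L) \<theta>0"
  define q where "q = Jt L x"
  define \<mu> where "\<mu> = mean_vec \<Omega> ?N \<theta>0"
  have q: "q \<in> carrier_vec ?N" and \<mu>: "\<mu> \<in> carrier_vec ?N" and K: "?K \<in> carrier_mat ?N ?N"
    by (auto simp: q_def \<mu>_def mean_vec_def cov_mat_def)
  note R = mat_sqrt_props[OF A_carrier A_psd, of L]
  define z where "z = Ai L *\<^sub>v q"
  define w where "w = ?R *\<^sub>v z"
  have z: "z \<in> carrier_vec ?N" unfolding z_def by (rule Ai_vec_carrier[OF q])
  have w: "w \<in> carrier_vec ?N" unfolding w_def by (rule mult_mat_vec_carrier[OF R(1) z])
  have Rw: "?R *\<^sub>v w = q"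
    unfolding w_def by (simp only: assoc_mult_mat_vec[OF R(1) R(1) z, symmetric] R(3))
      (simp only: z_def A_Ai_vec[OF q])
  have ww: "scalar_prod w w = (norm (proj L x))\<^sup>2"
  proof -
    have "scalar_prod w w = scalar_prod z q"
      using scalar_prod_sym_mat[OF R(1,2) z w] unfolding Rw by (simp only: w_def)
    also have "q = A L *\<^sub>v z" by (simp only: z_def A_Ai_vec[OF q])
    also have "scalar_prod z (A L *\<^sub>v z) = (norm (J L z))\<^sup>2" by (simp only: norm_J_sq[OF z])
    also have "J L z = proj L x" by (simp only: z_def q_def proj_def sandwich_def)
    finally show ?thesis .
  qed
  have ww_le: "scalar_prod w w \<le> (norm x)\<^sup>2"
    unfolding ww by (rule power_mono[OF norm_proj_le]) simp
  have C0: "0 \<le> C0" using mean vec_norm2_nonneg[of "mean_vec \<Omega> ?N (\<lambda>\<omega>. ?R *\<^sub>v \<theta>0 \<omega>)"] by linarith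
  have int: "integrable \<Omega> (\<lambda>\<omega>. \<theta>0 \<omega> $ i)" if "i < ?N" for i
    by (rule sq_integrable_integrable[OF initial_sq_integrable[OF that]])
  have csq: "sq_integrable \<Omega> (\<lambda>\<omega>. \<theta>0 \<omega> $ i - \<mu> $ i)" if "i < ?N" for i
    using sq_integrable_add[OF initial_sq_integrable[OF that] sq_integrable_const[of "- \<mu> $ i"]] by simp
  define D where "D \<omega> = (\<Sum>i<?N. q $ i * (\<theta>0 \<omega> $ i - \<mu> $ i))" for \<omega>
  define c where "c = scalar_prod q \<mu> - inner x (exact L f)"
  \<comment> \<open>Split into a centred part \<open>D\<close> and a deterministic bias
    \<open>c\<close>; the covariance bound controls the former, the bounds on the initial and target
    means the latter.\<close>
  have dev_eq: "inner x (dev 0 \<omega>) = D \<omega> + c" if "\<omega> \<in> space \<Omega>" for \<omega>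
  proof -
    have "D \<omega> = (\<Sum>i<?N. q $ i * \<theta>0 \<omega> $ i) - (\<Sum>i<?N. q $ i * \<mu> $ i)"
      by (simp add: D_def right_diff_distrib sum_subtractf)
    then have "D \<omega> = scalar_prod q (\<theta>0 \<omega>) - scalar_prod q \<mu>"
      using initial_carrier[OF that] \<mu> by (simp add: scalar_prod_def lessThan_atLeast0)
    then show ?thesis by (simp add: inner_dev_0[OF that] c_def q_def)
  qed
  have Dsq: "sq_integrable \<Omega> D"
    unfolding D_def by (intro sq_integrable_sum sq_integrable_cmult csq) simp
  have ED: "(\<integral>\<omega>. D \<omega> \<partial>\<Omega>) = 0"
  proof -
    have "(\<integral>\<omega>. D \<omega> \<partial>\<Omega>) = (\<Sum>i<?N. q $ i * ((\<integral>\<omega>. \<theta>0 \<omega> $ i \<partial>\<Omega>) - \<mu> $ i))"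
      unfolding D_def using int by (simp add: Bochner_Integration.integral_sum prob_space)
    also have "\<dots> = 0" by (simp add: \<mu>_def mean_vec_def)
    finally show ?thesis .
  qed
  have ED2: "(\<integral>\<omega>. (D \<omega>)\<^sup>2 \<partial>\<Omega>) = scalar_prod q (?K *\<^sub>v q)"
  proof -
    have "(\<integral>\<omega>. (D \<omega>)\<^sup>2 \<partial>\<Omega>) = (\<integral>\<omega>. (\<Sum>i<?N. \<Sum>j<?N. q $ i * q $ j * ((\<theta>0 \<omega> $ i - \<mu> $ i) * (\<theta>0 \<omega> $ j - \<mu> $ j))) \<partial>\<Omega>)"
      unfolding D_def power2_eq_square sum_product by (simp add: ac_simps)
    also have "\<dots> = (\<Sum>i<?N. \<Sum>j<?N. q $ i * q $ j * (\<integral>\<omega>. (\<theta>0 \<omega> $ i - \<mu> $ i) * (\<theta>0 \<omega> $ j - \<mu> $ j) \<partial>\<Omega>))"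
    proof -
      have int2: "integrable \<Omega> (\<lambda>\<omega>. q $ i * q $ j * ((\<theta>0 \<omega> $ i - \<mu> $ i) * (\<theta>0 \<omega> $ j - \<mu> $ j)))"
        if "i \<in> {..<?N}" "j \<in> {..<?N}" for i j
        by (intro integrable_mult_right sq_integrable_mult csq) (use that in simp_all)
      show ?thesis
        by (simp only: Bochner_Integration.integral_sum Bochner_Integration.integrable_sum int2
            integral_mult_right_zero cong: sum.cong)
    qed
    also have "\<dots> = (\<Sum>i<?N. \<Sum>j<?N. q $ i * q $ j * ?K $$ (i, j))"
      by (simp add: cov_mat_def \<mu>_def)
    also have "\<dots> = scalar_prod q (?K *\<^sub>v q)"
      using q K by (simp add: scalar_prod_def lessThan_atLeast0 sum_distrib_left ac_simps)
    finally show ?thesis .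
  qed
  have KV: "scalar_prod q (?K *\<^sub>v q) \<le> C0 * (norm x)\<^sup>2"
  proof -
    have RKR: "?R * ?K * ?R \<in> carrier_mat ?N ?N"
      by (rule mult_carrier_mat[OF mult_carrier_mat[OF R(1) K] R(1)])
    have "?R * ?K * ?R *\<^sub>v w = ?R *\<^sub>v (?K *\<^sub>v q)"
      unfolding assoc_mult_mat_vec[OF mult_carrier_mat[OF R(1) K] R(1) w] Rw
      by (rule assoc_mult_mat_vec[OF R(1) K q])
    then have "scalar_prod q (?K *\<^sub>v q) = scalar_prod w (?R * ?K * ?R *\<^sub>v w)"
      using scalar_prod_sym_mat[OF R(1,2) w mult_mat_vec_carrier[OF K q]] by (simp only: Rw)
    also have "\<dots> \<le> mat_norm2 (?R * ?K * ?R) * scalar_prod w w"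
      by (rule scalar_prod_le_mat_norm2[OF RKR w])
    also have "\<dots> \<le> C0 * scalar_prod w w"
      using cov by (intro mult_right_mono scalar_prod_self_nonneg) simp
    also have "\<dots> \<le> C0 * (norm x)\<^sup>2" by (rule mult_left_mono[OF ww_le C0])
    finally show ?thesis .
  qed
  have "mean_vec \<Omega> ?N (\<lambda>\<omega>. ?R *\<^sub>v \<theta>0 \<omega>) = ?R *\<^sub>v \<mu>"
  proof (rule eq_vecI)
    fix i assume "i < dim_vec (?R *\<^sub>v \<mu>)"
    then have i: "i < ?N" using R(1) by simp
    have "mean_vec \<Omega> ?N (\<lambda>\<omega>. ?R *\<^sub>v \<theta>0 \<omega>) $ i = (\<integral>\<omega>. (\<Sum>j<?N. ?R $$ (i, j) * \<theta>0 \<omega> $ j) \<partial>\<Omega>)"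
      using i unfolding mean_vec_def
      by (auto intro!: Bochner_Integration.integral_cong sum.cong
          simp: carrier_vecD[OF initial_carrier] carrier_matD[OF R(1)] scalar_prod_def lessThan_atLeast0)
    also have "\<dots> = (\<Sum>j<?N. ?R $$ (i, j) * (\<integral>\<omega>. \<theta>0 \<omega> $ j \<partial>\<Omega>))"
      using int by (simp add: Bochner_Integration.integral_sum)
    also have "\<dots> = (?R *\<^sub>v \<mu>) $ i"
      using i by (simp add: carrier_matD[OF R(1)] scalar_prod_def lessThan_atLeast0 \<mu>_def mean_vec_def)
    finally show "mean_vec \<Omega> ?N (\<lambda>\<omega>. ?R *\<^sub>v \<theta>0 \<omega>) $ i = (?R *\<^sub>v \<mu>) $ i" .
  qed (use carrier_matD[OF R(1)] in \<open>simp add: mean_vec_def\<close>)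
  then have Rmu: "vec_norm2 (?R *\<^sub>v \<mu>) \<le> C0" using mean by simp
  have "\<bar>c\<bar> \<le> norm x * (C0 + norm (exact L f))"
  proof -
    have wx: "vec_norm2 w \<le> norm x"
      by (rule power2_le_imp_le) (simp_all add: vec_norm2_sq ww_le)
    have "scalar_prod q \<mu> = scalar_prod w (?R *\<^sub>v \<mu>)"
      using scalar_prod_sym_mat[OF R(1,2) w \<mu>] by (simp only: Rw)
    then have "\<bar>scalar_prod q \<mu>\<bar> \<le> vec_norm2 w * vec_norm2 (?R *\<^sub>v \<mu>)"
      using scalar_prod_le_vec_norm2[OF w mult_mat_vec_carrier[OF R(1) \<mu>]] by simp
    also have "\<dots> \<le> norm x * C0"
      by (rule mult_mono[OF wx Rmu]) simp_all
    finally have "\<bar>scalar_prod q \<mu>\<bar> \<le> norm x * C0" .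
    moreover have "\<bar>inner x (exact L f)\<bar> \<le> norm x * norm (exact L f)"
      by (rule Cauchy_Schwarz_ineq2)
    ultimately show ?thesis unfolding c_def by (simp add: distrib_left)
  qed
  then have "c\<^sup>2 \<le> (norm x * (C0 + norm (exact L f)))\<^sup>2"
    using power_mono[of "\<bar>c\<bar>" _ 2] by simp
  then have c2: "c\<^sup>2 \<le> (C0 + norm (exact L f))\<^sup>2 * (norm x)\<^sup>2"
    by (simp only: power_mult_distrib mult.commute)
  have "(\<integral>\<omega>. (inner x (dev 0 \<omega>))\<^sup>2 \<partial>\<Omega>) = (\<integral>\<omega>. (D \<omega>)\<^sup>2 + (2 * c * D \<omega> + c\<^sup>2) \<partial>\<Omega>)"
    by (intro Bochner_Integration.integral_cong) (simp_all add: dev_eq power2_sum)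
  also have "\<dots> = scalar_prod q (?K *\<^sub>v q) + c\<^sup>2"
    using Dsq sq_integrable_integrable[OF Dsq] ED ED2 by (simp add: sq_integrable_def prob_space)
  finally show ?thesis using KV c2 by (simp add: distrib_right)
qed

end

section \<open>The error of the ergodic average\<close>

lemma comb_injective:
  fixes b :: "nat \<Rightarrow> 'h::real_inner"
  assumes b: "is_basis_of b n U" and x: "x \<in> carrier_vec n" and 0: "comb n b x = 0"
  shows "x = 0\<^sub>v n"
proof (rule eq_vecI)
  fix i assume "i < dim_vec (0\<^sub>v n)"
  then have i: "i < n" by simp
  have inj: "inj_on b {..<n}" and ind: "independent (b ` {..<n})"
    using b by (auto simp: is_basis_of_def)
  let ?u = "\<lambda>v. x $ (the_inv_into {..<n} b v)"
  have "(\<Sum>v\<in>b ` {..<n}. ?u v *\<^sub>R v) = (\<Sum>j<n. (x $ j) *\<^sub>R b j)"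
    by (simp add: sum.reindex[OF inj] the_inv_into_f_f[OF inj])
  then have "(\<Sum>v\<in>b ` {..<n}. ?u v *\<^sub>R v) = 0" using 0 by (simp add: comb_def)
  then have "?u (b i) = 0"
    by (rule real_vector.independentD[OF ind, rotated 2]) (use i in auto)
  then show "x $ i = 0\<^sub>v n $ i" using i by (simp add: the_inv_into_f_f[OF inj])
qed (use x in simp)

lemma comb_surjective:
  fixes b :: "nat \<Rightarrow> 'h::real_inner"
  assumes b: "is_basis_of b n U" and v: "v \<in> U"
  shows "\<exists>x \<in> carrier_vec n. comb n b x = v"
proof -
  have inj: "inj_on b {..<n}" and "v \<in> span (b ` {..<n})"
    using b v by (auto simp: is_basis_of_def)
  then obtain u where "v = (\<Sum>w\<in>b ` {..<n}. u w *\<^sub>R w)"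
    using real_vector.span_finite[of "b ` {..<n}"] by auto
  then have "comb n b (Matrix.vec n (\<lambda>j. u (b j))) = v"
    by (simp add: comb_def sum.reindex[OF inj])
  then show ?thesis by (intro bexI[of _ "Matrix.vec n (\<lambda>j. u (b j))"]) auto
qed

lemma comb_in_space:
  assumes "is_basis_of b n U"
  shows "comb n b x \<in> U"
proof -
  have "(\<Sum>j<n. (x $ j) *\<^sub>R b j) \<in> span (b ` {..<n})"
    by (intro real_vector.span_sum real_vector.span_scale real_vector.span_base) simp
  then show ?thesis using assms by (simp add: comb_def is_basis_of_def)
qed

lemma comb_unit:
  assumes "j < n"
  shows "comb n b (unit_vec n j) = b j"
proof -
  have "comb n b (unit_vec n j) = (\<Sum>i<n. if i = j then b i else 0)"
    unfolding comb_def by (intro sum.cong) (auto simp: unit_vec_def)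
  then show ?thesis using assms by simp
qed

lemma basis_in_space:
  fixes b :: "nat \<Rightarrow> 'h::real_inner"
  shows "is_basis_of b n U \<Longrightarrow> j < n \<Longrightarrow> b j \<in> U"
  using comb_in_space[of b n U "unit_vec n j"] by (simp add: comb_unit)

lemma synth_eq_comb: "synth n \<phi> l = comb (n l) (\<phi> l)"
  by (simp add: synth_def comb_def fun_eq_iff)

text \<open>Column \<open>j\<close> of the matrix holds the fine coordinates of the coarse basis
  element \<open>\<phi> l j\<close>. They exist because the spaces are nested and are recovered by
  \<open>the_inv_into\<close> because synthesis is injective.\<close>

lemma synth_prolongation:
  fixes \<phi> :: "nat \<Rightarrow> nat \<Rightarrow> 'h::real_inner"
  assumes basis: "\<And>l. is_basis_of (\<phi> l) (n l) (Vl l)" and nested: "Vl l \<subseteq> Vl (Suc l)"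
    and x: "x \<in> carrier_vec (n l)"
  shows "synth n \<phi> (Suc l) (prolongation n \<phi> (Suc l) *\<^sub>v x) = synth n \<phi> l x"
proof -
  let ?C = "carrier_vec (n (Suc l)) :: real Matrix.vec set" and ?s = "synth n \<phi> (Suc l)"
  let ?P = "prolongation n \<phi> (Suc l)"
  have inj: "inj_on ?s ?C"
  proof (rule inj_onI)
    fix x y assume x: "x \<in> ?C" and y: "y \<in> ?C" and eq: "?s x = ?s y"
    then have "comb (n (Suc l)) (\<phi> (Suc l)) (x - y) = 0"
      by (simp add: synth_eq_comb comb_diff)
    then have 0: "x - y = 0\<^sub>v (n (Suc l))"
      using x y by (intro comb_injective[OF basis]) auto
    show "x = y"
    proof (rule eq_vecI)
      fix i assume "i < dim_vec y"
      then show "x $ i = y $ i" using arg_cong[OF 0, of "\<lambda>v. v $ i"] x y by simp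
    qed (use x y in simp)
  qed
  define a where "a j = the_inv_into ?C ?s (\<phi> l j)" for j
  have a: "a j \<in> ?C" "?s (a j) = \<phi> l j" if "j < n l" for j
  proof -
    have "\<phi> l j \<in> Vl (Suc l)" using basis_in_space[OF basis that] nested by auto
    then have "\<phi> l j \<in> ?s ` ?C"
      using comb_surjective[OF basis] unfolding synth_eq_comb by (metis imageI)
    then show "a j \<in> ?C" "?s (a j) = \<phi> l j"
      unfolding a_def by (rule the_inv_into_into[OF inj _ subset_refl], rule f_the_inv_into_f[OF inj])
  qed
  have P: "?P $$ (i, j) = a j $ i" if "i < n (Suc l)" "j < n l" for i j
    using that by (simp add: prolongation_def a_def synth_eq_comb comb_unit)
  have dim: "?P \<in> carrier_mat (n (Suc l)) (n l)" by (simp add: prolongation_def)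
  have "?s (?P *\<^sub>v x) = (\<Sum>i<n (Suc l). (\<Sum>j<n l. a j $ i * x $ j) *\<^sub>R \<phi> (Suc l) i)"
    unfolding synth_def
    by (intro sum.cong refl) (use x dim P in \<open>simp add: scalar_prod_def lessThan_atLeast0\<close>)
  also have "\<dots> = (\<Sum>i<n (Suc l). \<Sum>j<n l. (x $ j) *\<^sub>R ((a j $ i) *\<^sub>R \<phi> (Suc l) i))"
    by (simp add: scaleR_sum_left mult.commute)
  also have "\<dots> = (\<Sum>j<n l. (x $ j) *\<^sub>R ?s (a j))"
    by (subst sum.swap) (simp add: synth_def scaleR_sum_right)
  also have "\<dots> = synth n \<phi> l x" unfolding synth_def[of n \<phi> l x] by (intro sum.cong) (simp_all add: a)
  finally show ?thesis .
qed

theorem theorem4p15: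
  fixes D V :: "'h::{real_inner, complete_space} set"
    and T R :: "'h \<Rightarrow> 'h"
    and Vl :: "nat \<Rightarrow> 'h set"
    and n :: "nat \<Rightarrow> nat"
    and \<phi> :: "nat \<Rightarrow> nat \<Rightarrow> 'h"
    and A S Pr :: "nat \<Rightarrow> real mat"
    and g f :: 'h
    and \<Phi> :: "nat \<Rightarrow> real"
    and c\<^sub>1 c\<^sub>2 C\<^sub>A C\<^sub>0 :: real
    and \<nu> :: nat
  assumes separable: "\<exists>Q::'h set. countable Q \<and> closure Q = UNIV"
    and op: "self_adjoint_op D T" "pos_def_op D T" "has_compact_inverse D T"
    and sqrt_op: "is_sqrt_op V R D T"
    and spaces: "\<And>l. subspace (Vl l)" "\<And>l. Vl l \<subseteq> Vl (Suc l)" "\<And>l. Vl l \<subseteq> V"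
    and basis: "\<And>l. is_basis_of (\<phi> l) (n l) (Vl l)"
    and A_eq: "A = stiffness R n \<phi>"
    and Pr_eq: "Pr = prolongation n \<phi>"
    and Phi: "antimono \<Phi>" "\<And>l. 0 \<le> \<Phi> l"
    and c_pos: "0 < c\<^sub>1" "0 < c\<^sub>2"
    and norm_equiv: "\<And>l x. x \<in> carrier_vec (n l) \<Longrightarrow>
          c\<^sub>1 * norm (synth n \<phi> l x) \<le> \<Phi> l * vec_norm2 x \<and>
          \<Phi> l * vec_norm2 x \<le> c\<^sub>2 * norm (synth n \<phi> l x)"
    and nu: "0 < \<nu>" "even \<nu>"
    and splitting: "\<And>l. 1 \<le> l \<Longrightarrow> S l \<in> carrier_mat (n l) (n l)"
          "\<And>l. 1 \<le> l \<Longrightarrow> invertible_mat (S l)"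
          "\<And>l. 1 \<le> l \<Longrightarrow> (S l)\<^sup>T = S l"
    and smoothing: "\<And>l. 1 \<le> l \<Longrightarrow> pos_def_mat (A l)"
          "\<And>l. 1 \<le> l \<Longrightarrow> loewner_le (A l) (S l)"
    and C_A_pos: "0 < C\<^sub>A"
    and approximation: "\<And>l. 1 \<le> l \<Longrightarrow>
          mat_norm2 (mat_sqrt (S l) *
            (mat_inv (A l) - Pr l * mat_inv (A (l - 1)) * (Pr l)\<^sup>T) *
            mat_sqrt (S l)) \<le> C\<^sub>A"
  shows "\<exists>C>0. \<forall>L (\<Omega> :: 'w measure) \<theta>0 \<xi>.
     prob_space \<Omega> \<longrightarrow>
     mgmc_randomness \<Omega> n A S \<nu> L \<theta>0 \<xi> \<longrightarrow>
     mat_norm2 (mat_sqrt (A L) * cov_mat \<Omega> (n L) \<theta>0 * mat_sqrt (A L)) < C\<^sub>0 \<longrightarrow>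
     vec_norm2 (mean_vec \<Omega> (n L) (\<lambda>\<omega>. mat_sqrt (A L) *\<^sub>v \<theta>0 \<omega>)) < C\<^sub>0 \<longrightarrow>
     (\<forall>M\<ge>1.
        let F = load_vec n \<phi> g L;
            f\<^sub>L = load_vec n \<phi> f L;
            I = (\<integral>\<theta>. scalar_prod F \<theta> \<partial>normal_law (n L) (mat_inv (A L) *\<^sub>v f\<^sub>L) (mat_inv (A L)));
            I\<^sub>M = (\<lambda>\<omega>. 1 / real M * (\<Sum>m = 1..M. scalar_prod F
               (mgmc_chain n A S Pr (\<nu> div 2) (\<nu> div 2) L f\<^sub>L \<theta>0 \<xi> m \<omega>)))
        in sqrt (\<integral>\<omega>. \<bar>I - I\<^sub>M \<omega>\<bar>\<^sup>2 \<partial>\<Omega>) \<le> C / sqrt (real M))"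
proof -
  have V: "subspace V" and R_add: "\<And>x y. x \<in> V \<Longrightarrow> y \<in> V \<Longrightarrow> R (x + y) = R x + R y"
    and R_scale: "\<And>c x. x \<in> V \<Longrightarrow> R (c *\<^sub>R x) = c *\<^sub>R R x"
    and D: "D = {x \<in> V. R x \<in> V}" and RR: "\<And>x. x \<in> D \<Longrightarrow> R (R x) = T x"
    using sqrt_op by (auto simp: is_sqrt_op_def self_adjoint_op_def)
  have R_sym: "inner (R x) y = inner x (R y)" if "x \<in> V" "y \<in> V" for x y
    using sqrt_op that unfolding is_sqrt_op_def self_adjoint_op_def by blast
  have V0: "0 \<in> V" by (rule subspace_0[OF V])
  have R0: "R 0 = 0" using R_scale[OF V0, of 0] by simp
  have T_bij: "bij_betw T D UNIV" using op(3) by (simp add: has_compact_inverse_def)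
  have D0: "0 \<in> D" and T0: "T 0 = 0" using V0 R0 RR[of 0] by (auto simp: D)
  \<comment> \<open>\<open>R x = 0\<close> lies in \<open>V\<close>, so \<open>x\<close> is in the
    domain \<open>D\<close> of \<open>T\<close> and \<open>T x = R (R x) = 0\<close>. Injectivity
    and surjectivity of \<open>R\<close> are both inherited from \<open>T\<close>.\<close>
  have R_inj: "x = 0" if "x \<in> V" "R x = 0" for x
  proof -
    have "x \<in> D" using that V0 by (simp add: D)
    moreover have "T x = T 0" using RR[OF calculation] that(2) R0 T0 by simp
    ultimately show ?thesis using T_bij D0 by (auto simp: bij_betw_def dest: inj_onD)
  qed
  have R_surj: "\<exists>x\<in>V. R x = y" for y
  proof -
    obtain x where "x \<in> D" "T x = y" using T_bij by (metis UNIV_I bij_betw_def imageE)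
    then show ?thesis using RR[of x] by (auto simp: D)
  qed
  \<comment> \<open>Since \<open>inner (\<phi> l j) (R h) = inner (R (\<phi> l j)) h\<close>, the
    load vectors of \<open>g\<close> and \<open>f\<close> on every level are \<open>coef\<close> of
    the level-independent elements \<open>h\<close> and \<open>r\<close>.\<close>
  obtain h where h: "h \<in> V" "R h = g" using R_surj by blast
  obtain r where r: "r \<in> V" "R r = f" using R_surj by blast
  define b where "b l j = R (\<phi> l j)" for l j
  have \<phi>V: "\<phi> l j \<in> V" if "j < n l" for l j
    using basis_in_space[OF basis that] spaces(3) by blast
  have synthV: "synth n \<phi> l x \<in> V" for l x
    using comb_in_space[OF basis] spaces(3) unfolding synth_eq_comb by blast
  have R_synth: "R (synth n \<phi> l x) = comb (n l) (b l) x" for l x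
  proof -
    \<comment> \<open>\<open>R\<close> is linear only on \<open>V\<close>, so membership of the
      partial sums in \<open>V\<close> is carried along.\<close>
    have "(\<Sum>j\<in>I. (x $ j) *\<^sub>R \<phi> l j) \<in> V \<and> R (\<Sum>j\<in>I. (x $ j) *\<^sub>R \<phi> l j) = (\<Sum>j\<in>I. (x $ j) *\<^sub>R b l j)"
      if "finite I" "I \<subseteq> {..<n l}" for I
      using that
    proof (induction I rule: finite_induct)
      case (insert j I)
      have "(x $ j) *\<^sub>R \<phi> l j \<in> V" using insert.prems by (intro subspace_scale[OF V] \<phi>V) simp
      then show ?case using insert V \<phi>V by (simp add: R_add R_scale subspace_add b_def)
    qed (simp add: V0 R0)
    from this[of "{..<n l}"] show ?thesis by (simp add: synth_def comb_def)
  qed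
  have load: "load_vec n \<phi> (R y) l = coef (n l) (b l) y" if "y \<in> V" for l y
    by (rule eq_vecI) (use that in \<open>simp_all add: load_vec_def coef_def b_def R_sym \<phi>V\<close>)
  define m where "m = \<nu> div 2"
  have m: "0 < m" "m + m = \<nu>" using nu by (auto simp: m_def)
  interpret G: galerkin_hierarchy n b A S Pr C\<^sub>A m
  proof
    show "A l = gram (n l) (b l)" for l
      unfolding A_eq stiffness_def gram_def b_def by simp
    show "x = 0\<^sub>v (n l)" if x: "x \<in> carrier_vec (n l)" and 0: "comb (n l) (b l) x = 0" for l x
    proof -
      have "synth n \<phi> l x = 0" using R_inj[OF synthV] 0 by (simp add: R_synth)
      then show ?thesis using comb_injective[OF basis x] by (simp add: synth_eq_comb)
    qed
    show "Pr (Suc l) \<in> carrier_mat (n (Suc l)) (n l)" for l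
      by (simp add: Pr_eq prolongation_def)
    show "comb (n (Suc l)) (b (Suc l)) (Pr (Suc l) *\<^sub>v x) = comb (n l) (b l) x" if "x \<in> carrier_vec (n l)" for l x
      unfolding Pr_eq R_synth[symmetric] synth_prolongation[OF basis spaces(2) that] ..
    show "mat_norm2 (mat_sqrt (S (Suc l)) * (mat_inv (A (Suc l)) - Pr (Suc l) * mat_inv (A l) * (Pr (Suc l))\<^sup>T)
        * mat_sqrt (S (Suc l))) \<le> C\<^sub>A" for l
      using approximation[of "Suc l"] by simp
  qed (use splitting smoothing C_A_pos m in auto)
  \<comment> \<open>The bound of \<open>initial_second_moment\<close> with \<open>norm r\<close> in
    place of the norm of the target mean, which is the projection of \<open>r\<close>. The summand 1
    ensures \<open>1 \<le> Gc\<close>; absolute values appear because the sign of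
    \<open>C\<^sub>0\<close> is known only once a chain satisfying the mean bound is given.\<close>
  define Gc where "Gc = 1 + \<bar>C\<^sub>0\<bar> + (\<bar>C\<^sub>0\<bar> + norm r)\<^sup>2"
  define K where "K = 2 * (Gc * (norm h)\<^sup>2) / (1 - G.rate)"
  have Gc: "1 \<le> Gc" by (simp add: Gc_def)
  have K: "0 \<le> K" using Gc G.rate_bounds(2) by (simp add: K_def)
  show ?thesis
    unfolding Let_def
  \<comment> \<open>Adding 1 keeps the constant positive when \<open>h = 0\<close>. \<open>K\<close>
    is fixed before \<open>L\<close>, the probability space and the chain.\<close>
  proof (intro exI[of _ "sqrt K + 1"] conjI allI impI)
    show "0 < sqrt K + 1" using K by (simp add: add_nonneg_pos)
    fix L :: nat and \<Omega> :: "'w measure" and \<theta>0 \<xi> and M :: nat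
    assume \<Omega>: "prob_space \<Omega>" and rand: "mgmc_randomness \<Omega> n A S \<nu> L \<theta>0 \<xi>"
      and cov: "mat_norm2 (mat_sqrt (A L) * cov_mat \<Omega> (n L) \<theta>0 * mat_sqrt (A L)) < C\<^sub>0"
      and mean: "vec_norm2 (mean_vec \<Omega> (n L) (\<lambda>\<omega>. mat_sqrt (A L) *\<^sub>v \<theta>0 \<omega>)) < C\<^sub>0"
      and M: "1 \<le> M"
    interpret prob_space \<Omega> by (rule \<Omega>)
    let ?F = "load_vec n \<phi> g L" and ?f = "load_vec n \<phi> f L"
    have F: "?F = coef (n L) (b L) h" and fL: "?f = coef (n L) (b L) r"
      using load[OF h(1), of L] load[OF r(1), of L] by (simp_all add: h r)
    interpret X: mgmc_process n b A S Pr "C\<^sub>A" m \<Omega> L ?f \<theta>0 \<xi>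
      by unfold_locales (use rand m in \<open>simp_all add: fL\<close>)
    have exact: "G.exact L ?f = G.proj L r"
      by (simp add: G.exact_def G.proj_def sandwich_def fL)
    have C0: "0 \<le> C\<^sub>0"
      using mean vec_norm2_nonneg[of "mean_vec \<Omega> (n L) (\<lambda>\<omega>. mat_sqrt (A L) *\<^sub>v \<theta>0 \<omega>)"] by linarith
    have init: "(\<integral>\<omega>. (inner x (X.dev 0 \<omega>))\<^sup>2 \<partial>\<Omega>) \<le> Gc * (norm x)\<^sup>2" for x
    proof -
      have "(C\<^sub>0 + norm (G.exact L ?f))\<^sup>2 \<le> (\<bar>C\<^sub>0\<bar> + norm r)\<^sup>2"
        unfolding exact using X.norm_proj_le[of L r] C0 by (intro power_mono add_mono) simp_all
      then have "C\<^sub>0 + (C\<^sub>0 + norm (G.exact L ?f))\<^sup>2 \<le> Gc"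
        using abs_ge_self[of C\<^sub>0] unfolding Gc_def by linarith
      then show ?thesis
        using X.initial_second_moment[OF cov mean, of x] mult_right_mono[of _ Gc "(norm x)\<^sup>2"]
        by (meson order_trans zero_le_power2)
    qed
    let ?u = "mat_inv (A L) *\<^sub>v ?f"
    have u: "?u \<in> carrier_vec (n L)" by (rule G.Ai_vec_carrier) (simp add: fL)
    have FJ: "scalar_prod ?F x = inner h (comb (n L) (b L) x)" if "x \<in> carrier_vec (n L)" for x
      using comm_scalar_prod[OF that coef_carrier[of "n L" "b L" h]] that
      by (simp add: F inner_comb inner_commute[of h])
    have I: "(\<integral>\<theta>. scalar_prod ?F \<theta> \<partial>normal_law (n L) ?u (mat_inv (A L))) = inner h (G.exact L ?f)"
      using normal_law_linear(2)[OF u G.Ai_carrier G.Ai_psd, of ?F] FJ[OF u]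
      by (simp add: F G.exact_def)
    let ?I = "\<integral>\<theta>. scalar_prod ?F \<theta> \<partial>normal_law (n L) ?u (mat_inv (A L))"
    let ?IM = "\<lambda>\<omega>. 1 / real M * (\<Sum>j = 1..M. scalar_prod ?F
        (mgmc_chain n A S Pr (\<nu> div 2) (\<nu> div 2) L ?f \<theta>0 \<xi> j \<omega>))"
    have diff: "?IM \<omega> - ?I = 1 / real M * (\<Sum>j = 1..M. inner h (X.dev j \<omega>))" if "\<omega> \<in> space \<Omega>" for \<omega>
    proof -
      have "inner h (X.dev j \<omega>) = scalar_prod ?F (mgmc_chain n A S Pr (\<nu> div 2) (\<nu> div 2) L ?f \<theta>0 \<xi> j \<omega>) - ?I" for j
        unfolding X.dev_def inner_diff_right I FJ[OF X.state_step(1)[OF that], symmetric]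
        by (simp add: X.state_def flip: m_def)
      then have "(\<Sum>j = 1..M. inner h (X.dev j \<omega>)) = (\<Sum>j = 1..M. scalar_prod ?F
          (mgmc_chain n A S Pr (\<nu> div 2) (\<nu> div 2) L ?f \<theta>0 \<xi> j \<omega>)) - real M * ?I"
        by (simp only: sum_subtractf) simp
      then show ?thesis using M by (simp add: right_diff_distrib)
    qed
    have "(\<integral>\<omega>. \<bar>?I - ?IM \<omega>\<bar>\<^sup>2 \<partial>\<Omega>) = (\<integral>\<omega>. (1 / real M * (\<Sum>j = 1..M. inner h (X.dev j \<omega>)))\<^sup>2 \<partial>\<Omega>)"
      by (intro Bochner_Integration.integral_cong) (simp_all only: power2_abs power2_commute[of ?I] diff)
    also have "\<dots> \<le> K / real M"
      unfolding K_def by (rule X.average_second_moment[OF Gc init M])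
    finally have "sqrt (\<integral>\<omega>. \<bar>?I - ?IM \<omega>\<bar>\<^sup>2 \<partial>\<Omega>) \<le> sqrt K / sqrt (real M)"
      using real_sqrt_le_mono[of _ "K / real M"] by (simp add: real_sqrt_divide)
    also have "\<dots> \<le> (sqrt K + 1) / sqrt (real M)" by (simp add: divide_right_mono)
    finally show "sqrt (\<integral>\<omega>. \<bar>?I - ?IM \<omega>\<bar>\<^sup>2 \<partial>\<Omega>) \<le> (sqrt K + 1) / sqrt (real M)" .
  qed
qed

end
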